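(* Let $d\ge 2$. Let $(X,\sigma)$ be a symbolic system having a family of patterns $\mathcal{C}$ with property $F$, and let $(Y,T)$ be a shift space with $h_{top}(Y,T)<h(\mathcal{C})$. Then there is an equivariant Borel embedding (an injective equivariant Borel map) from $\mathrm{Free}(Y)$ to $X$.
   Context: A symbolic system is a shift-invariant subset $X\subseteq\mathcal{A}^{\mathbb{Z}^d}$, $\mathcal{A}$ finite, with shift $(\sigma^\gamma x)_\delta=x_{\gamma+\delta}$; a shift space is a closed such set; $\mathrm{Free}(Y)=\{y:\sigma^\gamma y\ne y\ \forall\gamma\ne\bar 0\}$; $h_{top}$ is topological entropy. For $B\subseteq\mathbb{Z}^d$, $\mathcal{L}(X,B)=\{x|_B:x\in X\}$. A set $B\subseteq\mathbb{Z}^d$ is a $k$-grid union if there exist $C\subseteq k\mathbb{Z}^d$ and $\gamma\in\mathbb{Z}^d$ with $B=\gamma+C+[1,k]^d$ and both $B$ and $\mathbb{Z}^d\setminus B$ connected (edges $\{\alpha,\alpha\pm\epsilon^i\}$). A family of patterns is a translation-invariant collection $\mathcal{C}=(P_C)$ indexed by $k$-grid unions $C$ with $P_C\subseteq\mathcal{L}(X,C)$ (a pattern on $C$ is in $P_C$ iff its translate to $C+\alpha$ is in $P_{C+\alpha}$). It has property $F$ (with gap $m$) if: (1) for all $k$-grid unions $C,C_1,\dots,C_r$ and $c_i\in P_{C_i}$ with the $C_j+[-m,m]^d$ pairwise disjoint and contained in $C$, there is $c\in P_C$ with $c|_{C_j}=c_j$ for all $j$; (2) if $x\in\mathcal{A}^{\mathbb{Z}^d}$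 and $x|_{C}\in P_C$ for every $C$ in some increasing sequence of $k$-grid unions covering $\mathbb{Z}^d$, then $x\in X$. Its entropy is $h(\mathcal{C})=\liminf_{n\to\infty}(nk)^{-d}\log|P_{[1,nk]^d}|$. *)

theory Defs
  imports "HOL-Analysis.Analysis"
begin

(* Points of Z^d are vectors  int^'d  with 'd a finite index type, d = CARD('d).
   Configurations over a finite alphabet 'a are functions  int^'d \<Rightarrow> 'a. *)

definition shift :: "int^'d \<Rightarrow> (int^'d \<Rightarrow> 'a) \<Rightarrow> (int^'d \<Rightarrow> 'a)" where
  "shift \<gamma> x = (\<lambda>\<delta>. x (\<gamma> + \<delta>))"

definition shift_invariant :: "(int^'d \<Rightarrow> 'a) set \<Rightarrow> bool" where
  "shift_invariant X \<longleftrightarrow> (\<forall>\<gamma>. \<forall>x\<in>X. shift \<gamma> x \<in> X)"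

definition config_topology :: "(int^'d \<Rightarrow> 'a) topology" where
  "config_topology = product_topology (\<lambda>_. discrete_topology UNIV) UNIV"

definition borel_of :: "'x topology \<Rightarrow> 'x measure" where
  "borel_of T = sigma (topspace T) {U. openin T U}"

definition symbolic_system :: "(int^'d \<Rightarrow> 'a::finite) set \<Rightarrow> bool" where
  "symbolic_system X \<longleftrightarrow> shift_invariant X"

definition shift_space :: "(int^'d \<Rightarrow> 'a::finite) set \<Rightarrow> bool" where
  "shift_space X \<longleftrightarrow> shift_invariant X \<and> closedin config_topology X"

definition Free :: "(int^'d \<Rightarrow> 'a) set \<Rightarrow> (int^'d \<Rightarrow> 'a) set" where
  "Free Y = {y \<in> Y. \<forall>\<gamma>. \<gamma> \<noteq> 0 \<longrightarrow> shift \<gamma> y \<noteq> y}"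

(* language: patterns x|_B, represented as functions restricted to B (undefined outside) *)
definition lang :: "(int^'d \<Rightarrow> 'a) set \<Rightarrow> (int^'d) set \<Rightarrow> (int^'d \<Rightarrow> 'a) set" where
  "lang X B = (\<lambda>x. restrict x B) ` X"

definition box_d :: "int \<Rightarrow> int \<Rightarrow> (int^'d) set" where
  "box_d a b = {v. \<forall>i. a \<le> v$i \<and> v$i \<le> b}"

definition adjacent :: "int^'d \<Rightarrow> int^'d \<Rightarrow> bool" where
  "adjacent \<alpha> \<beta> \<longleftrightarrow> (\<exists>i. \<bar>\<beta>$i - \<alpha>$i\<bar> = 1 \<and> (\<forall>j. j \<noteq> i \<longrightarrow> \<beta>$j = \<alpha>$j))"

definition lattice_connected :: "(int^'d) set \<Rightarrow> bool" where
  "lattice_connected S \<longleftrightarrow>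
     (\<forall>a\<in>S. \<forall>b\<in>S. (\<lambda>u v. u \<in> S \<and> v \<in> S \<and> adjacent u v)\<^sup>*\<^sup>* a b)"

definition grid_union :: "nat \<Rightarrow> (int^'d) set \<Rightarrow> bool" where
  "grid_union k B \<longleftrightarrow>
     (\<exists>C \<gamma>. finite C \<and> C \<subseteq> {v. \<forall>i. int k dvd v$i} \<and>
        B = {\<gamma> + c + u | c u. c \<in> C \<and> u \<in> box_d 1 (int k)}) \<and>
     lattice_connected B \<and> lattice_connected (UNIV - B)"

definition translate_pat :: "int^'d \<Rightarrow> (int^'d \<Rightarrow> 'a) \<Rightarrow> (int^'d \<Rightarrow> 'a)" where
  "translate_pat \<alpha> p = (\<lambda>\<delta>. p (\<delta> - \<alpha>))"

definition translate_set :: "int^'d \<Rightarrow> (int^'d) set \<Rightarrow> (int^'d) set" where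
  "translate_set \<alpha> C = (\<lambda>\<beta>. \<beta> + \<alpha>) ` C"

definition family_of_patterns ::
  "(int^'d \<Rightarrow> 'a) set \<Rightarrow> nat \<Rightarrow> ((int^'d) set \<Rightarrow> (int^'d \<Rightarrow> 'a) set) \<Rightarrow> bool" where
  "family_of_patterns X k P \<longleftrightarrow> k \<ge> 1 \<and>
     (\<forall>C. grid_union k C \<longrightarrow> P C \<subseteq> lang X C) \<and>
     (\<forall>C \<alpha> p. grid_union k C \<longrightarrow>
        (p \<in> P C \<longleftrightarrow> translate_pat \<alpha> p \<in> P (translate_set \<alpha> C)))"

definition property_F ::
  "(int^'d \<Rightarrow> 'a) set \<Rightarrow> nat \<Rightarrow> ((int^'d) set \<Rightarrow> (int^'d \<Rightarrow> 'a) set) \<Rightarrow> nat \<Rightarrow> bool" where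
  "property_F X k P m \<longleftrightarrow>
     (\<forall>C (r::nat) Cs cs.
        grid_union k C \<and> (\<forall>j<r. grid_union k (Cs j) \<and> cs j \<in> P (Cs j)) \<and>
        (\<forall>i<r. \<forall>j<r. i \<noteq> j \<longrightarrow>
            (Cs i + box_d (- int m) (int m)) \<inter> (Cs j + box_d (- int m) (int m)) = {}) \<and>
        (\<forall>j<r. Cs j + box_d (- int m) (int m) \<subseteq> C)
        \<longrightarrow> (\<exists>c\<in>P C. \<forall>j<r. restrict c (Cs j) = cs j)) \<and>
     (\<forall>x Bs. (\<forall>n. grid_union k (Bs n)) \<and> incseq Bs \<and> (\<Union>n. Bs n) = UNIV \<and>
              (\<forall>n. restrict x (Bs n) \<in> P (Bs n)) \<longrightarrow> x \<in> X)"

definition family_entropy :: "nat \<Rightarrow> ((int^'d) set \<Rightarrow> (int^'d \<Rightarrow> 'a) set) \<Rightarrow> ereal" where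
  "family_entropy k P =
     liminf (\<lambda>n. ereal (ln (real (card (P (box_d 1 (int (n * k)) :: (int^'d) set))))
                        / (real (n * k)) ^ CARD('d)))"

definition htop :: "(int^'d \<Rightarrow> 'a) set \<Rightarrow> real" where
  "htop Y = lim (\<lambda>n. ln (real (card (lang Y (box_d 1 (int n) :: (int^'d) set))))
                      / (real n) ^ CARD('d))"

end

theory Submission
  imports Defs
begin

text \<open>
  Greedy colourings of the free part give Borel marker sets at rapidly growing scales \<open>r n\<close> such that,
  in every orbit, markers of the same scale are \<open>100 * r n\<close> apart and every finite set is deep inside the
  cube of radius \<open>2 * r n\<close> around some marker, for infinitely many \<open>n\<close>: there is a bounded number of
  colour classes at each scale, and one colour is good for infinitely many scales. Enlarging these cubes so
  that they swallow all smaller pieces they touch, and filling the holes, gives a toast, a Borel family of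
  grid unions which are pairwise nested or far apart. Patterns are chosen on the pieces by induction on the
  scale, extending the patterns on smaller pieces by property F. On the part of a piece that is not covered
  by smaller pieces we place code boxes on a lattice based at the centre of the piece. They carry the point
  of \<open>Y\<close>, which is possible because \<open>Y\<close> has smaller entropy and the boundary of a piece is negligible.
  An array of equal marker words at the centre makes the pieces recognisable: the marker word is chosen so
  that the array cannot be matched with a code box out of phase. One further box per scale tells whether
  the piece has that scale. So the image of a point determines, scale by scale, all pieces, and hence the point.
\<close>

text \<open>Property F leaves a pattern uncontrolled off the prescribed boxes, so arrays that look
  like markers may arise by accident. They are excluded indirectly. Every point has a code box
  within distance \<open>K = 3 * s * k\<close>, and an array has extent
  \<open>6 * k * s = 2 * K\<close>, so any array must agree with a genuine code box wherever the two
  overlap. Only words of the code are compared with arrays, and counting suffices: a word that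
  matches an array out of phase is determined by few of its symbols.

  Decoding runs by induction on the level, because the code boxes of a piece are located by means of
  the smaller pieces. Hence the positions of the boxes and the coding injection are chosen from the
  pieces alone, not from the content of the point of \<open>Y\<close>.

  Grid unions must have connected complement, and this is where dimension at least 2 enters: the
  complement of a cube is then connected, so that holes can be filled. The entropy gap enters the
  coding as the factor 2 in \<open>2 * b \<le> card Q\<close>; it pays for the cells near the
  boundary of a piece and for the boxes that carry no data.\<close>

definition nrm :: "int^'d \<Rightarrow> int" where
  "nrm v = Max (range (\<lambda>i. \<bar>v$i\<bar>))"

lemma nrm_le_iff: "nrm v \<le> R \<longleftrightarrow> (\<forall>i. \<bar>v$i\<bar> \<le> R)"
  unfolding nrm_def by (subst Max_le_iff) auto

lemma comp_le_nrm: "\<bar>v$i\<bar> \<le> nrm v"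
  using nrm_le_iff[of v "nrm v"] by simp

lemma nrm_nonneg [simp]: "0 \<le> nrm v"
  using comp_le_nrm[of v undefined] by linarith

lemma nrm_zero [simp]: "nrm 0 = 0"
  by (rule antisym) (simp_all add: nrm_le_iff)

lemma nrm_eq_0 [simp]: "nrm v = 0 \<longleftrightarrow> v = 0"
proof
  assume "nrm v = 0"
  then show "v = 0" using nrm_le_iff[of v 0] by (simp add: vec_eq_iff)
qed simp

lemma nrm_minus [simp]: "nrm (- v) = nrm v"
  by (simp add: nrm_def)

lemma nrm_commute: "nrm (u - v) = nrm (v - u)"
  using nrm_minus[of "v - u"] by simp

lemma nrm_triangle: "nrm (u + v) \<le> nrm u + nrm v"
proof -
  have "\<bar>(u + v)$i\<bar> \<le> nrm u + nrm v" for i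
    using comp_le_nrm[of u i] comp_le_nrm[of v i] by simp
  then show ?thesis by (simp add: nrm_le_iff)
qed

lemma nrm_triangle_diff: "nrm (u - w) \<le> nrm (u - v) + nrm (v - w)"
  using nrm_triangle[of "u - v" "v - w"] by simp

lemma nrm_axis: "nrm (axis i c) = \<bar>c\<bar>"
proof (rule antisym)
  show "nrm (axis i c) \<le> \<bar>c\<bar>" by (auto simp: nrm_le_iff axis_def)
  show "\<bar>c\<bar> \<le> nrm (axis i c)" using comp_le_nrm[of "axis i c" i] by (simp add: axis_def)
qed

section \<open>Cubes and thickenings in the sup norm\<close>

definition cb :: "int^'d \<Rightarrow> int \<Rightarrow> (int^'d) set" where
  "cb v R = {p. nrm (p - v) \<le> R}"

definition thick :: "int \<Rightarrow> (int^'d) set \<Rightarrow> (int^'d) set" where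
  "thick h S = {p. \<exists>u\<in>S. nrm (p - u) \<le> h}"

lemma mem_cb [simp]: "p \<in> cb v R \<longleftrightarrow> nrm (p - v) \<le> R"
  by (simp add: cb_def)

lemma mem_thick: "p \<in> thick h S \<longleftrightarrow> (\<exists>u\<in>S. nrm (p - u) \<le> h)"
  by (simp add: thick_def)

lemma thick_mono: assumes "S \<subseteq> T" "h \<le> h'" shows "thick h S \<subseteq> thick h' T"
proof
  fix x assume "x \<in> thick h S"
  then obtain u where "u \<in> S" "nrm (x - u) \<le> h" by (auto simp: thick_def)
  with assms show "x \<in> thick h' T" unfolding mem_thick by (intro bexI[of _ u]) auto
qed

lemma subset_thick: assumes "0 \<le> h" shows "S \<subseteq> thick h S"
proof
  fix x assume "x \<in> S"
  with assms show "x \<in> thick h S" unfolding mem_thick by (intro bexI[of _ x]) simp_all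
qed

lemma thick_thick: "thick h (thick h' S) \<subseteq> thick (h + h') S"
proof
  fix p assume "p \<in> thick h (thick h' S)"
  then obtain u v where "v \<in> S" "nrm (p - u) \<le> h" "nrm (u - v) \<le> h'" by (auto simp: thick_def)
  then show "p \<in> thick (h + h') S"
    unfolding mem_thick using nrm_triangle_diff[of p v u] by (intro bexI[of _ v]) auto
qed

lemma thick_empty [simp]: "thick h {} = {}" by (simp add: thick_def)

lemma box_d_symmetric: "box_d (- R) R = cb (0::int^'d) R"
proof -
  have "(\<forall>i. - R \<le> v$i \<and> v$i \<le> R) \<longleftrightarrow> nrm v \<le> R" for v :: "int^'d"
    unfolding nrm_le_iff by (metis abs_le_iff minus_le_iff)
  then show ?thesis by (auto simp: box_d_def)
qed

lemma set_plus_box: "S + box_d (- h) h = thick h S"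
proof (intro equalityI subsetI)
  fix p assume "p \<in> S + box_d (- h) h"
  then show "p \<in> thick h S"
    unfolding box_d_symmetric by (auto simp: set_plus_def thick_def) (metis add_diff_cancel_left')
next
  fix p assume "p \<in> thick h S"
  then obtain u where "u \<in> S" "nrm (p - u) \<le> h" by (auto simp: thick_def)
  then show "p \<in> S + box_d (- h) h"
    unfolding box_d_symmetric set_plus_def by (intro CollectI bexI[of _ u] bexI[of _ "p - u"]) auto
qed

lemma finite_box_d [simp]: "finite (box_d a b)"
proof -
  have "box_d a b \<subseteq> (\<lambda>f. \<chi> i. f i) ` (UNIV \<rightarrow>\<^sub>E {a..b})"
  proof
    fix v :: "int^'d" assume "v \<in> box_d a b"
    then show "v \<in> (\<lambda>f. \<chi> i. f i) ` (UNIV \<rightarrow>\<^sub>E {a..b})"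
      by (intro image_eqI[of _ _ "\<lambda>i. v$i"]) (auto simp: box_d_def)
  qed
  then show ?thesis by (rule finite_subset) (intro finite_imageI finite_PiE; simp)
qed

lemma card_box_d: "card (box_d a b :: (int^'d) set) = nat (b - a + 1) ^ CARD('d)"
proof -
  have "bij_betw (\<lambda>f. \<chi> i. f i) (UNIV \<rightarrow>\<^sub>E {a..b}) (box_d a b :: (int^'d) set)"
    by (rule bij_betwI[where g = "\<lambda>v i. v$i"]) (auto simp: box_d_def)
  then have "card (box_d a b :: (int^'d) set) = card ((UNIV::'d set) \<rightarrow>\<^sub>E {a..b})"
    by (metis bij_betw_same_card)
  then show ?thesis by (simp add: card_PiE)
qed

lemma cb_eq_translate: "cb v R = (+) v ` cb 0 R"
proof (intro equalityI subsetI)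
  fix p assume "p \<in> cb v R" then show "p \<in> (+) v ` cb 0 R" by (intro image_eqI[of _ _ "p - v"]) auto
qed auto

lemma finite_cb [simp]: "finite (cb v R)"
  unfolding cb_eq_translate[of v] box_d_symmetric[symmetric] by (intro finite_imageI finite_box_d)

lemma card_cb: "card (cb v R :: (int^'d) set) = nat (2 * R + 1) ^ CARD('d)"
proof -
  have "card (cb v R) = card (cb 0 R :: (int^'d) set)"
    unfolding cb_eq_translate[of v] by (rule card_image) simp
  then show ?thesis using card_box_d[of "-R" R, where 'd='d] by (simp add: box_d_symmetric)
qed

lemma thick_cb_subset: "thick h (cb v R) \<subseteq> cb v (R + h)"
proof
  fix p assume "p \<in> thick h (cb v R)"
  then obtain u where "nrm (u - v) \<le> R" "nrm (p - u) \<le> h" by (auto simp: thick_def)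
  then show "p \<in> cb v (R + h)" using nrm_triangle_diff[of p v u] by simp
qed

subsection \<open>Connectivity\<close>

definition lattice_step :: "(int^'d) set \<Rightarrow> int^'d \<Rightarrow> int^'d \<Rightarrow> bool" where
  "lattice_step S u v \<longleftrightarrow> u \<in> S \<and> v \<in> S \<and> adjacent u v"

abbreviation "reaches S \<equiv> (lattice_step S)\<^sup>*\<^sup>*"

lemma lattice_connected_iff: "lattice_connected S \<longleftrightarrow> (\<forall>a\<in>S. \<forall>b\<in>S. reaches S a b)"
  by (simp add: lattice_connected_def lattice_step_def[abs_def])

lemma adjacent_sym: "adjacent u v \<longleftrightarrow> adjacent v u"
  unfolding adjacent_def by (metis abs_minus_commute)

lemma reaches_sym: "reaches S u v \<Longrightarrow> reaches S v u"
proof (induction rule: rtranclp_induct)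
  case (step y z)
  then have "lattice_step S z y" using adjacent_sym by (auto simp: lattice_step_def)
  then show ?case using step.IH by (rule converse_rtranclp_into_rtranclp)
qed simp

lemma reaches_mono:
  assumes "S \<subseteq> T" "reaches S u v"
  shows "reaches T u v"
proof -
  have "lattice_step S \<le> lattice_step T" using assms(1) by (auto simp: lattice_step_def)
  then show ?thesis using rtranclp_mono[of "lattice_step S" "lattice_step T"] assms(2) by (auto dest: predicate2D)
qed

lemma reaches_mem: "reaches S u v \<Longrightarrow> u \<in> S \<Longrightarrow> v \<in> S"
  by (erule rtranclp_induct) (simp_all add: lattice_step_def)

text \<open>Turns reachability in \<open>S\<close> into reachability inside a component of
  \<open>S\<close>, which is what connectedness of the component itself asks for.\<close>

lemma reaches_closed:
  assumes "reaches S u v" "u \<in> A" "\<And>x y. x \<in> A \<Longrightarrow> lattice_step S x y \<Longrightarrow> y \<in> A"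
  shows "reaches (S \<inter> A) u v \<and> v \<in> A"
  using assms(1)
proof (induction rule: rtranclp_induct)
  case base then show ?case using assms(2) by simp
next
  case (step y z)
  then have "z \<in> A" using assms(3) by blast
  then have "lattice_step (S \<inter> A) y z" using step by (auto simp: lattice_step_def)
  with step.IH show ?case using \<open>z \<in> A\<close> rtranclp.rtrancl_into_rtrancl[of "lattice_step (S \<inter> A)" u y z] by simp
qed

lemma lattice_connectedI:
  assumes "c \<in> S" "\<And>a. a \<in> S \<Longrightarrow> reaches S a c"
  shows "lattice_connected S"
  unfolding lattice_connected_iff using assms reaches_sym by (meson rtranclp_trans)

lemma lattice_connectedD: "lattice_connected S \<Longrightarrow> a \<in> S \<Longrightarrow> b \<in> S \<Longrightarrow> reaches S a b"
  by (simp add: lattice_connected_iff)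

lemma adjacent_axis: "adjacent p (p + axis i 1)" "adjacent p (p - axis i 1)"
  unfolding adjacent_def by (auto simp: axis_def intro!: exI[of _ i])

lemma reaches_axis:
  assumes "\<And>j. 0 \<le> j \<Longrightarrow> j \<le> t \<Longrightarrow> p + axis i j \<in> S" and "0 \<le> t"
  shows "reaches S p (p + axis i t)"
  using assms(2,1)
proof (induction t rule: int_ge_induct)
  case base
  then show ?case by (simp add: axis_def vec_eq_iff zero_vec_def[symmetric])
next
  case (step t)
  have e: "p + axis i (t + 1) = (p + axis i t) + axis i 1" by (simp add: axis_def vec_eq_iff)
  have "lattice_step S (p + axis i t) (p + axis i (t + 1))"
    unfolding lattice_step_def using step.prems[of t] step.prems[of "t+1"] step.hyps adjacent_axis(1)[of "p + axis i t" i] by (simp add: e)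
  moreover have "reaches S p (p + axis i t)" by (rule step.IH) (use step.prems in auto)
  ultimately show ?case by (rule rtranclp.rtrancl_into_rtrancl[rotated])
qed

lemma reaches_update:
  assumes "\<And>j. min (p$i) c \<le> j \<Longrightarrow> j \<le> max (p$i) c \<Longrightarrow> (\<chi> l. if l = i then j else p$l) \<in> S"
  shows "reaches S p (\<chi> l. if l = i then c else p$l)"
proof (cases "p$i \<le> c")
  case True
  have e: "p + axis i t = (\<chi> l. if l = i then p$i + t else p$l)" for t by (simp add: axis_def vec_eq_iff)
  have "reaches S p (p + axis i (c - p$i))"
    by (rule reaches_axis) (use True assms in \<open>auto simp: e\<close>)
  moreover have "p + axis i (c - p$i) = (\<chi> l. if l = i then c else p$l)" by (simp add: axis_def vec_eq_iff)
  ultimately show ?thesis by simp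
next
  case False
  define u where "u = (\<chi> l. if l = i then c else p$l)"
  have e: "u + axis i t = (\<chi> l. if l = i then c + t else p$l)" for t by (simp add: axis_def vec_eq_iff u_def)
  have "reaches S u (u + axis i (p$i - c))"
    by (rule reaches_axis) (use False assms in \<open>auto simp: e\<close>)
  moreover have "u + axis i (p$i - c) = p" by (simp add: e vec_eq_iff)
  ultimately show ?thesis using reaches_sym u_def by simp
qed

text \<open>A path from \<open>a\<close> to \<open>b\<close> changes one coordinate at a time;
  \<open>F\<close> is the set of coordinates already changed.\<close>

lemma lattice_connected_rect:
  assumes S: "S = {v::int^'d. \<forall>i. lo$i \<le> v$i \<and> v$i \<le> hi$i}"
  shows "lattice_connected S"
proof -
  { fix a b assume a: "a \<in> S" and b: "b \<in> S"
    have "reaches S a (\<chi> l. if l \<in> F then b$l else a$l)" if "finite F" for F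
      using that
    proof (induction F)
      case empty
      have "a = (\<chi> l. if l \<in> {} then b$l else a$l)" by (simp add: vec_eq_iff)
      then show ?case by auto
    next
      case (insert i F)
      let ?p = "\<chi> l. if l \<in> F then b$l else a$l"
      have "reaches S ?p (\<chi> l. if l = i then b$i else ?p$l)"
      proof (rule reaches_update)
        fix j assume j: "min (?p$i) (b$i) \<le> j" "j \<le> max (?p$i) (b$i)"
        have "lo$i \<le> j \<and> j \<le> hi$i" using j a b insert.hyps unfolding S by (auto simp: min_def max_def split: if_splits dest: spec[of _ i]) 
        then show "(\<chi> l. if l = i then j else ?p$l) \<in> S" using a b unfolding S by auto
      qed
      moreover have "(\<chi> l. if l = i then b$i else ?p$l) = (\<chi> l. if l \<in> insert i F then b$l else a$l)"
        by (auto simp: vec_eq_iff)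
      ultimately show ?case using insert.IH by (metis (no_types, lifting) rtranclp_trans)
    qed
    from this[of UNIV] have "reaches S a b" by simp }
  then show ?thesis by (simp add: lattice_connected_iff)
qed

lemma cb_eq_rect: "cb v R = {u. \<forall>i. (\<chi> i. v$i - R)$i \<le> u$i \<and> u$i \<le> (\<chi> i. v$i + R)$i}"
  unfolding cb_def nrm_le_iff by (auto simp: abs_le_iff) (smt (verit))+

lemma lattice_connected_cb: "lattice_connected (cb v R)"
  by (rule lattice_connected_rect[OF cb_eq_rect])

lemma lattice_connected_thick:
  assumes "lattice_connected S" "0 \<le> h"
  shows "lattice_connected (thick h S)"
proof (cases "S = {}")
  case False
  then obtain c where c: "c \<in> S" by auto
  show ?thesis
  proof (rule lattice_connectedI)
    show "c \<in> thick h S" using c subset_thick assms(2) by blast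
    fix a assume "a \<in> thick h S"
    then obtain u where u: "u \<in> S" "nrm (a - u) \<le> h" by (auto simp: thick_def)
    have "cb u h \<subseteq> thick h S" using u by (auto simp: thick_def)
    moreover have "reaches (cb u h) a u" using lattice_connectedD[OF lattice_connected_cb, of a u h u] u assms(2) by simp
    ultimately have 1: "reaches (thick h S) a u" using reaches_mono by blast
    have "reaches S u c" using assms(1) u c by (simp add: lattice_connected_iff)
    then have "reaches (thick h S) u c" using reaches_mono subset_thick assms(2) by blast
    with 1 show "reaches (thick h S) a c" by simp
  qed
qed (simp add: lattice_connected_def)

text \<open>Outside a rectangle, a coordinate that leaves its range may be kept fixed while all the others
  are moved; a second coordinate direction is what makes room to go around.\<close>

lemma lattice_connected_compl_rect:
  fixes lo hi :: "int^'d"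
  assumes "CARD('d) \<ge> 2"
  shows "lattice_connected (UNIV - {v. \<forall>i. lo$i \<le> v$i \<and> v$i \<le> hi$i})" (is "lattice_connected ?S")
proof -
  have mem: "p \<in> ?S" if "p$i < lo$i \<or> hi$i < p$i" for p i
    using that by (auto intro: exI[of _ i])
  have move: "reaches ?S p q" if pi: "p$i < lo$i \<or> hi$i < p$i" and qi: "q$i = p$i" for p q i
  proof -
    let ?H = "{u::int^'d. \<forall>j. (\<chi> l. min (p$l) (q$l))$j \<le> u$j \<and> u$j \<le> (\<chi> l. max (p$l) (q$l))$j}"
    have "lattice_connected ?H" by (rule lattice_connected_rect[OF refl])
    moreover have "p \<in> ?H" "q \<in> ?H" by auto
    ultimately have "reaches ?H p q" by (rule lattice_connectedD)
    moreover have "?H \<subseteq> ?S"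
    proof
      fix u assume "u \<in> ?H"
      then have "min (p$i) (q$i) \<le> u$i" "u$i \<le> max (p$i) (q$i)" by auto
      then have "u$i = p$i" using qi by auto
      then show "u \<in> ?S" using pi mem[of u i] by simp
    qed
    ultimately show ?thesis using reaches_mono by blast
  qed
  define c where "c = (\<chi> j. hi$j + 1)"
  have cj: "hi$j < c$j" for j by (simp add: c_def)
  show ?thesis
  proof (rule lattice_connectedI)
    show "c \<in> ?S" using mem cj by blast
    fix p assume "p \<in> ?S"
    then obtain i where i: "p$i < lo$i \<or> hi$i < p$i" by (auto simp: not_le)
    have "\<exists>j. j \<noteq> i"
    proof (rule ccontr)
      assume "\<nexists>j. j \<noteq> i"
      then have "(UNIV::'d set) = {i}" by auto
      then have "CARD('d) = 1" by (metis One_nat_def card.empty card.insert empty_iff finite.emptyI)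
      then show False using assms by simp
    qed
    then obtain j where j: "j \<noteq> i" by auto
    let ?q = "\<chi> l. if l = i then p$i else c$l"
    have "reaches ?S p ?q" by (rule move[OF i]) simp
    moreover have "reaches ?S ?q c" by (rule move[of _ j]) (use j cj in auto)
    ultimately show "reaches ?S p c" by simp
  qed
qed

lemma lattice_connected_compl_cb:
  assumes "CARD('d) \<ge> 2"
  shows "lattice_connected (UNIV - cb (v::int^'d) R)"
  unfolding cb_eq_rect by (rule lattice_connected_compl_rect[OF assms])

subsection \<open>Grid cells\<close>

text \<open>The offset 1 makes the cells the translates of \<open>box_d 1 k\<close> by multiples of
  \<open>k\<close>, as in grid unions.\<close>

definition same_cell :: "int \<Rightarrow> int^'d \<Rightarrow> int^'d \<Rightarrow> bool" where
  "same_cell k p p' \<longleftrightarrow> (\<forall>i. (p$i - 1) div k = (p'$i - 1) div k)"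

definition saturated :: "int \<Rightarrow> (int^'d) set \<Rightarrow> bool" where
  "saturated k S \<longleftrightarrow> (\<forall>p\<in>S. \<forall>p'. same_cell k p p' \<longrightarrow> p' \<in> S)"

lemma same_cell_refl [simp]: "same_cell k p p" by (simp add: same_cell_def)

lemma same_cell_sym: "same_cell k p p' \<longleftrightarrow> same_cell k p' p" by (auto simp: same_cell_def)

lemma same_cell_trans: "same_cell k p p' \<Longrightarrow> same_cell k p' p'' \<Longrightarrow> same_cell k p p''"
  by (simp add: same_cell_def)

lemma div_eq_iff_bounds:
  assumes "(0::int) < k" shows "x div k = c \<longleftrightarrow> k * c \<le> x \<and> x < k * c + k"
proof -
  have x: "x = k * (x div k) + x mod k" by simp
  have m: "0 \<le> x mod k" "x mod k < k" using assms by auto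
  have "k * c \<le> x \<and> x < k * c + k \<Longrightarrow> x div k = c"
    using assms by (intro int_div_pos_eq[of _ _ _ "x - k * c"]) auto
  moreover have "k * (x div k) \<le> x \<and> x < k * (x div k) + k" using x m by linarith
  ultimately show ?thesis by auto
qed

lemma same_cell_rect:
  assumes "0 < k"
  shows "{p'. same_cell k p p'} = {v. \<forall>i. (\<chi> i. k * ((p$i - 1) div k) + 1)$i \<le> v$i \<and>
           v$i \<le> (\<chi> i. k * ((p$i - 1) div k) + k)$i}"
proof -
  have "(p$i - 1) div k = (v$i - 1) div k \<longleftrightarrow>
      k * ((p$i - 1) div k) + 1 \<le> v$i \<and> v$i \<le> k * ((p$i - 1) div k) + k" for v :: "int^'a" and i
    using div_eq_iff_bounds[OF assms, of "v$i - 1" "(p$i - 1) div k"] by auto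
  then show ?thesis by (simp add: same_cell_def)
qed

lemma lattice_connected_cell: "0 < k \<Longrightarrow> lattice_connected {p'. same_cell k p p'}"
  by (rule lattice_connected_rect[OF same_cell_rect])

lemma same_cell_nrm:
  assumes "0 < k" "same_cell k p p'" shows "nrm (p - p') < k"
proof -
  have "\<bar>(p - p')$i\<bar> \<le> k - 1" for i
  proof -
    have "(p$i - 1) div k = (p'$i - 1) div k" using assms by (simp add: same_cell_def)
    then have "k * ((p$i - 1) div k) \<le> p'$i - 1" "p'$i - 1 < k * ((p$i - 1) div k) + k"
      "k * ((p$i - 1) div k) \<le> p$i - 1" "p$i - 1 < k * ((p$i - 1) div k) + k"
      using div_eq_iff_bounds[OF assms(1), of "p$i - 1" "(p$i - 1) div k"]
        div_eq_iff_bounds[OF assms(1), of "p'$i - 1" "(p$i - 1) div k"] by auto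
    then show ?thesis by auto
  qed
  then have "nrm (p - p') \<le> k - 1" unfolding nrm_le_iff by blast
  then show ?thesis by simp
qed

text \<open>Pieces are built from large cells of side \<open>K\<close>, which leave room for code
  boxes, while property F speaks of cells of side \<open>k\<close>. Each large cell is a union of
  small ones.\<close>

lemma saturated_dvd:
  assumes "saturated K S" "k dvd K" "0 < k" "0 < K"
  shows "saturated k S"
proof -
  obtain c where c: "K = k * c" using assms by auto
  have "x div K = (x div k) div c" for x :: int
    unfolding c using assms c by (simp add: zdiv_zmult2_eq zero_less_mult_iff)
  then have "same_cell k p p' \<Longrightarrow> same_cell K p p'" for p p'
    by (simp add: same_cell_def)
  then show ?thesis using assms(1) by (auto simp: saturated_def)
qed

lemma grid_union_saturated:
  assumes "finite S" "saturated (int k) S" "0 < k" "lattice_connected S" "lattice_connected (UNIV - S)"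
  shows "grid_union k (S :: (int^'d) set)"
proof -
  \<comment> \<open>A cell is represented by the corner \<open>c\<close> just below it;
    \<open>c + 1\<close> in each coordinate is its least point.\<close>
  define C where "C = {c::int^'d. (\<forall>i. int k dvd c$i) \<and> (\<chi> i. c$i + 1) \<in> S}"
  have "inj_on (\<lambda>c::int^'d. \<chi> i. c$i + 1) C" by (auto simp: inj_on_def vec_eq_iff)
  moreover have "(\<lambda>c::int^'d. \<chi> i. c$i + 1) ` C \<subseteq> S" by (auto simp: C_def)
  ultimately have fin: "finite C" using assms(1) by (meson finite_imageD finite_subset)
  have "S = {0 + c + u | c u. c \<in> C \<and> u \<in> box_d 1 (int k)}"
  proof (intro equalityI subsetI)
    fix p assume p: "p \<in> S"
    define c where "c = (\<chi> i. int k * ((p$i - 1) div int k))"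
    have k: "0 < int k" using assms by simp
    have "same_cell (int k) p (\<chi> i. c$i + 1)"
      using k by (auto simp: same_cell_def c_def)
    then have "c \<in> C" using p assms(2) by (auto simp: C_def c_def saturated_def)
    moreover have "p - c \<in> box_d 1 (int k)"
    proof -
      have "1 \<le> p$i - c$i \<and> p$i - c$i \<le> int k" for i
        using div_eq_iff_bounds[OF k, of "p$i - 1" "(p$i - 1) div int k"] by (auto simp: c_def)
      then show ?thesis by (simp add: box_d_def)
    qed
    ultimately show "p \<in> {0 + c + u | c u. c \<in> C \<and> u \<in> box_d 1 (int k)}"
      by (intro CollectI exI[of _ c] exI[of _ "p - c"]) simp
  next
    fix p assume "p \<in> {0 + c + u | c u. c \<in> C \<and> u \<in> box_d 1 (int k)}"
    then obtain c u where cu: "p = c + u" "c \<in> C" "u \<in> box_d 1 (int k)" by auto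
    have "same_cell (int k) (\<chi> i. c$i + 1) p"
      unfolding same_cell_def
    proof
      fix i
      obtain e where e: "c$i = int k * e" using cu(2) by (auto simp: C_def)
      have u: "1 \<le> u$i" "u$i \<le> int k" using cu(3) by (auto simp: box_d_def)
      have k: "0 < int k" using assms by simp
      have "(p$i - 1) div int k = e" unfolding div_eq_iff_bounds[OF k] using u e cu(1) by simp
      moreover have "((\<chi> i. c$i + 1)$i - 1) div int k = e" using e k by simp
      ultimately show "((\<chi> i. c$i + 1)$i - 1) div int k = (p$i - 1) div int k" by simp
    qed
    then show "p \<in> S" using cu(2) assms(2) by (auto simp: C_def saturated_def)
  qed
  then show ?thesis
    unfolding grid_union_def using fin assms(4,5)
    by (intro conjI exI[of _ C] exI[of _ 0]) (auto simp: C_def)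
qed

lemma translate_set_mem: "p \<in> translate_set \<alpha> S \<longleftrightarrow> p - \<alpha> \<in> S"
  by (force simp: translate_set_def)

lemma lattice_connected_translate:
  assumes "lattice_connected S" shows "lattice_connected (translate_set \<alpha> S)"
proof -
  have "reaches S a b \<Longrightarrow> reaches (translate_set \<alpha> S) (a + \<alpha>) (b + \<alpha>)" for a b
  proof (induction rule: rtranclp_induct)
    case (step y z)
    then have "lattice_step (translate_set \<alpha> S) (y + \<alpha>) (z + \<alpha>)"
      by (simp add: lattice_step_def translate_set_mem adjacent_def)
    with step.IH show ?case by (rule rtranclp.rtrancl_into_rtrancl)
  qed simp
  from this[of "_ - \<alpha>" "_ - \<alpha>"] assms show ?thesis
    by (simp add: lattice_connected_iff translate_set_mem)
qed

lemma grid_union_translate: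
  assumes "grid_union k S" shows "grid_union k (translate_set \<alpha> S)"
proof -
  obtain C \<gamma> where C: "finite C" "C \<subseteq> {v. \<forall>i. int k dvd v$i}"
      "S = {\<gamma> + c + u | c u. c \<in> C \<and> u \<in> box_d 1 (int k)}"
    and conn: "lattice_connected S" "lattice_connected (UNIV - S)"
    using assms unfolding grid_union_def by blast
  have "translate_set \<alpha> S = {(\<gamma> + \<alpha>) + c + u | c u. c \<in> C \<and> u \<in> box_d 1 (int k)}"
  proof (intro equalityI subsetI)
    fix p assume "p \<in> translate_set \<alpha> S"
    then obtain c u where "p - \<alpha> = \<gamma> + c + u" "c \<in> C" "u \<in> box_d 1 (int k)"
      unfolding translate_set_mem C(3) by auto
    then show "p \<in> {(\<gamma> + \<alpha>) + c + u | c u. c \<in> C \<and> u \<in> box_d 1 (int k)}"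
      by (intro CollectI exI[of _ c] exI[of _ u]) (simp add: algebra_simps)
  next
    fix p assume "p \<in> {(\<gamma> + \<alpha>) + c + u | c u. c \<in> C \<and> u \<in> box_d 1 (int k)}"
    then obtain c u where "p = (\<gamma> + \<alpha>) + c + u" "c \<in> C" "u \<in> box_d 1 (int k)" by auto
    then show "p \<in> translate_set \<alpha> S" unfolding translate_set_mem C(3)
      by (intro CollectI exI[of _ c] exI[of _ u]) (simp add: algebra_simps)
  qed
  moreover have "UNIV - translate_set \<alpha> S = translate_set \<alpha> (UNIV - S)"
    by (auto simp: translate_set_mem)
  ultimately show ?thesis
    unfolding grid_union_def using C(1,2) lattice_connected_translate[OF conn(1), of \<alpha>]
      lattice_connected_translate[OF conn(2), of \<alpha>] by (intro conjI exI[of _ C] exI[of _ "\<gamma> + \<alpha>"]) simp_all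
qed

lemma grid_union_box:
  assumes "CARD('d) \<ge> 2" "0 < k"
  shows "grid_union k (box_d 1 (int (n * k)) :: (int^'d) set)"
proof (rule grid_union_saturated)
  have r: "(box_d 1 (int (n * k)) :: (int^'d) set)
     = {v. \<forall>i. (\<chi> i. 1)$i \<le> v$i \<and> v$i \<le> (\<chi> i. int (n * k))$i}" by (simp add: box_d_def)
  show "lattice_connected (box_d 1 (int (n * k)) :: (int^'d) set)"
    by (rule lattice_connected_rect[OF r])
  show "lattice_connected (UNIV - (box_d 1 (int (n * k)) :: (int^'d) set))"
    unfolding r by (rule lattice_connected_compl_rect[OF assms(1)])
  have "p \<in> box_d 1 (int (n * k)) \<longleftrightarrow> (\<forall>i. 0 \<le> (p$i - 1) div int k \<and> (p$i - 1) div int k < int n)" for p :: "int^'d"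
  proof -
    have "(1 \<le> x \<and> x \<le> int (n * k)) \<longleftrightarrow> (0 \<le> (x - 1) div int k \<and> (x - 1) div int k < int n)" for x
    proof -
      have k: "0 < int k" using assms(2) by simp
      have "(x - 1) div int k < int n \<longleftrightarrow> x - 1 < int n * int k"
      proof -
        define c where "c = (x - 1) div int k"
        have c: "int k * c \<le> x - 1" "x - 1 < int k * c + int k"
          using div_eq_iff_bounds[OF k, of "x - 1" c] c_def by auto
        have "c < int n \<longleftrightarrow> x - 1 < int k * int n"
        proof (cases "c < int n")
          case True
          then have "int k * (c + 1) \<le> int k * int n" by (intro mult_left_mono) auto
          moreover have "int k * (c + 1) = int k * c + int k" by (simp add: algebra_simps)
          ultimately show ?thesis using c True by linarith
        next
          case False
          then have "int k * int n \<le> int k * c" by (intro mult_left_mono) auto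
          then show ?thesis using c False by linarith
        qed
        then show ?thesis by (simp add: c_def mult.commute)
      qed
      then show ?thesis using pos_imp_zdiv_nonneg_iff[OF k, of "x - 1"] by auto
    qed
    then show ?thesis by (simp add: box_d_def)
  qed
  then show "saturated (int k) (box_d 1 (int (n * k)) :: (int^'d) set)"
    unfolding saturated_def same_cell_def by metis
qed (use assms in auto)

subsection \<open>Components and filling\<close>

text \<open>Maximality is stated for arbitrary connected subsets because it is applied to three
  kinds of them: the central cube of a piece, grid cells, and thickened smaller pieces.\<close>

lemma component_exists:
  assumes "c \<in> S"
  obtains T where "T \<subseteq> S" "c \<in> T" "lattice_connected T"
    "\<And>U. lattice_connected U \<Longrightarrow> U \<subseteq> S \<Longrightarrow> U \<inter> T \<noteq> {} \<Longrightarrow> U \<subseteq> T"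
proof
  let ?T = "{p. reaches S c p}"
  show "?T \<subseteq> S" using reaches_mem assms by auto
  show "c \<in> ?T" by simp
  show "lattice_connected ?T"
  proof (rule lattice_connectedI)
    show "c \<in> ?T" by simp
    fix a assume "a \<in> ?T"
    then have "reaches (S \<inter> ?T) c a \<and> a \<in> ?T"
      by (intro reaches_closed[of S c a ?T]) (auto intro: rtranclp.rtrancl_into_rtrancl)
    then show "reaches ?T a c" using reaches_mono[of "S \<inter> ?T" ?T] reaches_sym by blast
  qed
  fix U assume U: "lattice_connected U" "U \<subseteq> S" "U \<inter> ?T \<noteq> {}"
  then obtain u where u: "u \<in> U" "reaches S c u" by auto
  show "U \<subseteq> ?T"
  proof
    fix x assume "x \<in> U"
    then have "reaches U u x" using U(1) u by (simp add: lattice_connected_iff)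
    then have "reaches S u x" using reaches_mono U(2) by blast
    then show "x \<in> ?T" using u by simp
  qed
qed

text \<open>\<open>Out\<close> consists of the points from which one can leave the cube without
  meeting \<open>S\<close>. The outside of the cube is connected, hence so is \<open>Out\<close>,
  and the complement of \<open>Out\<close> is \<open>S\<close> with its holes filled. The last
  conclusion, that a connected set avoiding \<open>S\<close> lies in the holes or off the filled
  set, lets closure properties of \<open>S\<close> survive the filling.\<close>

lemma fill_exists:
  fixes S :: "(int^'d) set"
  assumes d: "CARD('d) \<ge> 2" and S: "S \<subseteq> cb v R" "lattice_connected S" "S \<noteq> {}"
  obtains T where "S \<subseteq> T" "T \<subseteq> cb v R" "lattice_connected T" "lattice_connected (UNIV - T)"
    "\<And>U. lattice_connected U \<Longrightarrow> U \<inter> T \<noteq> {} \<Longrightarrow> U \<inter> S \<noteq> {} \<or> U \<subseteq> T"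
proof -
  define b where "b = cb v R"
  define Out where "Out = {p. p \<notin> S \<and> (\<exists>z. z \<notin> b \<and> reaches (UNIV - S) p z)}"
  have OutI: "p \<in> Out" if "p \<notin> S" "q \<in> Out" "reaches (UNIV - S) p q" for p q
    using that unfolding Out_def by (auto intro: rtranclp_trans)
  have b_Out: "UNIV - b \<subseteq> Out" using S(1) by (auto simp: Out_def b_def)
  have conn_b: "lattice_connected (UNIV - b)" unfolding b_def by (rule lattice_connected_compl_cb[OF d])
  obtain i :: 'd where True by auto
  define c where "c = v + axis i (\<bar>R\<bar> + 1)"
  have c: "c \<in> UNIV - b" by (simp add: b_def c_def nrm_axis)
  have 1: "lattice_connected Out"
  proof (rule lattice_connectedI)
    show "c \<in> Out" using c b_Out by blast
    fix p assume p: "p \<in> Out"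
    then obtain z where z: "z \<notin> b" "reaches (UNIV - S) p z" by (auto simp: Out_def)
    have step: "y \<in> Out" if "x \<in> Out" "lattice_step (UNIV - S) x y" for x y
    proof (rule OutI)
      show "y \<notin> S" using that by (simp add: lattice_step_def)
      have "lattice_step (UNIV - S) y x" using that(2) adjacent_sym[of x y] by (simp add: lattice_step_def)
      then show "reaches (UNIV - S) y x" by (rule r_into_rtranclp)
    qed (use that in simp)
    have "reaches ((UNIV - S) \<inter> Out) p z \<and> z \<in> Out"
      by (rule reaches_closed[OF z(2) p step])
    then have "reaches Out p z" using reaches_mono by blast
    moreover have "reaches (UNIV - b) z c" using conn_b z c by (simp add: lattice_connected_iff)
    then have "reaches Out z c" using reaches_mono b_Out by blast
    ultimately show "reaches Out p c" by simp
  qed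
  obtain s0 where s0: "s0 \<in> S" using S by auto
  have 2: "lattice_connected (UNIV - Out)"
  proof (rule lattice_connectedI)
    show "s0 \<in> UNIV - Out" using s0 by (simp add: Out_def)
    fix p assume p: "p \<in> UNIV - Out"
    have SO: "S \<subseteq> UNIV - Out" by (auto simp: Out_def)
    \<comment> \<open>A straight ray from \<open>p\<close> must hit \<open>S\<close>, as otherwise
      it would leave the cube and put \<open>p\<close> into \<open>Out\<close>. Up to its first hit
      it stays inside the filled set.\<close>
    have "\<exists>t::nat. p + axis i (int t) \<in> S"
    proof (rule ccontr)
      assume no: "\<not> ?thesis"
      define t where "t = nrm (p - v) + \<bar>R\<bar> + 1"
      have t: "0 \<le> t" by (simp add: t_def)
      have "p + axis i j \<in> UNIV - S" if "0 \<le> j" for j using no[simplified, rule_format, of "nat j"] that by simp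
      then have "reaches (UNIV - S) p (p + axis i t)" by (intro reaches_axis) (use t in auto)
      moreover have "p + axis i t \<notin> b"
        using nrm_triangle_diff[of "p + axis i t" p v] nrm_triangle[of "p + axis i t - v" "v - p"] nrm_commute[of v p] t
        by (simp add: b_def nrm_axis t_def)
      moreover have "p \<notin> S" using no[simplified, rule_format, of 0] by (simp add: axis_def zero_vec_def[symmetric])
      ultimately show False using p by (auto simp: Out_def)
    qed
    then obtain t where t: "p + axis i (int t) \<in> S" "\<And>j. j < t \<Longrightarrow> p + axis i (int j) \<notin> S"
      using exists_least_iff[of "\<lambda>t. p + axis i (int t) \<in> S"] by auto
    have in_fill: "p + axis i j \<in> UNIV - Out" if "0 \<le> j" "j \<le> int t" for j
    proof (cases "j = int t")
      case True then show ?thesis using t(1) SO by auto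
    next
      case False
      then have "p + axis i l \<in> UNIV - S" if "0 \<le> l" "l \<le> j" for l
        using t(2)[of "nat l"] that \<open>j \<le> int t\<close> by auto
      then have l: "reaches (UNIV - S) p (p + axis i j)" by (intro reaches_axis) (use that in auto)
      have "p \<notin> S" using t(2)[of 0] False that by (simp add: axis_def zero_vec_def[symmetric])
      with l show ?thesis using OutI[of p "p + axis i j"] p by auto
    qed
    have "reaches (UNIV - Out) p (p + axis i (int t))" by (intro reaches_axis in_fill) auto
    moreover have "reaches S (p + axis i (int t)) s0" using S(2) t(1) s0 by (simp add: lattice_connected_iff)
    then have "reaches (UNIV - Out) (p + axis i (int t)) s0" using reaches_mono SO by blast
    ultimately show "reaches (UNIV - Out) p s0" by simp
  qed
  show ?thesis
  proof
    show "S \<subseteq> UNIV - Out" by (auto simp: Out_def)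
    show "UNIV - Out \<subseteq> cb v R" using b_Out b_def by auto
    show "lattice_connected (UNIV - (UNIV - Out))" using 1 by (simp add: Diff_Diff_Int)
    fix U assume U: "lattice_connected U" "U \<inter> (UNIV - Out) \<noteq> {}"
    show "U \<inter> S \<noteq> {} \<or> U \<subseteq> UNIV - Out"
    proof (rule ccontr)
      assume "\<not> ?thesis"
      then obtain q where q: "U \<subseteq> UNIV - S" "q \<in> U" "q \<in> Out" by auto
      obtain p where p: "p \<in> U" "p \<notin> Out" using U by auto
      have "reaches U p q" using U(1) p q by (simp add: lattice_connected_iff)
      then have "reaches (UNIV - S) p q" using reaches_mono q by blast
      then show False using OutI[of p q] p q by blast
    qed
  qed (rule 2)
qed

subsection \<open>Spread families\<close>

text \<open>The constants are rounded from the pieces built later: their radius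
  \<open>2 * r j + 8 * \<rho> j\<close> is at most \<open>3 * r j\<close>, and markers more than
  \<open>100 * r j\<close> apart are displaced by at most \<open>16 * \<rho> j \<le> r j\<close>
  each.\<close>

definition spread :: "(nat \<Rightarrow> int) \<Rightarrow> nat \<Rightarrow> (nat \<Rightarrow> int^'d \<Rightarrow> (int^'d) set) \<Rightarrow> bool" where
  "spread r n E \<longleftrightarrow> (\<forall>j<n. (\<forall>u. E j u \<subseteq> cb u (3 * r j)) \<and>
     (\<forall>u u'. E j u \<noteq> {} \<longrightarrow> E j u' \<noteq> {} \<longrightarrow> u \<noteq> u' \<longrightarrow> 98 * r j \<le> nrm (u - u')))"

text \<open>Because the pieces are thickened on both sides of the implication, a smaller piece that
  comes within \<open>q\<close> of \<open>S\<close> lies in \<open>S\<close> together with a margin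
  of width \<open>q\<close>.\<close>

definition piece_closed :: "int \<Rightarrow> nat \<Rightarrow> (nat \<Rightarrow> int^'d \<Rightarrow> (int^'d) set) \<Rightarrow> (int^'d) set \<Rightarrow> bool" where
  "piece_closed q n E S \<longleftrightarrow> (\<forall>j<n. \<forall>u. thick q (E j u) \<inter> S \<noteq> {} \<longrightarrow> thick q (E j u) \<subseteq> S)"

text \<open>Around a point that is clear of \<open>E\<close> there is room for a cube at every scale below \<open>n\<close>, so that boxes
  placed there avoid all smaller pieces whatever their shape.\<close>

definition clear_at :: "(nat \<Rightarrow> int) \<Rightarrow> nat \<Rightarrow> (nat \<Rightarrow> int^'d \<Rightarrow> (int^'d) set) \<Rightarrow> int^'d \<Rightarrow> bool" where
  "clear_at r n E v \<longleftrightarrow> (\<forall>j<n. \<forall>u. E j u \<inter> cb v (4 * r j) = {})"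

locale scales =
  fixes \<rho> :: "nat \<Rightarrow> int" and K :: int
  assumes K_pos: "1 \<le> K" and rho_0: "8 * K \<le> \<rho> 0" and rho_Suc: "64 * \<rho> n \<le> \<rho> (Suc n)"
begin

text \<open>One sequence under two names: at level \<open>n\<close> the radius of the pieces is
  governed by \<open>r n\<close>, and \<open>\<rho> n\<close> bounds \<open>r j\<close> for all
  lower levels \<open>j\<close>.\<close>

definition r :: "nat \<Rightarrow> int" where "r n = \<rho> (Suc n)"

lemma rho_ge: "8 * K \<le> \<rho> n"
proof (induction n)
  case (Suc n) then show ?case using rho_Suc[of n] K_pos by linarith
qed (rule rho_0)

lemma rho_pos: "0 < \<rho> n" using rho_ge[of n] K_pos by linarith

lemma r_pos: "0 < r n" by (simp add: r_def rho_pos)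

lemma rho_r64: "64 * \<rho> n \<le> r n" by (simp add: r_def rho_Suc)

lemma rho_r: "16 * \<rho> n \<le> r n" using rho_r64[of n] rho_pos[of n] by linarith

lemma rho_mono: "i \<le> j \<Longrightarrow> \<rho> i \<le> \<rho> j"
proof (induction rule: dec_induct)
  case (step n) then show ?case using rho_Suc[of n] rho_pos[of n] by linarith
qed simp

lemma rho_ge_nat: "int n \<le> \<rho> n"
proof (induction n)
  case (Suc n) then show ?case using rho_Suc[of n] rho_pos[of n] by linarith
qed (use rho_pos[of 0] in simp)

lemma r_rho: "j < n \<Longrightarrow> r j \<le> \<rho> n" unfolding r_def by (rule rho_mono) simp

text \<open>At most one piece of a given level comes near a point, so a step in one of two opposite directions
  avoids it; the later steps, for smaller levels, are too short to undo this.\<close>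

lemma clear_exists:
  assumes "spread r n E"
  shows "\<exists>v. nrm (v - z) \<le> 16 * \<rho> n \<and> clear_at r n E v"
  using assms
proof (induction n arbitrary: z)
  case 0
  show ?case using rho_pos[of 0] by (intro exI[of _ z]) (simp add: clear_at_def)
next
  case (Suc n)
  have sp: "spread r n E" using Suc.prems by (simp add: spread_def)
  have bnd: "E n u \<subseteq> cb u (3 * r n)" for u using Suc.prems by (simp add: spread_def)
  have sep: "98 * r n \<le> nrm (u - u')" if "E n u \<noteq> {}" "E n u' \<noteq> {}" "u \<noteq> u'" for u u'
    using Suc.prems that by (simp add: spread_def)
  obtain i :: 'a where True by auto
  let ?e = "axis i (12 * r n) :: int^'a"
  have near: "nrm (u - z') \<le> 8 * r n" if meet: "E n u \<inter> cb z' (5 * r n) \<noteq> {}" for u z'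
  proof -
    obtain p where "p \<in> E n u" "nrm (p - z') \<le> 5 * r n" using meet by auto
    moreover from this have "nrm (p - u) \<le> 3 * r n" using bnd[of u] by auto
    ultimately show ?thesis using nrm_triangle_diff[of u z' p] nrm_commute[of u p] by linarith
  qed
  \<comment> \<open>A piece meeting the cube of radius \<open>5 * r n\<close> has its centre within
    \<open>8 * r n\<close> of the centre of that cube. If both candidates failed because of one
    piece, they would be at distance at most \<open>16 * r n\<close> instead of
    \<open>24 * r n\<close>; two pieces would have centres within \<open>40 * r n\<close>. Radius 5
    rather than 4 leaves room for the later move by \<open>16 * \<rho> n \<le> r n\<close>.\<close>
  have "\<exists>z'. nrm (z' - z) \<le> 12 * r n \<and> (\<forall>u. E n u \<inter> cb z' (5 * r n) = {})"
  proof (rule ccontr)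
    assume no: "\<not> ?thesis"
    have "nrm ((z + ?e) - z) \<le> 12 * r n" "nrm ((z - ?e) - z) \<le> 12 * r n"
      using r_pos[of n] by (simp_all add: nrm_axis)
    with no obtain u1 u2 where u: "E n u1 \<inter> cb (z + ?e) (5 * r n) \<noteq> {}" "E n u2 \<inter> cb (z - ?e) (5 * r n) \<noteq> {}"
      by meson
    have ee: "nrm ((z + ?e) - (z - ?e)) = 24 * r n"
    proof -
      have "(z + ?e) - (z - ?e) = axis i (24 * r n)" by (simp add: vec_eq_iff axis_def)
      then show ?thesis using r_pos[of n] by (simp add: nrm_axis)
    qed
    have n1: "nrm (u1 - (z + ?e)) \<le> 8 * r n" and n2: "nrm (u2 - (z - ?e)) \<le> 8 * r n"
      using near[OF u(1)] near[OF u(2)] by auto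
    show False
    proof (cases "u1 = u2")
      case True
      then show False using nrm_triangle_diff[of "z + ?e" "z - ?e" u1] n1 n2[folded True] ee
          nrm_commute[of u1 "z + ?e"] r_pos[of n] by linarith
    next
      case False
      then have "98 * r n \<le> nrm (u1 - u2)" using sep u by blast
      then show False
        using nrm_triangle_diff[of u1 u2 "z + ?e"] nrm_triangle_diff[of "z + ?e" u2 "z - ?e"] n1 n2 ee
          nrm_commute[of u2 "z - ?e"] r_pos[of n] by linarith
    qed
  qed
  then obtain z' where z': "nrm (z' - z) \<le> 12 * r n" "\<And>u. E n u \<inter> cb z' (5 * r n) = {}" by blast
  obtain v where v: "nrm (v - z') \<le> 16 * \<rho> n" "clear_at r n E v" using Suc.IH[OF sp] by blast
  have "E n u \<inter> cb v (4 * r n) = {}" for u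
  proof -
    have "cb v (4 * r n) \<subseteq> cb z' (5 * r n)"
    proof
      fix p assume "p \<in> cb v (4 * r n)"
      then show "p \<in> cb z' (5 * r n)" using nrm_triangle_diff[of p z' v] v(1) rho_r[of n] by simp
    qed
    then show ?thesis using z'(2)[of u] by blast
  qed
  then have "clear_at r (Suc n) E v" using v(2) by (auto simp: clear_at_def less_Suc_eq)
  moreover have "nrm (v - z) \<le> 16 * \<rho> (Suc n)"
    using nrm_triangle_diff[of v z z'] v(1) z'(1) rho_r[of n] r_pos[of n] unfolding r_def by linarith
  ultimately show ?case by blast
qed

text \<open>The highest level is absorbed first. After all pieces of level \<open>n\<close> near
  \<open>A\<close> have been added, closing under the lower levels moves the boundary by at most
  \<open>8 * \<rho> n\<close>. A piece of level \<open>n\<close> reached in this way was near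
  \<open>A\<close> from the start or is close to an absorbed one, hence equal to it by
  separation.\<close>

lemma closed_exists:
  assumes "spread r n E"
  shows "\<exists>S. A \<subseteq> S \<and> S \<subseteq> thick (8 * \<rho> n) A \<and> saturated K S \<and> piece_closed (8 * K) n E S"
  using assms
proof (induction n arbitrary: A)
  case 0
  let ?S = "{p. \<exists>a\<in>A. same_cell K p a}"
  have "?S \<subseteq> thick (8 * \<rho> 0) A"
  proof
    fix p assume "p \<in> ?S"
    then obtain a where a: "a \<in> A" "same_cell K p a" by auto
    then have "nrm (p - a) < K" using same_cell_nrm K_pos by force
    then show "p \<in> thick (8 * \<rho> 0) A" unfolding mem_thick using a rho_0 K_pos by (intro bexI[of _ a]) auto
  qed
  moreover have "saturated K ?S"
    unfolding saturated_def using same_cell_sym same_cell_trans by blast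
  moreover have "A \<subseteq> ?S" using same_cell_refl by blast
  ultimately show ?case by (intro exI[of _ ?S]) (simp add: piece_closed_def)
next
  case (Suc n)
  have sp: "spread r n E" using Suc.prems by (simp add: spread_def)
  have bnd: "E n u \<subseteq> cb u (3 * r n)" for u using Suc.prems by (simp add: spread_def)
  have sep: "98 * r n \<le> nrm (u - u')" if "E n u \<noteq> {}" "E n u' \<noteq> {}" "u \<noteq> u'" for u u'
    using Suc.prems that by (simp add: spread_def)
  let ?q = "8 * K" and ?t = "8 * \<rho> n"
  have bndq: "nrm (p - u) \<le> 3 * r n + ?q" if "p \<in> thick ?q (E n u)" for p u
    using that thick_mono[OF bnd order_refl, of ?q u] thick_cb_subset[of ?q u "3 * r n"] by auto
  define U where "U = {u. thick ?q (E n u) \<inter> thick ?t A \<noteq> {}}"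
  define A' where "A' = A \<union> (\<Union>u\<in>U. thick ?q (E n u))"
  obtain S where S: "A' \<subseteq> S" "S \<subseteq> thick ?t A'" "saturated K S" "piece_closed ?q n E S"
    using Suc.IH[OF sp] by blast
  have A'_near: "A' \<subseteq> thick (?t + 6 * r n + 2 * ?q) A"
  proof
    fix p assume "p \<in> A'"
    then consider "p \<in> A" | u where "u \<in> U" "p \<in> thick ?q (E n u)" by (auto simp: A'_def)
    then show "p \<in> thick (?t + 6 * r n + 2 * ?q) A"
    proof cases
      case 1 then show ?thesis using subset_thick[of "?t + 6 * r n + 2 * ?q" A] rho_pos[of n] r_pos[of n] K_pos by auto
    next
      case 2
      obtain x where x: "x \<in> thick ?q (E n u)" "x \<in> thick ?t A" using 2 by (auto simp: U_def)
      then obtain a where a: "a \<in> A" "nrm (x - a) \<le> ?t" by (auto simp: mem_thick)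
      have "nrm (p - a) \<le> ?t + 6 * r n + 2 * ?q"
        using nrm_triangle_diff[of p a u] nrm_triangle_diff[of u a x] bndq[OF 2(2)] bndq[OF x(1)] a(2) nrm_commute[of u x]
        by linarith
      then show ?thesis unfolding mem_thick using a by blast
    qed
  qed
  have num: "?t + (?t + 6 * r n + 2 * ?q) \<le> 8 * \<rho> (Suc n)"
    using rho_r[of n] rho_ge[of n] r_pos[of n] unfolding r_def by linarith
  have "S \<subseteq> thick (8 * \<rho> (Suc n)) A"
    using S(2) thick_mono[OF A'_near order_refl, of ?t] thick_thick[of ?t "?t + 6 * r n + 2 * ?q" A]
      thick_mono[OF order_refl num, of A] by blast
  moreover have "thick ?q (E n u) \<subseteq> S" if meet: "thick ?q (E n u) \<inter> S \<noteq> {}" for u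
  proof -
    obtain p where p: "p \<in> thick ?q (E n u)" "p \<in> S" using meet by blast
    then have "p \<in> thick ?t A'" using S(2) by blast
    then obtain a where a: "a \<in> A'" "nrm (p - a) \<le> ?t" unfolding mem_thick by blast
    have "u \<in> U"
    proof (cases "a \<in> A")
      case True
      then have "p \<in> thick ?t A" unfolding mem_thick using a by blast
      then show ?thesis using p by (auto simp: U_def)
    next
      case False
      then obtain u' where u': "u' \<in> U" "a \<in> thick ?q (E n u')" using a by (auto simp: A'_def)
      have "nrm (u - u') < 98 * r n"
        using nrm_triangle_diff[of u u' p] nrm_triangle_diff[of p u' a] bndq[OF p(1)] bndq[OF u'(2)] a(2) nrm_commute[of u p]
          rho_r[of n] rho_ge[of n] r_pos[of n] by linarith
      moreover have "E n u \<noteq> {}" "E n u' \<noteq> {}" using p u' by auto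
      ultimately have "u = u'" using sep[of u u'] by auto
      then show ?thesis using u' by simp
    qed
    then show ?thesis using S(1) by (auto simp: A'_def)
  qed
  then have "piece_closed ?q (Suc n) E S" using S(4) by (auto simp: piece_closed_def less_Suc_eq)
  ultimately show ?case using S(1,3) by (intro exI[of _ S]) (auto simp: A'_def)
qed

definition good_piece :: "nat \<Rightarrow> (nat \<Rightarrow> int^'d \<Rightarrow> (int^'d) set) \<Rightarrow> (int^'d) set \<Rightarrow> bool" where
  "good_piece n E S \<longleftrightarrow> cb 0 (2 * r n) \<subseteq> S \<and> S \<subseteq> cb 0 (2 * r n + 8 * \<rho> n) \<and> saturated K S \<and>
     lattice_connected S \<and> lattice_connected (UNIV - S) \<and> piece_closed (8 * K) n E S"

text \<open>The closure of the cube may be disconnected and may have holes. Passing to the component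
  of the origin and then filling it preserves saturation and closedness, because cells and thickened
  smaller pieces are connected and so are never cut in two.\<close>

lemma good_piece_exists:
  fixes E :: "nat \<Rightarrow> int^'d \<Rightarrow> (int^'d) set"
  assumes d: "CARD('d) \<ge> 2" and sp: "spread r n E" and conn: "\<And>j u. j < n \<Longrightarrow> lattice_connected (E j u)"
  shows "\<exists>S. good_piece n E S"
proof -
  let ?B = "cb 0 (2 * r n) :: (int^'d) set" and ?q = "8 * K"
  have K: "0 < K" using K_pos by simp
  have connq: "lattice_connected (thick ?q (E j u))" if "j < n" for j u
    by (rule lattice_connected_thick[OF conn[OF that]]) (use K in simp)
  obtain S where S: "?B \<subseteq> S" "S \<subseteq> thick (8 * \<rho> n) ?B" "saturated K S" "piece_closed ?q n E S"
    using closed_exists[OF sp, of ?B] by blast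
  have 0: "0 \<in> ?B" using r_pos[of n] by simp
  obtain T where T: "T \<subseteq> S" "0 \<in> T" "lattice_connected T"
    "\<And>U. lattice_connected U \<Longrightarrow> U \<subseteq> S \<Longrightarrow> U \<inter> T \<noteq> {} \<Longrightarrow> U \<subseteq> T"
    using component_exists[of 0 S] 0 S(1) by blast
  have BT: "?B \<subseteq> T" using T(4)[OF lattice_connected_cb S(1)] T(2) 0 by blast
  have Tcell: "{p'. same_cell K p p'} \<subseteq> T" if "p \<in> T" for p
  proof (rule T(4)[OF lattice_connected_cell[OF K]])
    show "{p'. same_cell K p p'} \<subseteq> S" using that T(1) S(3) by (auto simp: saturated_def)
    show "{p'. same_cell K p p'} \<inter> T \<noteq> {}" using that same_cell_refl by blast
  qed
  have Tq: "thick ?q (E j u) \<subseteq> T" if "j < n" "thick ?q (E j u) \<inter> T \<noteq> {}" for j u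
    by (rule T(4)[OF connq[OF that(1)]]) (use that T(1) S(4) in \<open>auto simp: piece_closed_def\<close>)
  have "T \<subseteq> cb 0 (2 * r n + 8 * \<rho> n)" using T(1) S(2) thick_cb_subset by blast
  then obtain F where F: "T \<subseteq> F" "F \<subseteq> cb 0 (2 * r n + 8 * \<rho> n)" "lattice_connected F" "lattice_connected (UNIV - F)"
    "\<And>U. lattice_connected U \<Longrightarrow> U \<inter> F \<noteq> {} \<Longrightarrow> U \<inter> T \<noteq> {} \<or> U \<subseteq> F"
    using fill_exists[OF d, of T 0 "2 * r n + 8 * \<rho> n"] T by blast
  have "saturated K F" unfolding saturated_def
  proof (intro ballI allI impI)
    fix p p' assume p: "p \<in> F" and pp: "same_cell K p p'"
    have "{p'. same_cell K p p'} \<inter> T \<noteq> {} \<or> {p'. same_cell K p p'} \<subseteq> F"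
      by (rule F(5)[OF lattice_connected_cell[OF K]]) (use p same_cell_refl in blast)
    then show "p' \<in> F"
    proof
      assume "{p'. same_cell K p p'} \<inter> T \<noteq> {}"
      then obtain x where x: "same_cell K p x" "x \<in> T" by auto
      then have "same_cell K x p'" using pp same_cell_sym same_cell_trans by blast
      then show ?thesis using Tcell[OF x(2)] F(1) by auto
    qed (use pp in auto)
  qed
  moreover have "piece_closed ?q n E F" unfolding piece_closed_def
  proof (intro allI impI)
    fix j u assume j: "j < n" and m: "thick ?q (E j u) \<inter> F \<noteq> {}"
    from F(5)[OF connq[OF j] m] show "thick ?q (E j u) \<subseteq> F" using Tq[OF j] F(1) by blast
  qed
  ultimately show ?thesis unfolding good_piece_def using F BT by (intro exI[of _ F]) auto
qed

end

subsection \<open>Borel functions with countable range\<close>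

lemma shift_shift: "shift \<gamma> (shift \<delta> y) = shift (\<delta> + \<gamma>) y"
  by (simp add: shift_def add.assoc)

lemma shift_0 [simp]: "shift 0 y = y" by (simp add: shift_def)

lemma shift_apply: "shift \<gamma> y p = y (\<gamma> + p)" by (simp add: shift_def)

lemma space_borel_config [simp]: "space (borel_of config_topology) = UNIV"
  by (simp add: borel_of_def space_measure_of_conv config_topology_def)

lemma sets_borel_of: "sets (borel_of T) = sigma_sets (topspace T) {U. openin T U}"
  unfolding borel_of_def by (rule sets_measure_of) (auto dest: openin_subset)

lemma openin_config_coordinate: "openin config_topology {x. x p = a}"
proof -
  have "continuous_map config_topology (discrete_topology UNIV) (\<lambda>x. x p)"
    unfolding config_topology_def by (rule continuous_map_product_projection) simp
  moreover have "openin (discrete_topology UNIV) {a}" by simp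
  ultimately have "openin config_topology {x \<in> topspace config_topology. x p \<in> {a}}"
    by (rule openin_continuous_map_preimage)
  then show ?thesis by (simp add: config_topology_def)
qed

lemma openin_config_cylinder:
  assumes "openin config_topology U" "x \<in> U"
  shows "\<exists>n::nat. \<forall>x'. (\<forall>p\<in>cb 0 (int n). x' p = x p) \<longrightarrow> x' \<in> (U :: (int^'d \<Rightarrow> 'a) set)"
proof -
  from assms obtain B where B: "finite {i. B i \<noteq> topspace (discrete_topology (UNIV::'a set))}"
      "x \<in> Pi\<^sub>E UNIV B" "Pi\<^sub>E UNIV B \<subseteq> U"
    unfolding config_topology_def openin_product_topology_alt by fastforce
  let ?F = "{i. B i \<noteq> UNIV}"
  have fin: "finite ?F" using B(1) by simp
  define n where "n = nat (Max (insert 0 (nrm ` ?F)))"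
  have F: "?F \<subseteq> cb 0 (int n)"
  proof
    fix p assume "p \<in> ?F"
    then have "nrm p \<le> Max (insert 0 (nrm ` ?F))" using fin by (intro Max_ge) auto
    then show "p \<in> cb 0 (int n)" by (simp add: n_def)
  qed
  show ?thesis
  proof (intro exI allI impI)
    fix x' assume x': "\<forall>p\<in>cb 0 (int n). x' p = x p"
    have "x' p \<in> B p" for p
    proof (cases "p \<in> ?F")
      case True
      then show ?thesis using x' F B(2) by (force simp: PiE_iff)
    qed simp
    then show "x' \<in> U" using B(3) by auto
  qed
qed

text \<open>An open set is the union of the cylinders contained in it. For each radius there are
  only finitely many patterns on the cube, so this union is countable.\<close>

lemma measurable_config:
  fixes f :: "'m \<Rightarrow> int^'d \<Rightarrow> 'a::finite"
  assumes f: "\<And>p a. {x\<in>space M. f x p = a} \<in> sets M"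
  shows "f \<in> measurable M (borel_of config_topology)"
  unfolding borel_of_def
proof (rule measurable_measure_of)
  show "{U. openin config_topology U} \<subseteq> Pow (topspace config_topology)"
    by (auto dest: openin_subset)
  show "f \<in> space M \<rightarrow> topspace config_topology" by (simp add: config_topology_def)
  fix U :: "(int^'d \<Rightarrow> 'a) set" assume "U \<in> {U. openin config_topology U}"
  then have U: "openin config_topology U" by simp
  let ?A = "\<lambda>n. {g \<in> PiE (cb 0 (int n)) (\<lambda>_. UNIV). \<forall>x'. (\<forall>p\<in>cb 0 (int n). x' p = g p) \<longrightarrow> x' \<in> U}"
  have finA: "finite (?A n)" for n by (rule finite_subset[of _ "PiE (cb 0 (int n)) (\<lambda>_. UNIV)"]) (auto intro: finite_PiE)
  have "f -` U \<inter> space M = (\<Union>n. \<Union>g\<in>?A n. {x\<in>space M. \<forall>p\<in>cb 0 (int n). f x p = g p})" (is "?L = ?R")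
  proof (intro equalityI subsetI)
    fix x assume x: "x \<in> ?L"
    then obtain n where n: "\<forall>x'. (\<forall>p\<in>cb 0 (int n). x' p = f x p) \<longrightarrow> x' \<in> U"
      using openin_config_cylinder[OF U, of "f x"] by auto
    have "restrict (f x) (cb 0 (int n)) \<in> ?A n" using n by simp
    then show "x \<in> ?R" using x by (intro UN_I[of n] UN_I[of "restrict (f x) (cb 0 (int n))"]) simp_all
  qed auto
  also have "\<dots> \<in> sets M"
  proof -
    have 1: "{x\<in>space M. \<forall>p\<in>cb 0 (int n). f x p = g p} \<in> sets M" for n g
      by (rule sets.sets_Collect_finite_All) (simp_all add: f)
    have "(\<Union>g\<in>?A n. {x\<in>space M. \<forall>p\<in>cb 0 (int n). f x p = g p}) \<in> sets M" for n
      by (rule sets.finite_UN[OF finA 1])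
    then show ?thesis by (intro sets.countable_UN) auto
  qed
  finally show "f -` U \<inter> space M \<in> sets M" .
qed

locale free_system =
  fixes Z :: "(int^'d \<Rightarrow> 'b::finite) set"
  assumes shift_Z: "y \<in> Z \<Longrightarrow> shift \<gamma> y \<in> Z"
    and free_Z: "y \<in> Z \<Longrightarrow> \<gamma> \<noteq> 0 \<Longrightarrow> shift \<gamma> y \<noteq> y"
begin

abbreviation N where "N \<equiv> restrict_space (borel_of config_topology) Z"

lemma space_N [simp]: "space N = Z" by (simp add: space_restrict_space)

text \<open>A \<open>borel_countable\<close> function stays so after composition with an arbitrary function. This allows
  Hilbert choice in the constructions below, as long as the choice only depends on such a function.\<close>

definition borel_pred :: "((int^'d \<Rightarrow> 'b) \<Rightarrow> bool) \<Rightarrow> bool" where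
  "borel_pred P \<longleftrightarrow> {y\<in>Z. P y} \<in> sets N"

definition borel_countable :: "((int^'d \<Rightarrow> 'b) \<Rightarrow> 'z) \<Rightarrow> bool" where
  "borel_countable f \<longleftrightarrow> countable (f ` Z) \<and> (\<forall>z. borel_pred (\<lambda>y. f y = z))"

lemma borel_pred_coord: "borel_pred (\<lambda>y. y p = b)"
proof -
  have "{x. x p = b} \<in> sets (borel_of config_topology)"
    unfolding sets_borel_of using openin_config_coordinate[of p b] by (intro sigma_sets.Basic) simp
  then have "Z \<inter> {x. x p = b} \<in> sets N" by (auto simp: sets_restrict_space)
  moreover have "Z \<inter> {x. x p = b} = {y\<in>Z. y p = b}" by auto
  ultimately show ?thesis by (simp add: borel_pred_def)
qed

lemma measurable_shift: "shift \<gamma> \<in> measurable N N"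
proof (rule measurable_restrict_space2)
  show "shift \<gamma> \<in> space N \<rightarrow> Z" using shift_Z by auto
  show "shift \<gamma> \<in> measurable N (borel_of config_topology)"
    by (rule measurable_config) (use borel_pred_coord in \<open>simp add: shift_apply borel_pred_def\<close>)
qed

lemma borel_pred_shift: assumes "borel_pred P" shows "borel_pred (\<lambda>y. P (shift \<gamma> y))"
proof -
  have "shift \<gamma> -` {y\<in>Z. P y} \<inter> space N \<in> sets N"
    by (rule measurable_sets[OF measurable_shift]) (use assms in \<open>simp add: borel_pred_def\<close>)
  moreover have "shift \<gamma> -` {y\<in>Z. P y} \<inter> space N = {y\<in>Z. P (shift \<gamma> y)}" using shift_Z by auto
  ultimately show ?thesis by (simp add: borel_pred_def)
qed

lemma borel_pred_cong: "(\<And>y. y \<in> Z \<Longrightarrow> P y = Q y) \<Longrightarrow> borel_pred P = borel_pred Q"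
  unfolding borel_pred_def by (rule arg_cong[of _ _ "\<lambda>A. A \<in> sets N"]) auto

lemma borel_pred_not: "borel_pred P \<Longrightarrow> borel_pred (\<lambda>y. \<not> P y)"
  unfolding borel_pred_def using sets.sets_Collect_neg[of N P] by simp

lemma borel_pred_conj: "borel_pred P \<Longrightarrow> borel_pred Q \<Longrightarrow> borel_pred (\<lambda>y. P y \<and> Q y)"
  unfolding borel_pred_def using sets.sets_Collect_conj[of N Q P] by simp

lemma borel_pred_ex: fixes P :: "'i::countable \<Rightarrow> _" shows "(\<And>i. borel_pred (P i)) \<Longrightarrow> borel_pred (\<lambda>y. \<exists>i. P i y)"
  unfolding borel_pred_def using sets.sets_Collect_countable_Ex[of N P] by simp

lemma borel_pred_all: fixes P :: "'i::countable \<Rightarrow> _" shows "(\<And>i. borel_pred (P i)) \<Longrightarrow> borel_pred (\<lambda>y. \<forall>i. P i y)"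
  unfolding borel_pred_def using sets.sets_Collect_countable_All[of N P] by simp

lemma borel_pred_const: "borel_pred (\<lambda>y. c)"
  unfolding borel_pred_def using sets.sets_Collect_const[of N c] by simp

lemma borel_pred_bex_countable:
  assumes "countable I" "\<And>i. i \<in> I \<Longrightarrow> borel_pred (P i)"
  shows "borel_pred (\<lambda>y. \<exists>i\<in>I. P i y)"
proof -
  have "(\<Union>i\<in>I. {y\<in>Z. P i y}) \<in> sets N"
    by (rule sets.countable_UN'[OF assms(1)]) (use assms(2) in \<open>auto simp: borel_pred_def\<close>)
  moreover have "(\<Union>i\<in>I. {y\<in>Z. P i y}) = {y\<in>Z. \<exists>i\<in>I. P i y}" by auto
  ultimately show ?thesis by (simp add: borel_pred_def)
qed

lemma borel_pred_ball_finite: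
  assumes "finite I" "\<And>i. i \<in> I \<Longrightarrow> borel_pred (P i)"
  shows "borel_pred (\<lambda>y. \<forall>i\<in>I. P i y)"
  using assms sets.sets_Collect_finite_All[of I N P] by (auto simp: borel_pred_def)

lemma borel_pred_cm: assumes "borel_countable f" shows "borel_pred (\<lambda>y. P (f y))"
proof -
  have "borel_pred (\<lambda>y. \<exists>z\<in>f ` Z \<inter> {z. P z}. f y = z)"
    by (rule borel_pred_bex_countable) (use assms in \<open>auto simp: borel_countable_def\<close>)
  then show ?thesis by (subst borel_pred_cong[of _ "\<lambda>y. \<exists>z\<in>f ` Z \<inter> {z. P z}. f y = z"]) auto
qed

lemma borel_countable_comp: assumes "borel_countable f" shows "borel_countable (\<lambda>y. g (f y))"
proof -
  have "countable ((\<lambda>y. g (f y)) ` Z)"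
    using countable_image[of "f ` Z" g] assms by (simp add: borel_countable_def image_image)
  moreover have "borel_pred (\<lambda>y. g (f y) = z)" for z using borel_pred_cm[OF assms, of "\<lambda>x. g x = z"] .
  ultimately show ?thesis by (simp add: borel_countable_def)
qed

lemma borel_countable_cong: assumes "\<And>y. y \<in> Z \<Longrightarrow> f y = g y" "borel_countable f" shows "borel_countable g"
proof -
  have "f ` Z = g ` Z" using assms(1) by (rule image_cong[OF refl])
  moreover have "borel_pred (\<lambda>y. f y = z) = borel_pred (\<lambda>y. g y = z)" for z by (rule borel_pred_cong) (simp add: assms(1))
  ultimately show ?thesis using assms(2) by (simp add: borel_countable_def)
qed

text \<open>\<open>g\<close> factors through \<open>f\<close>: pick any point of each fibre. For a
  definition by \<open>SOME\<close> it is therefore enough to list countably valued Borel data that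
  determine the predicate under it.\<close>

lemma borel_countable_det:
  assumes "borel_countable f" "\<And>y y'. y \<in> Z \<Longrightarrow> y' \<in> Z \<Longrightarrow> f y = f y' \<Longrightarrow> g y = g y'"
  shows "borel_countable g"
proof -
  let ?h = "\<lambda>z. g (SOME y. y \<in> Z \<and> f y = z)"
  have "?h (f y) = g y" if "y \<in> Z" for y
  proof -
    have "(SOME y'. y' \<in> Z \<and> f y' = f y) \<in> Z \<and> f (SOME y'. y' \<in> Z \<and> f y' = f y) = f y"
      by (rule someI[of _ y]) (simp add: that)
    then show ?thesis using assms(2) that by blast
  qed
  then show ?thesis using borel_countable_comp[OF assms(1), of ?h] by (rule borel_countable_cong)
qed

lemma borel_countable_window:
  assumes "finite I" "\<And>i. i \<in> I \<Longrightarrow> borel_countable (f i)"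
  shows "borel_countable (\<lambda>y. restrict (\<lambda>i. f i y) I)"
  unfolding borel_countable_def
proof (intro conjI allI)
  have "(\<lambda>y. restrict (\<lambda>i. f i y) I) ` Z \<subseteq> PiE I (\<lambda>i. f i ` Z)" by auto
  moreover have "countable (PiE I (\<lambda>i. f i ` Z))"
    using assms by (intro countable_PiE) (auto simp: borel_countable_def)
  ultimately show "countable ((\<lambda>y. restrict (\<lambda>i. f i y) I) ` Z)" by (rule countable_subset)
  fix z
  have "borel_pred (\<lambda>y. z \<in> extensional I \<and> (\<forall>i\<in>I. f i y = z i))"
    by (intro borel_pred_conj borel_pred_const borel_pred_ball_finite) (use assms in \<open>auto simp: borel_countable_def\<close>)
  moreover have "restrict (\<lambda>i. f i y) I = z \<longleftrightarrow> z \<in> extensional I \<and> (\<forall>i\<in>I. f i y = z i)" for y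
    by (auto simp: extensional_def fun_eq_iff)
  ultimately show "borel_pred (\<lambda>y. restrict (\<lambda>i. f i y) I = z)" by simp
qed

lemma borel_countable_det_window:
  assumes "finite I" "\<And>i. i \<in> I \<Longrightarrow> borel_countable (f i)"
    "\<And>y y'. y \<in> Z \<Longrightarrow> y' \<in> Z \<Longrightarrow> (\<And>i. i \<in> I \<Longrightarrow> f i y = f i y') \<Longrightarrow> g y = g y'"
  shows "borel_countable g"
proof (rule borel_countable_det[OF borel_countable_window[OF assms(1,2)]])
  fix y y' assume "y \<in> Z" "y' \<in> Z" and eq: "restrict (\<lambda>i. f i y) I = restrict (\<lambda>i. f i y') I"
  moreover have "f i y = f i y'" if "i \<in> I" for i using fun_cong[OF eq, of i] that by simp
  ultimately show "g y = g y'" using assms(3) by blast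
qed

lemma borel_countable_pair: assumes "borel_countable f" "borel_countable g" shows "borel_countable (\<lambda>y. (f y, g y))"
  unfolding borel_countable_def
proof (intro conjI allI)
  have "(\<lambda>y. (f y, g y)) ` Z \<subseteq> f ` Z \<times> g ` Z" by auto
  then show "countable ((\<lambda>y. (f y, g y)) ` Z)"
    by (rule countable_subset) (use assms in \<open>auto simp: borel_countable_def\<close>)
  fix z
  have "borel_pred (\<lambda>y. f y = fst z \<and> g y = snd z)" using assms by (intro borel_pred_conj) (auto simp: borel_countable_def)
  then show "borel_pred (\<lambda>y. (f y, g y) = z)" by (simp add: prod_eq_iff)
qed

lemma borel_countable_shift: assumes "borel_countable f" shows "borel_countable (\<lambda>y. f (shift \<gamma> y))"
  unfolding borel_countable_def
proof (intro conjI allI)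
  have "(\<lambda>y. f (shift \<gamma> y)) ` Z \<subseteq> f ` Z" using shift_Z by auto
  then show "countable ((\<lambda>y. f (shift \<gamma> y)) ` Z)"
    by (rule countable_subset) (use assms in \<open>auto simp: borel_countable_def\<close>)
  show "borel_pred (\<lambda>y. f (shift \<gamma> y) = z)" for z
    using borel_pred_shift[of "\<lambda>y. f y = z"] assms by (simp add: borel_countable_def)
qed

lemma borel_countable_pred: assumes "borel_pred P" shows "borel_countable P"
  unfolding borel_countable_def
proof (intro conjI allI)
  show "countable (P ` Z)" by (rule countable_subset[of _ UNIV]) auto
  show "borel_pred (\<lambda>y. P y = z)" for z using assms borel_pred_not[OF assms] by (cases z) auto
qed

lemma borel_countable_coord: "borel_countable (\<lambda>y. y p)"
  unfolding borel_countable_def using borel_pred_coord by (auto intro: countable_finite)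

lemma borel_countable_case:
  assumes "borel_countable n" "\<And>i::'i::countable. borel_countable (f i)"
  shows "borel_countable (\<lambda>y. f (n y) y)"
  unfolding borel_countable_def
proof (intro conjI allI)
  have "(\<lambda>y. f (n y) y) ` Z \<subseteq> (\<Union>i. f i ` Z)" by auto
  then show "countable ((\<lambda>y. f (n y) y) ` Z)"
    by (rule countable_subset) (use assms(2) in \<open>auto simp: borel_countable_def\<close>)
  fix z
  have "borel_pred (\<lambda>y. \<exists>i. n y = i \<and> f i y = z)"
    by (intro borel_pred_ex borel_pred_conj) (use assms in \<open>auto simp: borel_countable_def\<close>)
  then show "borel_pred (\<lambda>y. f (n y) y = z)" by simp
qed

lemma borel_countable_Least: assumes "\<And>n::nat. borel_pred (P n)" shows "borel_countable (\<lambda>y. LEAST n. P n y)"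
proof -
  have borel_pred: "borel_pred (\<lambda>y. (LEAST n. P n y) = m)" for m
  proof -
    \<comment> \<open>If no \<open>n\<close> satisfies the predicate, \<open>LEAST\<close> returns a
      fixed unspecified number, namely \<open>LEAST n. False\<close>; the second disjunct accounts
      for these points.\<close>
    have e: "(LEAST n. P n y) = m \<longleftrightarrow> (\<exists>n. P n y) \<and> P m y \<and> (\<forall>i. i < m \<longrightarrow> \<not> P i y) \<or>
        \<not> ((\<exists>n. P n y) \<or> m \<noteq> (LEAST n::nat. False))" for y
    proof (cases "\<exists>n. P n y")
      case True
      show ?thesis
      proof
        assume "(LEAST n. P n y) = m"
        then show "(\<exists>n. P n y) \<and> P m y \<and> (\<forall>i. i < m \<longrightarrow> \<not> P i y) \<or> \<not> ((\<exists>n. P n y) \<or> m \<noteq> (LEAST n::nat. False))"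
          using True by (metis LeastI_ex not_less_Least)
      next
        assume "(\<exists>n. P n y) \<and> P m y \<and> (\<forall>i. i < m \<longrightarrow> \<not> P i y) \<or> \<not> ((\<exists>n. P n y) \<or> m \<noteq> (LEAST n::nat. False))"
        then have "P m y" "\<And>i. P i y \<Longrightarrow> m \<le> i" using True not_le by blast+
        then show "(LEAST n. P n y) = m" by (rule Least_equality)
      qed
    next
      case False
      then show ?thesis by auto
    qed
    have imp: "borel_pred (\<lambda>y. i < m \<longrightarrow> \<not> P i y)" for i
      by (cases "i < m") (simp_all add: borel_pred_const borel_pred_not assms)
    have c: "borel_pred (\<lambda>y. (\<exists>n. P n y) \<and> P m y \<and> (\<forall>i. i < m \<longrightarrow> \<not> P i y))"
      by (intro borel_pred_conj borel_pred_ex borel_pred_all assms imp)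
    have c': "borel_pred (\<lambda>y. \<not> (\<exists>n. P n y) \<and> m = (LEAST n::nat. False))"
      by (intro borel_pred_conj borel_pred_ex borel_pred_not borel_pred_const assms)
    have "borel_pred (\<lambda>y. \<not> (\<not> ((\<exists>n. P n y) \<and> P m y \<and> (\<forall>i. i < m \<longrightarrow> \<not> P i y)) \<and>
        \<not> (\<not> (\<exists>n. P n y) \<and> m = (LEAST n::nat. False))))"
      using borel_pred_not[OF borel_pred_conj[OF borel_pred_not[OF c] borel_pred_not[OF c']]] .
    then show ?thesis by (rule back_subst[of borel_pred]) (auto simp: fun_eq_iff e)
  qed
  show ?thesis unfolding borel_countable_def using borel_pred by auto
qed

subsection \<open>Marker sets\<close>

text \<open>The size of a window in which \<open>y\<close> is told apart from all its translates by
  short nonzero vectors. It is attained because \<open>y\<close> is free and there are finitely many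
  such vectors.\<close>

definition sep_radius :: "int \<Rightarrow> (int^'d \<Rightarrow> 'b) \<Rightarrow> nat" where
  "sep_radius R y = (LEAST n. \<forall>\<gamma>\<in>cb 0 R - {0}. \<exists>p\<in>cb 0 (int n). y (\<gamma> + p) \<noteq> y p)"

lemma sep_radius:
  assumes "y \<in> Z"
  shows "\<forall>\<gamma>\<in>cb 0 R - {0}. \<exists>p\<in>cb 0 (int (sep_radius R y)). y (\<gamma> + p) \<noteq> y p"
  unfolding sep_radius_def
proof (rule LeastI_ex)
  have "\<exists>p. y (\<gamma> + p) \<noteq> y p" if "\<gamma> \<noteq> 0" for \<gamma>
    using free_Z[OF assms that] by (auto simp: fun_eq_iff shift_apply)
  then obtain w where w: "\<And>\<gamma>. \<gamma> \<noteq> 0 \<Longrightarrow> y (\<gamma> + w \<gamma>) \<noteq> y (w \<gamma>)" by metis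
  let ?n = "nat (Max (insert 0 ((\<lambda>\<gamma>. nrm (w \<gamma>)) ` cb 0 R)))"
  have "nrm (w \<gamma>) \<le> int ?n" if "\<gamma> \<in> cb 0 R" for \<gamma>
    using that by (auto intro!: order_trans[OF Max_ge[of "insert 0 ((\<lambda>\<gamma>. nrm (w \<gamma>)) ` cb 0 R)"]])
  then show "\<exists>n. \<forall>\<gamma>\<in>cb 0 R - {0}. \<exists>p\<in>cb 0 (int n). y (\<gamma> + p) \<noteq> y p"
    using w by (intro exI[of _ ?n]) force
qed

lemma borel_countable_local: "borel_countable (\<lambda>y. restrict y (cb 0 n))"
  by (rule borel_countable_window) (simp_all add: borel_countable_coord)

text \<open>The label is the pattern of \<open>y\<close> in its separating window, together with the
  size of the window. Equal labels force windows of equal size, so a short translate with the same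
  label would agree with \<open>y\<close> exactly where it has to differ.\<close>

lemma label_exists:
  "\<exists>idx :: _ \<Rightarrow> nat. borel_countable idx \<and> (\<forall>y\<in>Z. \<forall>\<gamma>\<in>cb 0 R - {0}. idx (shift \<gamma> y) \<noteq> idx y)"
proof -
  have cmN: "borel_countable (sep_radius R)" unfolding sep_radius_def[abs_def]
  proof (rule borel_countable_Least)
    fix n
    show "borel_pred (\<lambda>y. \<forall>\<gamma>\<in>cb 0 R - {0}. \<exists>p\<in>cb 0 (int n). y (\<gamma> + p) \<noteq> y p)"
    proof (intro borel_pred_ball_finite borel_pred_bex_countable borel_pred_not)
      fix \<gamma> p :: "int^'d"
      show "borel_pred (\<lambda>y. y (\<gamma> + p) = y p)"
        using borel_pred_cm[OF borel_countable_pair[OF borel_countable_coord[of "\<gamma> + p"] borel_countable_coord[of p]], of "\<lambda>z. fst z = snd z"] by simp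
    qed (auto intro: countable_finite)
  qed
  define lab where "lab y = (sep_radius R y, restrict y (cb 0 (int (sep_radius R y))))" for y
  have cml: "borel_countable lab"
    unfolding lab_def[abs_def]
    by (intro borel_countable_pair cmN borel_countable_case[OF cmN, of "\<lambda>n y. restrict y (cb 0 (int n))"] borel_countable_local)
  have "lab (shift \<gamma> y) \<noteq> lab y" if y: "y \<in> Z" and g: "\<gamma> \<in> cb 0 R - {0}" for y \<gamma>
  proof
    assume eq: "lab (shift \<gamma> y) = lab y"
    let ?n = "int (sep_radius R y)"
    have "restrict (shift \<gamma> y) (cb 0 ?n) = restrict y (cb 0 ?n)" using eq by (auto simp: lab_def)
    then have "y (\<gamma> + p) = y p" if "p \<in> cb 0 ?n" for p
      using that by (metis restrict_apply' shift_apply)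
    then show False using sep_radius[OF y, of R] g by blast
  qed
  moreover have "inj_on (to_nat_on (lab ` Z)) (lab ` Z)"
    using cml by (intro inj_on_to_nat_on) (simp add: borel_countable_def)
  ultimately have "to_nat_on (lab ` Z) (lab (shift \<gamma> y)) \<noteq> to_nat_on (lab ` Z) (lab y)"
    if "y \<in> Z" "\<gamma> \<in> cb 0 R - {0}" for y \<gamma>
    using that shift_Z by (simp add: inj_on_eq_iff)
  then show ?thesis using borel_countable_comp[OF cml, of "to_nat_on (lab ` Z)"]
    by (intro exI[of _ "\<lambda>y. to_nat_on (lab ` Z) (lab y)"]) blast
qed

text \<open>First-fit colouring in the order of the labels, written as recursion on the label
  \<open>n\<close> of \<open>y\<close>: the forbidden colours are those of neighbours with smaller
  label. The inner test repeats the premise so that the recursive call is visibly at a smaller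
  argument.\<close>

fun greedy :: "int \<Rightarrow> ((int^'d \<Rightarrow> 'b) \<Rightarrow> bool) \<Rightarrow> ((int^'d \<Rightarrow> 'b) \<Rightarrow> nat) \<Rightarrow> nat \<Rightarrow> (int^'d \<Rightarrow> 'b) \<Rightarrow> nat" where
  "greedy R V idx n y = (LEAST c. \<forall>\<gamma>\<in>cb 0 R. V (shift \<gamma> y) \<and> idx (shift \<gamma> y) < n \<longrightarrow>
     c \<noteq> (if idx (shift \<gamma> y) < n then greedy R V idx (idx (shift \<gamma> y)) (shift \<gamma> y) else 0))"

declare greedy.simps [simp del]

lemma Least_notin_finite:
  assumes "finite (A :: nat set)"
  shows "(LEAST c. c \<notin> A) \<notin> A" "(LEAST c. c \<notin> A) \<le> card A" "c < (LEAST c. c \<notin> A) \<Longrightarrow> c \<in> A"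
proof -
  show "(LEAST c. c \<notin> A) \<notin> A"
    using ex_new_if_finite[OF infinite_UNIV_nat assms] by (rule LeastI_ex)
  show *: "c < (LEAST c. c \<notin> A) \<Longrightarrow> c \<in> A" for c using not_less_Least by blast
  have "{..<(LEAST c. c \<notin> A)} \<subseteq> A"
  proof
    fix x assume "x \<in> {..<(LEAST c. c \<notin> A)}"
    then have "x < (LEAST c. c \<notin> A)" by (rule lessThan_iff[THEN iffD1])
    then show "x \<in> A" by (rule *)
  qed
  from card_mono[OF assms this] show "(LEAST c. c \<notin> A) \<le> card A" by (simp only: card_lessThan)
qed

text \<open>Labels of neighbours differ, so one of two neighbours sees the colour of the other.
  First fit yields more than properness: the colour is bounded by the number of neighbours, and a
  point of positive colour has a neighbour of colour 0, so colour 0 is a maximal independent set in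
  \<open>V\<close>.\<close>

lemma greedy_colouring:
  fixes idx :: "(int^'d \<Rightarrow> 'b) \<Rightarrow> nat"
  assumes cmi: "borel_countable idx" and idx: "\<forall>y\<in>Z. \<forall>\<gamma>\<in>cb 0 R - {0}. idx (shift \<gamma> y) \<noteq> idx y"
    and V: "borel_pred V"
  obtains col :: "(int^'d \<Rightarrow> 'b) \<Rightarrow> nat" where "borel_countable col"
    "\<And>y \<gamma>. y \<in> Z \<Longrightarrow> \<gamma> \<in> cb 0 R - {0} \<Longrightarrow> V y \<Longrightarrow> V (shift \<gamma> y) \<Longrightarrow> col (shift \<gamma> y) \<noteq> col y"
    "\<And>y. y \<in> Z \<Longrightarrow> col y \<le> card {\<gamma>\<in>cb 0 R. V (shift \<gamma> y)}"
    "\<And>y. y \<in> Z \<Longrightarrow> 0 < col y \<Longrightarrow> \<exists>\<gamma>\<in>cb 0 R. V (shift \<gamma> y) \<and> col (shift \<gamma> y) = 0"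
proof -
  let ?g = "greedy R V idx"
  define col where "col y = ?g (idx y) y" for y
  define used where "used y = (\<lambda>\<gamma>. col (shift \<gamma> y)) ` {\<gamma>\<in>cb 0 R. V (shift \<gamma> y) \<and> idx (shift \<gamma> y) < idx y}" for y
  have fin: "finite (used y)" for y unfolding used_def by (intro finite_imageI finite_subset[OF _ finite_cb[of 0 R]]) auto
  have col: "col y = (LEAST c. c \<notin> used y)" for y
    unfolding col_def[of y] greedy.simps[of R V idx "idx y"] used_def
    by (rule arg_cong[of _ _ Least]) (auto simp: fun_eq_iff col_def)
  have cmg: "borel_countable (?g n)" for n
  proof (induction n rule: less_induct)
    case (less n)
    let ?f = "\<lambda>\<gamma> y. (V (shift \<gamma> y), idx (shift \<gamma> y), restrict (\<lambda>j. ?g j (shift \<gamma> y)) {..<n})"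
    show ?case
    proof (rule borel_countable_det_window[of "cb 0 R" ?f])
      show "borel_countable (?f \<gamma>)" for \<gamma>
        using borel_countable_shift[OF borel_countable_pair[OF borel_countable_pred[OF V] borel_countable_pair[OF cmi borel_countable_window[of "{..<n}" ?g]]], of \<gamma>] less by simp
      fix y y' assume eq: "\<And>\<gamma>. \<gamma> \<in> cb 0 R \<Longrightarrow> ?f \<gamma> y = ?f \<gamma> y'"
      have 1: "V (shift \<gamma> y) = V (shift \<gamma> y')" "idx (shift \<gamma> y) = idx (shift \<gamma> y')"
        if "\<gamma> \<in> cb 0 R" for \<gamma> using eq[OF that] by auto
      have 2: "?g j (shift \<gamma> y) = ?g j (shift \<gamma> y')" if "\<gamma> \<in> cb 0 R" "j < n" for \<gamma> j
      proof -
        have "restrict (\<lambda>j. ?g j (shift \<gamma> y)) {..<n} = restrict (\<lambda>j. ?g j (shift \<gamma> y')) {..<n}"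
          using eq[OF that(1)] by auto
        from fun_cong[OF this, of j] show ?thesis using that(2) by simp
      qed
      show "?g n y = ?g n y'"
        unfolding greedy.simps[of R V idx n] by (rule arg_cong[of _ _ Least]) (auto simp: fun_eq_iff 1 2)
    qed simp
  qed
  show ?thesis
  proof
    show "borel_countable col" unfolding col_def[abs_def] by (rule borel_countable_case[OF cmi cmg])
    fix y assume y: "y \<in> Z"
    show "col y \<le> card {\<gamma>\<in>cb 0 R. V (shift \<gamma> y)}"
    proof -
      have "col y \<le> card (used y)" unfolding col by (rule Least_notin_finite(2)[OF fin])
      also have "\<dots> \<le> card {\<gamma>\<in>cb 0 R. V (shift \<gamma> y) \<and> idx (shift \<gamma> y) < idx y}"
        unfolding used_def by (rule card_image_le) (rule finite_subset[OF _ finite_cb[of 0 R]], auto)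
      also have "\<dots> \<le> card {\<gamma>\<in>cb 0 R. V (shift \<gamma> y)}" by (rule card_mono) (rule finite_subset[OF _ finite_cb[of 0 R]], auto)
      finally show ?thesis .
    qed
    show "\<exists>\<gamma>\<in>cb 0 R. V (shift \<gamma> y) \<and> col (shift \<gamma> y) = 0" if "0 < col y"
    proof -
      have "0 \<in> used y" by (rule Least_notin_finite(3)[OF fin]) (use that col[of y] in simp)
      then show ?thesis by (auto simp: used_def)
    qed
    have *: "col (shift \<gamma> y) \<noteq> col y" if "y \<in> Z" "\<gamma> \<in> cb 0 R" "V (shift \<gamma> y)" "idx (shift \<gamma> y) < idx y" for y \<gamma>
    proof -
      have "col (shift \<gamma> y) \<in> used y" using that by (auto simp: used_def)
      moreover have "col y \<notin> used y" unfolding col[of y] by (rule Least_notin_finite(1)[OF fin])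
      ultimately show ?thesis by auto
    qed
    fix \<gamma> assume g: "\<gamma> \<in> cb 0 R - {0}" and VV: "V y" "V (shift \<gamma> y)"
    consider "idx (shift \<gamma> y) < idx y" | "idx y < idx (shift \<gamma> y)" using idx y g by (metis linorder_neqE_nat)
    then show "col (shift \<gamma> y) \<noteq> col y"
    proof cases
      case 1 then show ?thesis using *[OF y] g VV by simp
    next
      case 2
      then show ?thesis using *[of "shift \<gamma> y" "- \<gamma>"] y g VV by (simp add: shift_shift shift_Z)
    qed
  qed
qed

text \<open>Two colourings. Colour 0 of the first, at radius \<open>R\<close>, is a set
  \<open>V\<close> that is both \<open>R\<close>-separated and \<open>R\<close>-dense in each orbit.
  The second colours \<open>V\<close> at radius \<open>100 * R\<close>, so that each of its colour
  classes is sparse. The value 0 of \<open>f\<close> is reserved for points off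
  \<open>V\<close>.\<close>

lemma coloured_markers:
  assumes R: "0 < R"
  shows "\<exists>f :: _ \<Rightarrow> nat. borel_countable f \<and> (\<forall>y\<in>Z. \<exists>\<gamma>. nrm \<gamma> \<le> R \<and> f (shift \<gamma> y) \<noteq> 0) \<and>
    (\<forall>y\<in>Z. f y \<le> Suc (201 ^ CARD('d))) \<and>
    (\<forall>y\<in>Z. \<forall>\<gamma>. \<gamma> \<noteq> 0 \<longrightarrow> f y \<noteq> 0 \<longrightarrow> f (shift \<gamma> y) = f y \<longrightarrow> 100 * R < nrm \<gamma>)"
proof -
  from label_exists[of R] obtain idx :: "_ \<Rightarrow> nat" where cmi: "borel_countable idx"
    and idx: "\<forall>y\<in>Z. \<forall>\<gamma>\<in>cb 0 R - {0}. idx (shift \<gamma> y) \<noteq> idx y" by (elim exE conjE)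
  obtain col :: "_ \<Rightarrow> nat" where col: "borel_countable col"
    "\<And>y \<gamma>. y \<in> Z \<Longrightarrow> \<gamma> \<in> cb 0 R - {0} \<Longrightarrow> True \<Longrightarrow> True \<Longrightarrow> col (shift \<gamma> y) \<noteq> col y"
    "\<And>y. y \<in> Z \<Longrightarrow> col y \<le> card {\<gamma>::int^'d \<in> cb 0 R. True}"
    "\<And>y. y \<in> Z \<Longrightarrow> 0 < col y \<Longrightarrow> \<exists>\<gamma>\<in>cb 0 R. True \<and> col (shift \<gamma> y) = 0"
    by (rule greedy_colouring[OF cmi idx borel_pred_const[of True]]) (rule that)
  define V where "V y \<longleftrightarrow> col y = 0" for y
  have V: "borel_pred V" unfolding V_def[abs_def] using borel_pred_cm[OF col(1), of "\<lambda>z. z = 0"] .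
  from label_exists[of "100 * R"] obtain idx' :: "_ \<Rightarrow> nat" where cmi': "borel_countable idx'"
    and idx': "\<forall>y\<in>Z. \<forall>\<gamma>\<in>cb 0 (100 * R) - {0}. idx' (shift \<gamma> y) \<noteq> idx' y" by (elim exE conjE)
  obtain col' :: "_ \<Rightarrow> nat" where col': "borel_countable col'"
    "\<And>y \<gamma>. y \<in> Z \<Longrightarrow> \<gamma> \<in> cb 0 (100 * R) - {0} \<Longrightarrow> V y \<Longrightarrow> V (shift \<gamma> y) \<Longrightarrow> col' (shift \<gamma> y) \<noteq> col' y"
    "\<And>y. y \<in> Z \<Longrightarrow> col' y \<le> card {\<gamma>\<in>cb 0 (100 * R). V (shift \<gamma> y)}"
    "\<And>y. y \<in> Z \<Longrightarrow> 0 < col' y \<Longrightarrow> \<exists>\<gamma>\<in>cb 0 (100 * R). V (shift \<gamma> y) \<and> col' (shift \<gamma> y) = 0"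
    by (rule greedy_colouring[OF cmi' idx' V]) (rule that)
  \<comment> \<open>Points of \<open>V\<close> in one orbit are more than \<open>R\<close> apart, so
    dividing coordinates by \<open>R\<close> is injective on them; the quotients lie between -100
    and 100, which is 201 values per coordinate.\<close>
  have pack: "card {\<gamma>\<in>cb 0 (100 * R). V (shift \<gamma> y)} \<le> 201 ^ CARD('d)" if y: "y \<in> Z" for y
  proof -
    let ?A = "{\<gamma>\<in>cb 0 (100 * R). V (shift \<gamma> y)}"
    let ?h = "\<lambda>\<gamma>::int^'d. \<chi> i. \<gamma>$i div R"
    have "inj_on ?h ?A"
    proof (rule inj_onI)
      fix \<gamma> \<delta> assume g: "\<gamma> \<in> ?A" "\<delta> \<in> ?A" and eq: "?h \<gamma> = ?h \<delta>"
      have "\<bar>(\<delta> - \<gamma>)$i\<bar> \<le> R" for i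
      proof -
        have "\<gamma>$i div R = \<delta>$i div R" using eq by (simp add: vec_eq_iff)
        then show ?thesis
          using div_eq_iff_bounds[OF R, of "\<gamma>$i" "\<gamma>$i div R"] div_eq_iff_bounds[OF R, of "\<delta>$i" "\<gamma>$i div R"]
          by simp linarith
      qed
      then have "\<delta> - \<gamma> \<in> cb 0 R" by (simp add: nrm_le_iff)
      then show "\<gamma> = \<delta>"
        using col(2)[OF shift_Z[OF y, of \<gamma>], of "\<delta> - \<gamma>"] g by (auto simp: shift_shift V_def)
    qed
    moreover have "?h ` ?A \<subseteq> cb 0 100"
    proof
      fix x assume "x \<in> ?h ` ?A"
      then obtain \<gamma> where g: "\<gamma> \<in> ?A" "x = ?h \<gamma>" by auto
      have "\<bar>x$i\<bar> \<le> 100" for i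
      proof -
        have "\<bar>\<gamma>$i\<bar> \<le> 100 * R" using g(1) by (simp add: nrm_le_iff)
        then have "\<gamma>$i div R \<le> (100 * R) div R" "((-100) * R) div R \<le> \<gamma>$i div R"
          using R by (intro zdiv_mono1; simp)+
        moreover have "(100 * R) div R = 100" "((-100) * R) div R = -100"
          using R by (intro nonzero_mult_div_cancel_right; simp)+
        ultimately have "\<bar>\<gamma>$i div R\<bar> \<le> 100" by linarith
        then show ?thesis using g(2) by simp
      qed
      then show "x \<in> cb 0 100" by (simp add: nrm_le_iff)
    qed
    ultimately have "card ?A \<le> card (cb 0 100 :: (int^'d) set)" using card_inj_on_le[OF _ _ finite_cb] by blast
    then show ?thesis by (simp add: card_cb)
  qed
  define f where "f y = (if V y then Suc (col' y) else 0)" for y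
  have "borel_countable f"
    using borel_countable_comp[OF borel_countable_pair[OF borel_countable_pred[OF V] col'(1)], of "\<lambda>z. if fst z then Suc (snd z) else 0"]
    unfolding f_def[abs_def] fst_conv snd_conv .
  moreover have "\<exists>\<gamma>. nrm \<gamma> \<le> R \<and> f (shift \<gamma> y) \<noteq> 0" if y: "y \<in> Z" for y
  proof (cases "col y = 0")
    case True then show ?thesis using R by (intro exI[of _ 0]) (simp add: f_def V_def)
  next
    case False
    then obtain \<gamma> where "\<gamma> \<in> cb 0 R" "col (shift \<gamma> y) = 0" using col(4)[OF y] by auto
    then show ?thesis by (intro exI[of _ \<gamma>]) (simp add: f_def V_def)
  qed
  moreover have "f y \<le> Suc (201 ^ CARD('d))" if "y \<in> Z" for y
    using col'(3)[OF that] pack[OF that] by (simp add: f_def)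
  moreover have "100 * R < nrm \<gamma>" if "y \<in> Z" "\<gamma> \<noteq> 0" "f y \<noteq> 0" "f (shift \<gamma> y) = f y" for y \<gamma>
    using col'(2)[OF that(1), of \<gamma>] that by (force simp: f_def split: if_splits)
  ultimately show ?thesis by blast
qed

text \<open>At every scale some marker lies within \<open>r n\<close>, in one of boundedly many
  colours, so by the pigeonhole principle one colour serves infinitely many scales. The additive
  slack \<open>c\<close> makes this property of a colour the same along the orbit; the least good
  colour \<open>I y\<close> is then constant on orbits, and each scale keeps a single sparse
  class.\<close>

lemma markers_exist:
  assumes r: "\<And>n. 0 < r n"
  obtains M :: "nat \<Rightarrow> (int^'d \<Rightarrow> 'b) \<Rightarrow> bool" where "\<And>n. borel_pred (M n)"
    "\<And>n y \<gamma>. y \<in> Z \<Longrightarrow> M n y \<Longrightarrow> M n (shift \<gamma> y) \<Longrightarrow> \<gamma> \<noteq> 0 \<Longrightarrow> 100 * r n < nrm \<gamma>"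
    "\<And>y. y \<in> Z \<Longrightarrow> \<exists>c::nat. \<forall>n0. \<exists>n\<ge>n0. \<exists>\<gamma>. nrm \<gamma> \<le> r n + int c \<and> M n (shift \<gamma> y)"
proof -
  let ?k = "Suc (201 ^ CARD('d))"
  have "\<forall>n. \<exists>f :: _ \<Rightarrow> nat. borel_countable f \<and> (\<forall>y\<in>Z. \<exists>\<gamma>. nrm \<gamma> \<le> r n \<and> f (shift \<gamma> y) \<noteq> 0) \<and>
    (\<forall>y\<in>Z. f y \<le> ?k) \<and>
    (\<forall>y\<in>Z. \<forall>\<gamma>. \<gamma> \<noteq> 0 \<longrightarrow> f y \<noteq> 0 \<longrightarrow> f (shift \<gamma> y) = f y \<longrightarrow> 100 * r n < nrm \<gamma>)"
    using coloured_markers[OF r] by blast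
  then obtain f :: "nat \<Rightarrow> _ \<Rightarrow> nat" where f: "\<And>n. borel_countable (f n)"
    "\<And>n y. y \<in> Z \<Longrightarrow> \<exists>\<gamma>. nrm \<gamma> \<le> r n \<and> f n (shift \<gamma> y) \<noteq> 0"
    "\<And>n y. y \<in> Z \<Longrightarrow> f n y \<le> ?k"
    "\<And>n y \<gamma>. y \<in> Z \<Longrightarrow> \<gamma> \<noteq> 0 \<Longrightarrow> f n y \<noteq> 0 \<Longrightarrow> f n (shift \<gamma> y) = f n y \<Longrightarrow> 100 * r n < nrm \<gamma>"
    by metis
  define good where "good i y \<longleftrightarrow> i \<noteq> 0 \<and> (\<exists>c::nat. \<forall>n0. \<exists>n. n \<ge> n0 \<and> (\<exists>\<gamma>. nrm \<gamma> \<le> r n + int c \<and> f n (shift \<gamma> y) = i))"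
    for i y
  have mpg: "borel_pred (good i)" for i
    unfolding good_def[abs_def]
    by (intro borel_pred_conj borel_pred_const borel_pred_ex borel_pred_all borel_pred_shift[of "\<lambda>y. f _ y = i"]) (use f(1) in \<open>simp add: borel_countable_def\<close>)
  have good_ex: "\<exists>i. good i y" if y: "y \<in> Z" for y
  proof -
    obtain g where g: "\<And>n. nrm (g n) \<le> r n" "\<And>n. f n (shift (g n) y) \<noteq> 0" using f(2)[OF y] by metis
    have "finite ((\<lambda>n. f n (shift (g n) y)) ` UNIV)"
      by (rule finite_subset[of _ "{..?k}"]) (use f(3) shift_Z[OF y] in auto)
    then obtain n1 where n1: "infinite {n. f n (shift (g n) y) = f n1 (shift (g n1) y)}"
      using pigeonhole_infinite[of UNIV "\<lambda>n. f n (shift (g n) y)"] by auto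
    let ?i = "f n1 (shift (g n1) y)"
    have "\<exists>n. n \<ge> n0 \<and> (\<exists>\<gamma>. nrm \<gamma> \<le> r n + int 0 \<and> f n (shift \<gamma> y) = ?i)" for n0
    proof -
      obtain n where "n \<ge> n0" "f n (shift (g n) y) = ?i"
        using n1 unfolding infinite_nat_iff_unbounded_le by auto
      then show ?thesis using g(1) by auto
    qed
    then have "good ?i y" unfolding good_def using g(2) by blast
    then show ?thesis by blast
  qed
  have good_shift': "good i y" if gs: "good i (shift \<delta> y)" for i y \<delta>
  proof -
    obtain c where c: "\<And>n0. \<exists>n. n \<ge> n0 \<and> (\<exists>\<gamma>. nrm \<gamma> \<le> r n + int c \<and> f n (shift \<gamma> (shift \<delta> y)) = i)"
      and i: "i \<noteq> 0" using gs by (auto simp: good_def)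
    have "\<exists>n. n \<ge> n0 \<and> (\<exists>\<gamma>. nrm \<gamma> \<le> r n + int (c + nat (nrm \<delta>)) \<and> f n (shift \<gamma> y) = i)" for n0
    proof -
      obtain n \<gamma> where n: "n \<ge> n0" "nrm \<gamma> \<le> r n + int c" "f n (shift \<gamma> (shift \<delta> y)) = i" using c by blast
      then have "nrm (\<delta> + \<gamma>) \<le> r n + int (c + nat (nrm \<delta>))" using nrm_triangle[of \<delta> \<gamma>] by simp
      then show ?thesis using n by (auto simp: shift_shift)
    qed
    then show ?thesis unfolding good_def using i by blast
  qed
  have good_shift: "good i (shift \<delta> y) = good i y" for i y \<delta>
    using good_shift'[of i \<delta> y] good_shift'[of i "- \<delta>" "shift \<delta> y"] by (auto simp: shift_shift)
  define I where "I y = (LEAST i. good i y)" for y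
  have I: "good (I y) y" if "y \<in> Z" for y unfolding I_def using good_ex[OF that] by (rule LeastI_ex)
  have I_shift: "I (shift \<delta> y) = I y" for y \<delta> by (simp add: I_def good_shift)
  have cmI: "borel_countable I" unfolding I_def[abs_def] by (rule borel_countable_Least[OF mpg])
  show ?thesis
  proof
    let ?M = "\<lambda>n y. f n y = I y"
    show "borel_pred (?M n)" for n
      using borel_pred_cm[OF borel_countable_pair[OF f(1)[of n] cmI], of "\<lambda>z. fst z = snd z"] by simp
    show "100 * r n < nrm \<gamma>" if "y \<in> Z" "?M n y" "?M n (shift \<gamma> y)" "\<gamma> \<noteq> 0" for n y \<gamma>
      using f(4)[OF that(1,4), of n] I[OF that(1)] that by (auto simp: I_shift good_def)
    show "\<exists>c::nat. \<forall>n0. \<exists>n\<ge>n0. \<exists>\<gamma>. nrm \<gamma> \<le> r n + int c \<and> ?M n (shift \<gamma> y)" if "y \<in> Z" for y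
      using I[OF that] unfolding good_def I_shift by blast
  qed
qed

end

subsection \<open>The toast\<close>

locale toast = free_system Z + scales \<rho> K
  for Z :: "(int^'d \<Rightarrow> 'b::finite) set" and \<rho> K +
  fixes M :: "nat \<Rightarrow> (int^'d \<Rightarrow> 'b) \<Rightarrow> bool"
  assumes dim: "CARD('d) \<ge> 2"
    and borel_pred_M: "borel_pred (M n)"
    and M_sep: "y \<in> Z \<Longrightarrow> M n y \<Longrightarrow> M n (shift \<gamma> y) \<Longrightarrow> \<gamma> \<noteq> 0 \<Longrightarrow> 100 * r n < nrm \<gamma>"
    and M_cov: "y \<in> Z \<Longrightarrow> \<exists>c::nat. \<forall>n0. \<exists>n\<ge>n0. \<exists>\<gamma>. nrm \<gamma> \<le> r n + int c \<and> M n (shift \<gamma> y)"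
begin

text \<open>The cutoff makes the visible configuration finite, so that choices based on it stay
  countably valued. Since pieces have radius at most \<open>3 * r j\<close>, every smaller piece
  with a point within \<open>7 * r n\<close> of the origin remains visible.\<close>

definition trim :: "nat \<Rightarrow> (nat \<Rightarrow> (int^'d \<Rightarrow> 'b) \<Rightarrow> (int^'d) set) \<Rightarrow> (int^'d \<Rightarrow> 'b) \<Rightarrow> nat \<Rightarrow> int^'d \<Rightarrow> (int^'d) set" where
  "trim n pc y j u = (if j < n \<and> nrm u \<le> 10 * r n then (+) u ` pc j (shift u y) else {})"

definition disp :: "nat \<Rightarrow> (nat \<Rightarrow> int^'d \<Rightarrow> (int^'d) set) \<Rightarrow> int^'d" where
  "disp n E = (SOME v. nrm v \<le> 16 * \<rho> n \<and> clear_at r n E v)"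

definition anchor_wrt :: "nat \<Rightarrow> (nat \<Rightarrow> (int^'d \<Rightarrow> 'b) \<Rightarrow> (int^'d) set) \<Rightarrow> (int^'d \<Rightarrow> 'b) \<Rightarrow> bool" where
  "anchor_wrt n pc y \<longleftrightarrow> (\<exists>z\<in>cb 0 (16 * \<rho> n). M n (shift z y) \<and> z + disp n (trim n pc (shift z y)) = 0)"

text \<open>\<open>piece n y\<close> is the piece of level \<open>n\<close> anchored at the origin, empty if the origin is not an anchor.
  Pieces at other places are obtained by shifting \<open>y\<close>. Anchors are markers displaced to clear points.\<close>

fun piece :: "nat \<Rightarrow> (int^'d \<Rightarrow> 'b) \<Rightarrow> (int^'d) set" where
  "piece n y = (if anchor_wrt n (\<lambda>j y'. if j < n then piece j y' else {}) y
     then SOME S. good_piece n (trim n (\<lambda>j y'. if j < n then piece j y' else {}) y) S else {})"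

declare piece.simps [simp del]

definition near :: "nat \<Rightarrow> (int^'d \<Rightarrow> 'b) \<Rightarrow> nat \<Rightarrow> int^'d \<Rightarrow> (int^'d) set" where
  "near n = trim n piece"

definition anchor :: "nat \<Rightarrow> (int^'d \<Rightarrow> 'b) \<Rightarrow> bool" where
  "anchor n y \<longleftrightarrow> (\<exists>z\<in>cb 0 (16 * \<rho> n). M n (shift z y) \<and> z + disp n (near n (shift z y)) = 0)"

lemma piece_eq: "piece n y = (if anchor n y then SOME S. good_piece n (near n y) S else {})"
proof -
  have *: "trim n (\<lambda>j y'. if j < n then piece j y' else {}) = near n"
    by (auto simp: near_def trim_def fun_eq_iff)
  show ?thesis
    unfolding piece.simps[of n] anchor_wrt_def anchor_def * by (rule refl)
qed

definition abs_piece :: "(int^'d \<Rightarrow> 'b) \<Rightarrow> nat \<Rightarrow> int^'d \<Rightarrow> (int^'d) set" where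
  "abs_piece y n v = (+) v ` piece n (shift v y)"

lemma near_eq: "near n y j u = (if j < n \<and> nrm u \<le> 10 * r n then abs_piece y j u else {})"
  by (simp add: near_def trim_def abs_piece_def)

lemma mem_abs_piece: "p \<in> abs_piece y n v \<longleftrightarrow> p - v \<in> piece n (shift v y)"
  unfolding abs_piece_def by (force simp: image_iff)

lemma abs_piece_shift: "abs_piece (shift z y) n v = (+) (- z) ` abs_piece y n (z + v)"
  by (auto simp: abs_piece_def shift_shift image_image)

lemma mem_abs_piece_shift: "p \<in> abs_piece (shift z y) n v \<longleftrightarrow> z + p \<in> abs_piece y n (z + v)"
  by (simp add: mem_abs_piece shift_shift)

lemma clear_abs_piece_shift: "clear_at r n (abs_piece (shift z y)) v \<longleftrightarrow> clear_at r n (abs_piece y) (z + v)"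
proof -
  have "(abs_piece (shift z y) j u \<inter> cb v h = {}) \<longleftrightarrow> (abs_piece y j (z + u) \<inter> cb (z + v) h = {})" for j u h
  proof
    assume L: "abs_piece (shift z y) j u \<inter> cb v h = {}"
    show "abs_piece y j (z + u) \<inter> cb (z + v) h = {}"
    proof (rule ccontr)
      assume "\<not> ?thesis"
      then obtain p where "p \<in> abs_piece y j (z + u)" "nrm (p - (z + v)) \<le> h" by auto
      then have "p - z \<in> abs_piece (shift z y) j u \<inter> cb v h" by (simp add: mem_abs_piece_shift diff_diff_eq)
      then show False using L by blast
    qed
  next
    assume R: "abs_piece y j (z + u) \<inter> cb (z + v) h = {}"
    show "abs_piece (shift z y) j u \<inter> cb v h = {}"
    proof (rule ccontr)
      assume "\<not> ?thesis"
      then obtain p where "p \<in> abs_piece (shift z y) j u" "nrm (p - v) \<le> h" by auto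
      then have "z + p \<in> abs_piece y j (z + u) \<inter> cb (z + v) h" by (simp add: mem_abs_piece_shift)
      then show False using R by blast
    qed
  qed
  note * = this
  show ?thesis unfolding clear_at_def *
    by (metis add.commute diff_add_cancel)
qed

text \<open>The induction hypothesis of the construction: the choices of the displacement and of the
  piece at a level are meaningful once the lower levels are spread out, and that follows from this
  property at the lower levels.\<close>

definition level_ok :: "nat \<Rightarrow> bool" where
  "level_ok n \<longleftrightarrow> (\<forall>y\<in>Z. anchor n y \<longrightarrow> good_piece n (near n y) (piece n y) \<and> clear_at r n (abs_piece y) 0 \<and>
     (\<forall>\<gamma>. \<gamma> \<noteq> 0 \<longrightarrow> anchor n (shift \<gamma> y) \<longrightarrow> 98 * r n \<le> nrm \<gamma>))"

lemma piece_nonempty_anchor: "piece n y \<noteq> {} \<Longrightarrow> anchor n y"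
  by (simp add: piece_eq split: if_splits)

lemma spread_abs_piece:
  assumes ok: "\<And>j. j < n \<Longrightarrow> level_ok j" and y: "y \<in> Z"
  shows "spread r n (abs_piece y)"
  unfolding spread_def
proof (intro allI impI conjI)
  fix j u assume j: "j < n"
  show "abs_piece y j u \<subseteq> cb u (3 * r j)"
  proof
    fix p assume p: "p \<in> abs_piece y j u"
    then have "anchor j (shift u y)" using piece_nonempty_anchor unfolding mem_abs_piece by blast
    then have "piece j (shift u y) \<subseteq> cb 0 (2 * r j + 8 * \<rho> j)"
      using ok[OF j] shift_Z[OF y] by (auto simp: level_ok_def good_piece_def)
    then have "nrm (p - u) \<le> 2 * r j + 8 * \<rho> j" using p by (auto simp: mem_abs_piece)
    then show "p \<in> cb u (3 * r j)" using rho_r[of j] rho_pos[of j] by simp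
  qed
  fix u' assume u: "abs_piece y j u \<noteq> {}" "abs_piece y j u' \<noteq> {}" "u \<noteq> u'"
  then have "anchor j (shift u y)" "anchor j (shift u' y)"
    using piece_nonempty_anchor by (auto simp: abs_piece_def)
  then have "anchor j (shift (u' - u) (shift u y))" by (simp add: shift_shift)
  then have "98 * r j \<le> nrm (u' - u)"
    using ok[OF j] shift_Z[OF y] u(3) \<open>anchor j (shift u y)\<close> unfolding level_ok_def by (metis right_minus_eq)
  then show "98 * r j \<le> nrm (u - u')" by (simp add: nrm_commute)
qed

lemma near_subset: "near n y j u \<subseteq> abs_piece y j u"
  by (auto simp: near_eq)

lemma spread_near:
  assumes "spread r n (abs_piece y)" shows "spread r n (near n y)"
  using assms unfolding spread_def by (auto simp: near_eq)

lemma abs_piece_near: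
  assumes sp: "spread r n (abs_piece y)" and j: "j < n" and p: "p \<in> abs_piece y j u" "nrm p \<le> 7 * r n"
  shows "near n y j u = abs_piece y j u"
proof -
  have "abs_piece y j u \<subseteq> cb u (3 * r j)" using sp j by (auto simp: spread_def)
  then have "nrm (p - u) \<le> 3 * r j" using p(1) unfolding cb_def by blast
  moreover have "r j \<le> r n" unfolding r_def by (rule rho_mono) (use j in simp)
  ultimately have "nrm u \<le> 10 * r n" using nrm_triangle_diff[of u 0 p] nrm_commute[of u p] p(2) by simp
  then show ?thesis using j by (simp add: near_eq)
qed

lemma clear_near:
  assumes sp: "spread r n (abs_piece y)" and v: "nrm v \<le> r n"
  shows "clear_at r n (near n y) v \<longleftrightarrow> clear_at r n (abs_piece y) v"
proof
  assume L: "clear_at r n (near n y) v"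
  show "clear_at r n (abs_piece y) v" unfolding clear_at_def
  proof (intro allI impI, rule ccontr)
    fix j u assume j: "j < n" and "abs_piece y j u \<inter> cb v (4 * r j) \<noteq> {}"
    then obtain p where p: "p \<in> abs_piece y j u" "nrm (p - v) \<le> 4 * r j" by auto
    have "r j \<le> r n" unfolding r_def by (rule rho_mono) (use j in simp)
    then have "nrm p \<le> 7 * r n" using nrm_triangle_diff[of p 0 v] p(2) v r_pos[of n] by simp
    then have "near n y j u = abs_piece y j u" using abs_piece_near[OF sp j p(1)] by simp
    then show False using L j p unfolding clear_at_def by fastforce
  qed
next
  assume "clear_at r n (abs_piece y) v"
  then show "clear_at r n (near n y) v" unfolding clear_at_def using near_subset by blast
qed

lemma disp:
  assumes sp: "spread r n (abs_piece y)"
  shows "nrm (disp n (near n y)) \<le> 16 * \<rho> n" "clear_at r n (abs_piece y) (disp n (near n y))"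
proof -
  have "\<exists>v. nrm v \<le> 16 * \<rho> n \<and> clear_at r n (near n y) v"
    using clear_exists[OF spread_near[OF sp], of 0] unfolding diff_0_right .
  then have *: "nrm (disp n (near n y)) \<le> 16 * \<rho> n \<and> clear_at r n (near n y) (disp n (near n y))"
    unfolding disp_def by (rule someI_ex)
  then show "nrm (disp n (near n y)) \<le> 16 * \<rho> n" by simp
  then show "clear_at r n (abs_piece y) (disp n (near n y))"
    using clear_near[OF sp, of "disp n (near n y)"] * rho_r[of n] by linarith
qed

lemma level_ok: "level_ok n"
proof (induction n rule: less_induct)
  case (less n)
  have sp: "spread r n (abs_piece y)" if "y \<in> Z" for y using spread_abs_piece less that by blast
  have rr: "16 * \<rho> n \<le> r n" by (rule rho_r)
  show ?case unfolding level_ok_def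
  proof (intro ballI impI conjI allI)
    fix y assume y: "y \<in> Z" and a: "anchor n y"
    have conn: "lattice_connected (near n y j u)" if "j < n" for j u
    proof (cases "near n y j u = {}")
      case True then show ?thesis by (simp add: lattice_connected_def)
    next
      case False
      then have e: "near n y j u = abs_piece y j u" by (simp add: near_eq split: if_splits)
      then have "anchor j (shift u y)" using False piece_nonempty_anchor by (auto simp: abs_piece_def)
      then have "lattice_connected (piece j (shift u y))"
        using less[OF that] shift_Z[OF y] by (auto simp: level_ok_def good_piece_def)
      from lattice_connected_translate[OF this, of u] show ?thesis
        unfolding e abs_piece_def translate_set_def by (simp add: add.commute)
    qed
    have "\<exists>S. good_piece n (near n y) S"
      by (rule good_piece_exists[OF dim spread_near[OF sp[OF y]] conn])
    then show "good_piece n (near n y) (piece n y)"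
      using a by (simp add: piece_eq someI_ex)
    obtain z where z: "nrm z \<le> 16 * \<rho> n" "M n (shift z y)" "z + disp n (near n (shift z y)) = 0"
      using a by (auto simp: anchor_def)
    then show "clear_at r n (abs_piece y) 0"
      using disp(2)[OF sp[OF shift_Z[OF y, of z]]] by (simp add: clear_abs_piece_shift)
    fix \<gamma> :: "int^'d" assume g: "\<gamma> \<noteq> 0" and "anchor n (shift \<gamma> y)"
    then obtain z' where z': "nrm z' \<le> 16 * \<rho> n" "M n (shift (\<gamma> + z') y)" "z' + disp n (near n (shift (\<gamma> + z') y)) = 0"
      by (auto simp: anchor_def shift_shift)
    \<comment> \<open>A marker has a single displacement, so distinct anchors come from distinct
      markers. The two displacements together cost at most
      \<open>32 * \<rho> n \<le> 2 * r n\<close>, whence 98 instead of 100.\<close>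
    have "\<gamma> + z' \<noteq> z"
    proof
      assume "\<gamma> + z' = z"
      then have "z' + disp n (near n (shift z y)) = 0" using z'(3) by simp
      then show False using z(3) \<open>\<gamma> + z' = z\<close> g by (metis add_right_cancel add_cancel_left_left)
    qed
    then have "100 * r n < nrm (\<gamma> + z' - z)"
      using M_sep[OF shift_Z[OF y, of z] z(2), of "\<gamma> + z' - z"] z'(2) by (simp add: shift_shift)
    moreover have "nrm (\<gamma> + z' - z) \<le> nrm \<gamma> + nrm z' + nrm z"
      using nrm_triangle[of "\<gamma> + z'" "- z"] nrm_triangle[of \<gamma> z'] by simp
    ultimately show "98 * r n \<le> nrm \<gamma>" using z(1) z'(1) rr by linarith
  qed
qed

section \<open>Geometry of the pieces within one orbit\<close>

context
  fixes y assumes y: "y \<in> Z"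
begin

lemma spread_all: "spread r n (abs_piece y)"
  using spread_abs_piece level_ok y by blast

lemma abs_piece_ne_anchor: "abs_piece y n v \<noteq> {} \<longleftrightarrow> anchor n (shift v y)"
proof
  assume "anchor n (shift v y)"
  then have "cb 0 (2 * r n) \<subseteq> piece n (shift v y)"
    using level_ok[of n] shift_Z[OF y] by (auto simp: level_ok_def good_piece_def)
  moreover have "0 \<in> cb 0 (2 * r n)" using r_pos[of n] by simp
  ultimately show "abs_piece y n v \<noteq> {}" unfolding abs_piece_def by blast
qed (use piece_nonempty_anchor in \<open>auto simp: abs_piece_def\<close>)

lemma abs_piece_good:
  assumes "abs_piece y n v \<noteq> {}" shows "good_piece n (near n (shift v y)) (piece n (shift v y))"
  using assms level_ok[of n] shift_Z[OF y] by (simp add: abs_piece_ne_anchor level_ok_def)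

lemma abs_piece_bounds:
  assumes "abs_piece y n v \<noteq> {}"
  shows "cb v (2 * r n) \<subseteq> abs_piece y n v" "abs_piece y n v \<subseteq> cb v (2 * r n + 8 * \<rho> n)"
    "abs_piece y n v \<subseteq> cb v (3 * r n)"
proof -
  note g = abs_piece_good[OF assms, unfolded good_piece_def]
  show "cb v (2 * r n) \<subseteq> abs_piece y n v"
  proof
    fix p assume "p \<in> cb v (2 * r n)"
    then have "p - v \<in> cb 0 (2 * r n)" by simp
    then show "p \<in> abs_piece y n v" unfolding mem_abs_piece using g by blast
  qed
  show *: "abs_piece y n v \<subseteq> cb v (2 * r n + 8 * \<rho> n)"
  proof
    fix p assume "p \<in> abs_piece y n v"
    then have "p - v \<in> cb 0 (2 * r n + 8 * \<rho> n)" unfolding mem_abs_piece using g by blast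
    then show "p \<in> cb v (2 * r n + 8 * \<rho> n)" by simp
  qed
  have "2 * r n + 8 * \<rho> n \<le> 3 * r n" using rho_r[of n] rho_pos[of n] by linarith
  then have "cb v (2 * r n + 8 * \<rho> n) \<subseteq> cb v (3 * r n)" by auto
  with * show "abs_piece y n v \<subseteq> cb v (3 * r n)" by blast
qed

lemma abs_piece_sep:
  assumes "abs_piece y n v \<noteq> {}" "abs_piece y n v' \<noteq> {}" "v \<noteq> v'"
  shows "98 * r n \<le> nrm (v - v')"
  using assms spread_all[of "Suc n"] by (simp add: spread_def)

lemma abs_piece_clear:
  assumes "abs_piece y n v \<noteq> {}" "j < n"
  shows "abs_piece y j u \<inter> cb v (4 * r j) = {}"
proof -
  have "clear_at r n (abs_piece (shift v y)) 0"
    using assms level_ok[of n] shift_Z[OF y] by (simp add: abs_piece_ne_anchor level_ok_def)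
  then have "clear_at r n (abs_piece y) v" unfolding clear_abs_piece_shift add_0_right .
  then show ?thesis using assms(2) by (simp add: clear_at_def)
qed

lemma abs_piece_saturated:
  assumes "p \<in> abs_piece y n v" "same_cell K (p - v) (p' - v)"
  shows "p' \<in> abs_piece y n v"
proof -
  have "abs_piece y n v \<noteq> {}" using assms(1) by auto
  then show ?thesis
    using abs_piece_good[of n v] assms unfolding good_piece_def saturated_def mem_abs_piece by blast
qed

text \<open>Closedness was arranged for the smaller pieces visible from the anchor. One that comes
  within \<open>8 * K\<close> of the piece has a point within \<open>7 * r n\<close> of the anchor
  and is visible.\<close>

lemma abs_piece_closed:
  assumes ne: "abs_piece y n v \<noteq> {}" and j: "j < n"
    and meet: "thick (8 * K) (abs_piece y j u) \<inter> abs_piece y n v \<noteq> {}"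
  shows "thick (8 * K) (abs_piece y j u) \<subseteq> abs_piece y n v"
proof -
  have tr: "p \<in> thick h (abs_piece y j u) \<longleftrightarrow> p - v \<in> thick h (abs_piece (shift v y) j (u - v))" for p h
  proof -
    have "(\<exists>x\<in>abs_piece y j u. nrm (p - x) \<le> h) \<longleftrightarrow> (\<exists>x. v + x \<in> abs_piece y j u \<and> nrm (p - v - x) \<le> h)"
    proof
      assume "\<exists>x\<in>abs_piece y j u. nrm (p - x) \<le> h"
      then obtain x where "x \<in> abs_piece y j u" "nrm (p - x) \<le> h" by blast
      then show "\<exists>x. v + x \<in> abs_piece y j u \<and> nrm (p - v - x) \<le> h" by (intro exI[of _ "x - v"]) simp
    next
      assume "\<exists>x. v + x \<in> abs_piece y j u \<and> nrm (p - v - x) \<le> h"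
      then obtain x where "v + x \<in> abs_piece y j u" "nrm (p - v - x) \<le> h" by blast
      then show "\<exists>x\<in>abs_piece y j u. nrm (p - x) \<le> h" by (intro bexI[of _ "v + x"]) (simp_all add: diff_diff_eq)
    qed
    then show ?thesis by (simp add: mem_thick mem_abs_piece_shift Bex_def)
  qed
  obtain p where p: "p \<in> thick (8 * K) (abs_piece y j u)" "p \<in> abs_piece y n v" using meet by blast
  obtain x where x: "x \<in> abs_piece y j u" "nrm (p - x) \<le> 8 * K" using p(1) by (auto simp: mem_thick)
  have "nrm (p - v) \<le> 3 * r n" using abs_piece_bounds(3)[OF ne] p(2) by auto
  moreover have "8 * K \<le> r n" using rho_ge[of "Suc n"] by (simp add: r_def)
  ultimately have xv: "nrm (x - v) \<le> 7 * r n" using nrm_triangle_diff[of x v p] nrm_commute[of x p] x(2) r_pos[of n] by linarith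
  have spv: "spread r n (abs_piece (shift v y))" using spread_abs_piece level_ok shift_Z[OF y] by blast
  have nr: "near n (shift v y) j (u - v) = abs_piece (shift v y) j (u - v)"
    by (rule abs_piece_near[OF spv j, of "x - v"]) (use x xv in \<open>simp_all add: mem_abs_piece_shift\<close>)
  have "piece_closed (8 * K) n (near n (shift v y)) (piece n (shift v y))"
    using abs_piece_good[OF ne] by (simp add: good_piece_def)
  moreover have "p - v \<in> thick (8 * K) (near n (shift v y) j (u - v)) \<inter> piece n (shift v y)"
    using p tr[of p "8 * K"] nr by (simp add: mem_abs_piece)
  ultimately have "thick (8 * K) (near n (shift v y) j (u - v)) \<subseteq> piece n (shift v y)"
    using j unfolding piece_closed_def by blast
  then show ?thesis using tr nr by (auto simp: mem_abs_piece)
qed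

lemma abs_piece_unique:
  assumes "p \<in> abs_piece y n v" "p \<in> abs_piece y n v'" shows "v = v'"
proof (rule ccontr)
  assume "v \<noteq> v'"
  have ne: "abs_piece y n v \<noteq> {}" "abs_piece y n v' \<noteq> {}" using assms by auto
  have "nrm (p - v) \<le> 3 * r n" "nrm (p - v') \<le> 3 * r n"
    using abs_piece_bounds(3)[OF ne(1)] abs_piece_bounds(3)[OF ne(2)] assms by auto
  then have "nrm (v - v') \<le> 6 * r n" using nrm_triangle_diff[of v v' p] nrm_commute[of v p] by linarith
  then show False using abs_piece_sep[OF ne \<open>v \<noteq> v'\<close>] r_pos[of n] by linarith
qed

lemma abs_piece_cover: "\<exists>n\<ge>n0. \<exists>v. cb p R \<subseteq> abs_piece y n v"
proof -
  obtain c :: nat where c: "\<And>n0. \<exists>n\<ge>n0. \<exists>\<gamma>. nrm \<gamma> \<le> r n + int c \<and> M n (shift \<gamma> y)"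
    using M_cov[OF y] by blast
  \<comment> \<open>At levels from \<open>n1\<close> on, \<open>\<rho> n\<close> exceeds
    \<open>nrm p + c + \<bar>R\<bar>\<close>. The cube around \<open>p\<close> is then within
    \<open>r n + 17 * \<rho> n \<le> 2 * r n\<close> of the displaced marker.\<close>
  define n1 where "n1 = max n0 (nat (nrm p + int c + \<bar>R\<bar>))"
  obtain n \<gamma> where n: "n \<ge> n1" "nrm \<gamma> \<le> r n + int c" "M n (shift \<gamma> y)" using c by blast
  define w where "w = disp n (near n (shift \<gamma> y))"
  have w: "nrm w \<le> 16 * \<rho> n" unfolding w_def
    by (rule disp) (use spread_abs_piece level_ok shift_Z[OF y] in blast)
  have "anchor n (shift (\<gamma> + w) y)" unfolding anchor_def
    by (rule bexI[of _ "- w"]) (use n w in \<open>simp_all add: shift_shift w_def[symmetric]\<close>)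
  then have ne: "abs_piece y n (\<gamma> + w) \<noteq> {}" by (simp add: abs_piece_ne_anchor)
  have "cb p R \<subseteq> cb (\<gamma> + w) (2 * r n)"
  proof
    fix x assume x: "x \<in> cb p R"
    have "nrm (x - (\<gamma> + w)) \<le> nrm (x - p) + nrm p + nrm \<gamma> + nrm w"
      using nrm_triangle_diff[of x "\<gamma> + w" p] nrm_triangle_diff[of p "\<gamma> + w" 0] nrm_triangle[of \<gamma> w]
      unfolding nrm_commute[of 0 "\<gamma> + w"] diff_0_right by linarith
    moreover have "nrm p + int c + \<bar>R\<bar> \<le> int n" using n(1) unfolding n1_def by linarith
    moreover have "int n \<le> \<rho> n" by (rule rho_ge_nat)
    ultimately show "x \<in> cb (\<gamma> + w) (2 * r n)" using x n(2) w rho_r64[of n] rho_pos[of n] by simp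
  qed
  then have "cb p R \<subseteq> abs_piece y n (\<gamma> + w)" using abs_piece_bounds(1)[OF ne] by blast
  then show ?thesis using n(1) by (intro exI[of _ n]) (auto simp: n1_def)
qed

end

section \<open>Borel dependence of the pieces on the point\<close>

lemma borel_countable_near:
  assumes "\<And>j. j < n \<Longrightarrow> borel_countable (piece j)" shows "borel_countable (near n)"
proof (rule borel_countable_det_window[of "{..<n} \<times> cb 0 (10 * r n)" "\<lambda>i y. piece (fst i) (shift (snd i) y)"])
  show "borel_countable (\<lambda>y. piece (fst i) (shift (snd i) y))" if "i \<in> {..<n} \<times> cb 0 (10 * r n)" for i
    by (rule borel_countable_shift[OF assms]) (use that in auto)
  fix y y' assume eq: "\<And>i. i \<in> {..<n} \<times> cb 0 (10 * r n) \<Longrightarrow> piece (fst i) (shift (snd i) y) = piece (fst i) (shift (snd i) y')"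
  have "near n y j u = near n y' j u" for j u
    using eq[of "(j, u)"] by (simp add: near_eq abs_piece_def)
  then show "near n y = near n y'" by blast
qed simp

lemma borel_countable_piece: "borel_countable (piece n)"
proof (induction n rule: less_induct)
  case (less n)
  have cn: "borel_countable (near n)" by (rule borel_countable_near[OF less])
  have "borel_pred (\<lambda>y. M n (shift z y) \<and> z + disp n (near n (shift z y)) = 0)" for z
    by (intro borel_pred_conj borel_pred_shift[of "M n"] borel_pred_M borel_pred_cm[OF borel_countable_shift[OF cn, of z], of "\<lambda>E. z + disp n E = 0"])
  then have "borel_pred (anchor n)" unfolding anchor_def[abs_def]
    by (intro borel_pred_bex_countable countable_finite finite_cb)
  then have "borel_countable (\<lambda>y. (anchor n y, near n y))" by (intro borel_countable_pair borel_countable_pred cn)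
  then show ?case by (rule borel_countable_det) (simp add: piece_eq)
qed

lemma borel_countable_near': "borel_countable (near n)" by (rule borel_countable_near[OF borel_countable_piece])

end

subsection \<open>Counting patterns\<close>

lemma card_image_determined:
  assumes "finite (g ` A)" "\<And>x y. x \<in> A \<Longrightarrow> y \<in> A \<Longrightarrow> g x = g y \<Longrightarrow> f x = f y"
  shows "card (f ` A) \<le> card (g ` A)"
proof -
  let ?h = "\<lambda>z. f (SOME x. x \<in> A \<and> g x = z)"
  have "f x = ?h (g x)" if "x \<in> A" for x
  proof -
    have "(SOME x'. x' \<in> A \<and> g x' = g x) \<in> A \<and> g (SOME x'. x' \<in> A \<and> g x' = g x) = g x"
      by (rule someI[of _ x]) (use that in simp)
    then show ?thesis using assms(2)[of x "SOME x'. x' \<in> A \<and> g x' = g x"] that by simp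
  qed
  then have "f ` A \<subseteq> ?h ` (g ` A)" by auto
  then have "card (f ` A) \<le> card (?h ` (g ` A))" by (rule card_mono[rotated]) (use assms(1) in simp)
  also have "\<dots> \<le> card (g ` A)" by (rule card_image_le[OF assms(1)])
  finally show ?thesis .
qed

lemma finite_lang: "finite B \<Longrightarrow> finite (lang (Y :: (int^'d \<Rightarrow> 'b::finite) set) B)"
  by (rule finite_subset[of _ "PiE B (\<lambda>_. UNIV)"]) (auto simp: lang_def intro: finite_PiE)

text \<open>The representative of \<open>p\<close> modulo \<open>s\<close> in the fundamental domain
  \<open>box_d 1 s\<close>.\<close>

definition rep :: "nat \<Rightarrow> int^'d \<Rightarrow> int^'d" where
  "rep s p = (\<chi> i. (p$i - 1) mod int s + 1)"

lemma rep_in_box: "0 < s \<Longrightarrow> rep s p \<in> box_d 1 (int s)"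
  by (auto simp: rep_def box_d_def intro: order_less_imp_le) (smt (verit) pos_mod_bound of_nat_0_less_iff)

lemma rep_id: "p \<in> box_d 1 (int s) \<Longrightarrow> rep s p = p"
proof -
  assume "p \<in> box_d 1 (int s)"
  then have "(p$i - 1) mod int s = p$i - 1" for i
    by (intro mod_pos_pos_trivial) (auto simp: box_d_def dest: spec[of _ i])
  then show ?thesis by (simp add: rep_def vec_eq_iff)
qed

lemma rep_rep_diff: "rep s (rep s p - t) = rep s (p - t)"
proof -
  have "((p$i - 1) mod int s + 1 - t$i - 1) mod int s = (p$i - t$i - 1) mod int s" for i
  proof -
    have "((p$i - 1) mod int s - t$i) mod int s = ((p$i - 1) - t$i) mod int s" by (simp add: mod_diff_left_eq)
    then show ?thesis by (simp add: algebra_simps)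
  qed
  then show ?thesis by (simp add: rep_def vec_eq_iff)
qed

lemma rep_diff_eq:
  obtains i where "p - rep s p = (\<chi> l. int s * i$l)"
proof
  show "p - rep s p = (\<chi> l. int s * (\<chi> l. (p$l - 1) div int s)$l)"
  proof -
    have "p$l - ((p$l - 1) mod int s + 1) = int s * ((p$l - 1) div int s)" for l
      using mult_div_mod_eq[of "int s" "p$l - 1"] by linarith
    then show ?thesis by (simp add: rep_def vec_eq_iff)
  qed
qed

text \<open>The array with period \<open>s\<close> built from the word \<open>w\<close> on the box of side \<open>a\<close>, translated by \<open>t\<close>,
  agrees with \<open>q\<close> wherever both are defined.\<close>

definition compat :: "nat \<Rightarrow> nat \<Rightarrow> (int^'d \<Rightarrow> 'a) \<Rightarrow> (int^'d \<Rightarrow> 'a) \<Rightarrow> int^'d \<Rightarrow> bool" where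
  "compat a s w q t \<longleftrightarrow> (\<forall>p\<in>box_d 1 (int a). rep s (p - t) \<in> box_d 1 (int a) \<longrightarrow> q p = w (rep s (p - t)))"

text \<open>The points of the box that fall into the gaps between the words of the translated
  array.\<close>

definition uncovered :: "nat \<Rightarrow> nat \<Rightarrow> int^'d \<Rightarrow> (int^'d) set" where
  "uncovered a s t = {p\<in>box_d 1 (int a). rep s (p - t) \<notin> box_d 1 (int a)}"

text \<open>Translation is injective on the torus of side \<open>s\<close>, and it carries these
  points into \<open>box_d 1 s - box_d 1 a\<close>.\<close>

lemma card_uncovered:
  assumes "a \<le> s" "0 < s"
  shows "card (uncovered a s t :: (int^'d) set) \<le> s ^ CARD('d) - a ^ CARD('d)"
proof -
  let ?f = "\<lambda>p::int^'d. rep s (p - t)"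
  have sub: "(box_d 1 (int a) :: (int^'d) set) \<subseteq> box_d 1 (int s)" using assms(1) by (auto simp: box_d_def intro: order_trans)
  have "inj_on ?f (uncovered a s t)"
  proof (rule inj_onI)
    fix p q assume p: "p \<in> uncovered a s t" and q: "q \<in> uncovered a s t" and eq: "?f p = ?f q"
    have "rep s (rep s (p - t) - (- t)) = rep s p" "rep s (rep s (q - t) - (- t)) = rep s q"
      unfolding rep_rep_diff by simp_all
    then have "rep s p = rep s q" using eq by simp
    moreover have "rep s p = p" "rep s q = q" using p q sub by (auto simp: uncovered_def intro!: rep_id)
    ultimately show "p = q" by simp
  qed
  moreover have "?f ` uncovered a s t \<subseteq> box_d 1 (int s) - box_d 1 (int a)"
    using rep_in_box[OF assms(2)] by (auto simp: uncovered_def)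
  ultimately have "card (uncovered a s t) \<le> card (box_d 1 (int s) - box_d 1 (int a) :: (int^'d) set)"
    by (rule card_inj_on_le) simp
  also have "\<dots> = s ^ CARD('d) - a ^ CARD('d)"
    using sub by (subst card_Diff_subset) (simp_all add: card_box_d)
  finally show ?thesis .
qed

lemma finite_uncovered [simp]: "finite (uncovered a s t)" by (simp add: uncovered_def)

lemma card_determined_PiE:
  fixes Q :: "(int^'d \<Rightarrow> 'a::finite) set"
  assumes U: "finite U" and det: "\<And>q q'. q \<in> Q \<Longrightarrow> q' \<in> Q \<Longrightarrow> (\<And>p. p \<in> U \<Longrightarrow> q p = q' p) \<Longrightarrow> q = q'"
  shows "finite Q" "card Q \<le> CARD('a) ^ card U"
proof -
  have inj: "inj_on (\<lambda>q. restrict q U) Q"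
  proof (rule inj_onI)
    fix q q' assume "q \<in> Q" "q' \<in> Q" and eq: "restrict q U = restrict q' U"
    moreover have "q p = q' p" if "p \<in> U" for p using fun_cong[OF eq, of p] that by simp
    ultimately show "q = q'" using det by blast
  qed
  have sub: "(\<lambda>q. restrict q U) ` Q \<subseteq> PiE U (\<lambda>_. UNIV)" by auto
  have fin: "finite (PiE U (\<lambda>_. UNIV :: 'a set))" by (intro finite_PiE U) simp
  show "finite Q" using finite_imageD[OF finite_subset[OF sub fin] inj] .
  have "card Q \<le> card (PiE U (\<lambda>_. UNIV :: 'a set))" by (rule card_inj_on_le[OF inj sub fin])
  then show "card Q \<le> CARD('a) ^ card U" by (simp add: card_PiE[OF U])
qed

abbreviation words :: "nat \<Rightarrow> (int^'d \<Rightarrow> 'a) set" where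
  "words a \<equiv> PiE (box_d 1 (int a)) (\<lambda>_. UNIV)"

text \<open>The array prescribes every symbol of \<open>q\<close> except those at uncovered
  points.\<close>

lemma card_compat:
  fixes w :: "int^'d \<Rightarrow> 'a::finite"
  assumes "a \<le> s" "0 < s"
  shows "card {q\<in>words a. compat a s w q t} \<le> CARD('a) ^ (s ^ CARD('d) - a ^ CARD('d))"
proof -
  have "card {q\<in>words a. compat a s w q t} \<le> CARD('a) ^ card (uncovered a s t)"
  proof (rule card_determined_PiE(2))
    fix q q' :: "int^'d \<Rightarrow> 'a"
    assume q: "q \<in> {q\<in>words a. compat a s w q t}" "q' \<in> {q\<in>words a. compat a s w q t}"
      and eq: "\<And>p. p \<in> uncovered a s t \<Longrightarrow> q p = q' p"
    show "q = q'"
    proof (rule PiE_ext[of _ "box_d 1 (int a)" "\<lambda>_. UNIV"])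
      fix p :: "int^'d" assume p: "p \<in> box_d 1 (int a)"
      show "q p = q' p"
        using eq[of p] q p by (cases "p \<in> uncovered a s t") (auto simp: uncovered_def compat_def)
    qed (use q in auto)
  qed simp
  also have "\<dots> \<le> CARD('a) ^ (s ^ CARD('d) - a ^ CARD('d))"
    by (rule power_increasing[OF card_uncovered[OF assms]]) (simp add: Suc_leI)
  finally show ?thesis .
qed

text \<open>By Bezout the multiples of \<open>t\<close> modulo \<open>s\<close> are the multiples of
  \<open>g\<close>, so \<open>x\<close> can be brought to \<open>x mod g\<close>.\<close>

lemma residue_reachable:
  fixes t x :: int
  assumes s: "0 < s" and g: "g = gcd t (int s)"
  shows "\<exists>j::nat. (x - int j * t) mod int s < g"
proof -
  have gp: "0 < g" "g dvd int s" using s g by auto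
  obtain u v where uv: "u * t + v * int s = g" using bezout_int[of t "int s"] g by auto
  define e where "e = x div g"
  define j where "j = nat ((u * e) mod int s)"
  have ij: "int j = (u * e) mod int s" using s by (simp add: j_def)
  have "u * e - int j = int s * ((u * e) div int s)" using mult_div_mod_eq[of "int s" "u * e"] ij by linarith
  then have "x - int j * t = x mod g + int s * (((u * e) div int s) * t + v * e)"
  proof -
    assume a: "u * e - int j = int s * ((u * e) div int s)"
    have "x - int j * t = x - (u * e) * t + (u * e - int j) * t" by (simp add: algebra_simps)
    also have "(u * e) * t = e * (g - v * int s)" using uv by (simp add: algebra_simps flip: uv)
    also have "x - e * (g - v * int s) = x mod g + v * int s * e"
      using minus_div_mult_eq_mod[of x g] by (simp add: e_def algebra_simps)
    finally show ?thesis unfolding a by (simp add: algebra_simps)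
  qed
  then have "(x - int j * t) mod int s = (x mod g) mod int s" by (simp add: mod_mult_self2 del: mult.commute)
  moreover have "(x mod g) mod int s = x mod g"
    using gp s zdvd_imp_le[OF gp(2)] by (intro mod_pos_pos_trivial) (auto intro: less_le_trans[OF pos_mod_bound])
  ultimately show ?thesis using gp(1) by (intro exI[of _ j]) simp
qed

lemma card_slab:
  assumes "0 \<le> g" shows "card {p::int^'d \<in> box_d 1 (int s). p$l \<le> g} \<le> nat g * s ^ (CARD('d) - 1)"
proof -
  let ?F = "PiE UNIV (\<lambda>i. if i = l then {1..g} else {1..int s}) :: ('d \<Rightarrow> int) set"
  have "{p::int^'d \<in> box_d 1 (int s). p$l \<le> g} \<subseteq> (\<lambda>f. \<chi> i. f i) ` ?F"
  proof
    fix p :: "int^'d" assume "p \<in> {p \<in> box_d 1 (int s). p$l \<le> g}"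
    then show "p \<in> (\<lambda>f. \<chi> i. f i) ` ?F"
      by (intro image_eqI[of _ _ "\<lambda>i. p$i"]) (auto simp: box_d_def PiE_iff)
  qed
  moreover have fin: "finite ?F" by (intro finite_PiE) auto
  ultimately have "card {p::int^'d \<in> box_d 1 (int s). p$l \<le> g} \<le> card ?F"
    by (meson card_image_le card_mono finite_imageI order_trans)
  also have "card ?F = (\<Prod>i\<in>UNIV. if i = l then nat g else s)"
    by (subst card_PiE) (auto intro!: prod.cong)
  also have "\<dots> = nat g * s ^ (CARD('d) - 1)"
    by (subst prod.remove[of _ l]) (simp_all add: card_Diff_singleton)
  finally show ?thesis .
qed

text \<open>A word compatible with its own array is invariant, away from the gaps, under the
  translation by \<open>t\<close> modulo \<open>s\<close>. It is determined by its symbols at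
  uncovered points and on a slab of width \<open>g\<close>, the gcd of \<open>t$l\<close> and
  \<open>s\<close>. As \<open>s div g\<close> is a divisor of \<open>s\<close> other than 1, it is
  at least \<open>L\<close>, and the slab fills at most the fraction \<open>1 / L\<close> of the
  torus.\<close>

lemma card_self_compat:
  assumes as: "a \<le> s" "0 < s" and tl: "\<not> int s dvd t$l" and s: "\<And>e. e dvd s \<Longrightarrow> e \<noteq> 1 \<Longrightarrow> L \<le> e"
    and L: "0 < L"
  shows "card {w :: int^'d \<Rightarrow> 'a::finite. w \<in> words a \<and> compat a s w w t}
    \<le> CARD('a) ^ (s ^ CARD('d) div L + (s ^ CARD('d) - a ^ CARD('d)))"
proof -
  define g where "g = gcd (t$l) (int s)"
  have g: "0 < g" "g dvd int s" using as by (auto simp: g_def)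
  let ?R = "{p::int^'d \<in> box_d 1 (int s). p$l \<le> g}"
  let ?U = "uncovered a s t \<union> ?R"
  have sub: "(box_d 1 (int a) :: (int^'d) set) \<subseteq> box_d 1 (int s)" using as(1) by (auto simp: box_d_def intro: order_trans)
  have finR: "finite ?R" by (rule finite_subset[of _ "box_d 1 (int s)"]) auto
  have "card {w :: int^'d \<Rightarrow> 'a. w \<in> words a \<and> compat a s w w t} \<le> CARD('a) ^ card ?U"
  proof (rule card_determined_PiE(2))
    show "finite ?U" using finR by simp
    fix q q' :: "int^'d \<Rightarrow> 'a"
    assume q: "q \<in> {w. w \<in> words a \<and> compat a s w w t}" "q' \<in> {w. w \<in> words a \<and> compat a s w w t}"
      and eq: "\<And>p. p \<in> ?U \<Longrightarrow> q p = q' p"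
    \<comment> \<open>stepping back by \<open>t\<close> on the torus, one either leaves the box or arrives in the slab\<close>
    have walk: "p \<in> box_d 1 (int a) \<Longrightarrow> (p$l - 1 - int j * t$l) mod int s < g \<Longrightarrow> q p = q' p" for p :: "int^'d" and j
    proof (induction j arbitrary: p)
      case 0
      have "p \<in> box_d 1 (int s)" using 0 sub by auto
      then have "(p$l - 1) mod int s = p$l - 1" by (intro mod_pos_pos_trivial) (auto simp: box_d_def dest: spec[of _ l])
      then have "p \<in> ?R" using 0 sub by auto
      then show ?case using eq by blast
    next
      case (Suc j)
      show ?case
      proof (cases "p \<in> uncovered a s t")
        case True then show ?thesis using eq by blast
      next
        case False
        let ?p = "rep s (p - t)"
        have p1: "?p \<in> box_d 1 (int a)" using False Suc.prems by (simp add: uncovered_def)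
        have "(?p$l - 1 - int j * t$l) mod int s = (p$l - t$l - 1 - int j * t$l) mod int s"
          by (simp add: rep_def mod_diff_left_eq)
        also have "p$l - t$l - 1 - int j * t$l = p$l - 1 - int (Suc j) * t$l" by (simp add: algebra_simps)
        finally have "q ?p = q' ?p" using Suc.IH[OF p1] Suc.prems(2) by simp
        moreover have "q p = q ?p" "q' p = q' ?p" using q p1 Suc.prems by (auto simp: compat_def)
        ultimately show ?thesis by simp
      qed
    qed
    show "q = q'"
    proof (rule PiE_ext[of _ "box_d 1 (int a)" "\<lambda>_. UNIV"])
      fix p :: "int^'d" assume p: "p \<in> box_d 1 (int a)"
      obtain j :: nat where "(p$l - 1 - int j * t$l) mod int s < g"
        using residue_reachable[OF as(2) g_def, of "p$l - 1"] by auto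
      then show "q p = q' p" using walk p by blast
    qed (use q in auto)
  qed
  also have "\<dots> \<le> CARD('a) ^ (s ^ CARD('d) div L + (s ^ CARD('d) - a ^ CARD('d)))"
  proof (rule power_increasing)
    obtain e where e: "s = nat g * e"
      using g by (metis dvd_def int_dvd_int_iff int_nat_eq less_imp_le nat_0_le)
    have "e \<noteq> 1"
    proof
      assume "e = 1"
      then have "int s = g" using e g by simp
      then have "int s dvd t$l" by (simp add: g_def) (metis gcd_dvd1)
      then show False using tl by simp
    qed
    then have "L \<le> e" using s[of e] e by simp
    then have gL: "nat g * L \<le> s" unfolding e by simp
    have "card ?R \<le> nat g * s ^ (CARD('d) - 1)" using card_slab[of g] g by simp
    then have "card ?R * L \<le> nat g * L * s ^ (CARD('d) - 1)"
      using mult_right_mono[of "card ?R" "nat g * s ^ (CARD('d) - 1)" L] by (simp add: ac_simps)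
    also have "\<dots> \<le> s * s ^ (CARD('d) - 1)" using gL by (rule mult_right_mono) simp
    also have "\<dots> = s ^ CARD('d)" by (simp flip: power_Suc)
    finally have "card ?R \<le> s ^ CARD('d) div L" using L by (simp add: less_eq_div_iff_mult_less_eq)
    moreover have "card (uncovered a s t) \<le> s ^ CARD('d) - a ^ CARD('d)" by (rule card_uncovered[OF as])
    ultimately show "card ?U \<le> s ^ CARD('d) div L + (s ^ CARD('d) - a ^ CARD('d))"
      using card_Un_le[of "uncovered a s t" ?R] by linarith
  qed (simp add: Suc_leI)
  finally show ?thesis .
qed

lemma compat_mod: "compat a s w q (\<chi> i. t$i mod int s) = compat a s w q t"
proof -
  have "rep s (p - (\<chi> i. t$i mod int s)) = rep s (p - t)" for p :: "int^'a"
  proof -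
    have "(p$i - t$i mod int s - 1) mod int s = (p$i - t$i - 1) mod int s" for i
    proof -
      have "((p$i - 1) - t$i mod int s) mod int s = ((p$i - 1) - t$i) mod int s" by (rule mod_diff_right_eq)
      then show ?thesis by (simp add: algebra_simps)
    qed
    then show ?thesis by (simp add: rep_def vec_eq_iff)
  qed
  then show ?thesis by (simp add: compat_def)
qed

text \<open>Two union bounds over the at most \<open>s ^ CARD('d)\<close> translations modulo
  \<open>s\<close>. By \<open>c1\<close> some word \<open>w\<close> is not compatible with its own
  array out of phase; by \<open>c2\<close>, at least \<open>2 * b\<close> further words remain after
  removing \<open>w\<close> and those compatible with the array of \<open>w\<close> out of
  phase.\<close>

lemma codebook_count:
  fixes W :: "(int^'d \<Rightarrow> 'a::finite) set"
  assumes as: "a \<le> s" "0 < s" and s: "\<And>e. e dvd s \<Longrightarrow> e \<noteq> 1 \<Longrightarrow> L \<le> e" and L: "0 < L"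
    and W: "W \<subseteq> words a"
    and c1: "s ^ CARD('d) * CARD('a) ^ (s ^ CARD('d) div L + (s ^ CARD('d) - a ^ CARD('d))) < card W"
    and c2: "2 * b + 1 + s ^ CARD('d) * CARD('a) ^ (s ^ CARD('d) - a ^ CARD('d)) \<le> card W"
  obtains w Q where "w \<in> W" "Q \<subseteq> W" "w \<notin> Q" "finite Q" "2 * b \<le> card Q"
    "\<And>q t. q \<in> insert w Q \<Longrightarrow> \<exists>l. \<not> int s dvd t$l \<Longrightarrow> \<not> compat a s w q t"
proof -
  let ?T = "{t::int^'d \<in> box_d 0 (int s - 1). \<exists>l. \<not> int s dvd t$l}"
  have finT: "finite ?T" by (rule finite_subset[of _ "box_d 0 (int s - 1)"]) auto
  have "card ?T \<le> card (box_d 0 (int s - 1) :: (int^'d) set)" by (rule card_mono) auto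
  then have cT: "card ?T \<le> s ^ CARD('d)" by (simp add: card_box_d)
  have finwords: "finite (words a :: (int^'d \<Rightarrow> 'a) set)" by (intro finite_PiE) simp_all
  have finW: "finite W" using W finwords by (rule finite_subset)
  let ?c = "CARD('a) ^ (s ^ CARD('d) div L + (s ^ CARD('d) - a ^ CARD('d)))"
  let ?B = "\<lambda>t. {w :: int^'d \<Rightarrow> 'a. w \<in> words a \<and> compat a s w w t}"
  have "card (\<Union>t\<in>?T. ?B t) \<le> (\<Sum>t\<in>?T. card (?B t))" by (rule card_UN_le[OF finT])
  also have "\<dots> \<le> (\<Sum>t\<in>?T. ?c)"
  proof (rule sum_mono)
    fix t assume "t \<in> ?T"
    then obtain l where "\<not> int s dvd t$l" by auto
    then show "card (?B t) \<le> ?c" by (rule card_self_compat[OF as _ s L])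
  qed
  also have "\<dots> \<le> s ^ CARD('d) * ?c" using cT by simp
  finally have less: "card (\<Union>t\<in>?T. ?B t) < card W" using c1 by linarith
  have finB: "finite (\<Union>t\<in>?T. ?B t)" by (rule finite_subset[OF _ finwords]) auto
  have "\<not> W \<subseteq> (\<Union>t\<in>?T. ?B t)"
  proof
    assume "W \<subseteq> (\<Union>t\<in>?T. ?B t)"
    from card_mono[OF finB this] less show False by linarith
  qed
  then have "\<exists>w. w \<in> W \<and> w \<notin> (\<Union>t\<in>?T. ?B t)" unfolding subset_eq Ball_def by simp
  then obtain w where w: "w \<in> W" "w \<notin> (\<Union>t\<in>?T. ?B t)" by (elim exE conjE)
  have wc: "\<not> compat a s w w t" if "t \<in> ?T" for t using w that W by blast
  let ?G = "\<lambda>t. {q\<in>words a. compat a s w q t}"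
  define Q where "Q = W - ({w} \<union> (\<Union>t\<in>?T. ?G t))"
  have "card (\<Union>t\<in>?T. ?G t) \<le> (\<Sum>t\<in>?T. card (?G t))" by (rule card_UN_le[OF finT])
  also have "\<dots> \<le> (\<Sum>t\<in>?T. CARD('a) ^ (s ^ CARD('d) - a ^ CARD('d)))"
    by (rule sum_mono) (rule card_compat[OF as])
  also have "\<dots> \<le> s ^ CARD('d) * CARD('a) ^ (s ^ CARD('d) - a ^ CARD('d))" using cT by simp
  finally have "card ({w} \<union> (\<Union>t\<in>?T. ?G t)) \<le> 1 + s ^ CARD('d) * CARD('a) ^ (s ^ CARD('d) - a ^ CARD('d))"
    using card_Un_le[of "{w}" "\<Union>t\<in>?T. ?G t"] by simp
  moreover have "card W - card ({w} \<union> (\<Union>t\<in>?T. ?G t)) \<le> card Q"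
    unfolding Q_def by (rule diff_card_le_card_Diff) (use finT finwords in auto)
  ultimately have cQ: "2 * b \<le> card Q" using c2 by linarith
  have notc: "\<not> compat a s w q t" if "q \<in> insert w Q" "\<exists>l. \<not> int s dvd t$l" for q t
  proof -
    let ?t = "\<chi> i. t$i mod int s"
    have "?t \<in> ?T" using that(2) as(2) by (auto simp: box_d_def dvd_mod_iff)
    then have "\<not> compat a s w q ?t" using that(1) wc[of ?t] W by (auto simp: Q_def)
    then show ?thesis by (simp add: compat_mod)
  qed
  show ?thesis
    by (rule that[OF w(1) _ _ _ cQ notc]) (use finW in \<open>auto simp: Q_def\<close>)
qed

subsection \<open>Entropy\<close>

text \<open>The box of side \<open>n\<close> is covered by \<open>(n div p + 1) ^ CARD('d)\<close>
  translates of the box of side \<open>p\<close>.\<close>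

lemma card_lang_cover:
  fixes Y :: "(int^'d \<Rightarrow> 'b::finite) set"
  assumes inv: "shift_invariant Y" and p: "0 < p"
  shows "card (lang Y (box_d 1 (int n))) \<le> card (lang Y (box_d 1 (int p))) ^ ((n div p + 1) ^ CARD('d))"
proof -
  let ?I = "box_d 0 (int (n div p)) :: (int^'d) set" and ?L = "lang Y (box_d 1 (int p))"
  let ?G = "\<lambda>x. restrict (\<lambda>i. restrict (shift (\<chi> l. int p * i$l) x) (box_d 1 (int p))) ?I"
  have fL: "finite ?L" by (rule finite_lang) simp
  have sub: "?G ` Y \<subseteq> PiE ?I (\<lambda>_. ?L)" using inv by (auto simp: lang_def shift_invariant_def)
  have fin: "finite (PiE ?I (\<lambda>_. ?L))" by (intro finite_PiE) (simp_all add: fL)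
  have "card (lang Y (box_d 1 (int n))) \<le> card (?G ` Y)"
    unfolding lang_def
  proof (rule card_image_determined)
    show "finite (?G ` Y)" using sub fin by (rule finite_subset)
    fix x y assume "?G x = ?G y"
    have "x v = y v" if v: "v \<in> box_d 1 (int n)" for v
    proof -
      define i where "i = (\<chi> l. (v$l - 1) div int p)"
      have p': "0 < int p" using p by simp
      have i: "i \<in> ?I"
      proof -
        have "0 \<le> (v$l - 1) div int p \<and> (v$l - 1) div int p \<le> int (n div p)" for l
        proof -
          have "1 \<le> v$l" "v$l \<le> int n" using v by (auto simp: box_d_def)
          then show ?thesis using p' zdiv_mono1[of "v$l - 1" "int n" "int p"]
            by (simp add: pos_imp_zdiv_nonneg_iff zdiv_int)
        qed
        then show ?thesis by (simp add: i_def box_d_def)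
      qed
      define u where "u = v - (\<chi> l. int p * i$l)"
      have u: "u \<in> box_d 1 (int p)"
      proof -
        have "1 \<le> u$l \<and> u$l \<le> int p" for l
          using div_eq_iff_bounds[OF p', of "v$l - 1" "i$l"] by (simp add: u_def i_def)
        then show ?thesis by (simp add: box_d_def)
      qed
      from fun_cong[OF \<open>?G x = ?G y\<close>, of i] i
      have "restrict (shift (\<chi> l. int p * i$l) x) (box_d 1 (int p)) = restrict (shift (\<chi> l. int p * i$l) y) (box_d 1 (int p))"
        by simp
      from fun_cong[OF this, of u] u show ?thesis by (simp add: shift_apply u_def)
    qed
    then show "restrict x (box_d 1 (int n)) = restrict y (box_d 1 (int n))" by (auto simp: restrict_def)
  qed
  also have "\<dots> \<le> card (PiE ?I (\<lambda>_. ?L))" by (rule card_mono[OF fin sub])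
  also have "\<dots> = card ?L ^ ((n div p + 1) ^ CARD('d))"
  proof -
    have "nat (int (n div p) - 0 + 1) = n div p + 1" by linarith
    then show ?thesis by (simp add: card_PiE card_box_d)
  qed
  finally show ?thesis .
qed

text \<open>\<open>htop\<close> is defined by \<open>lim\<close>, which says nothing before
  convergence is known. This is Fekete's argument: the covering bound gives
  \<open>u n \<le> (1 + p / n) ^ d * u p\<close> with \<open>d\<close> the dimension, so the
  sequence converges to its infimum over positive indices.\<close>

lemma htop_limit:
  fixes Y :: "(int^'d \<Rightarrow> 'b::finite) set"
  assumes inv: "shift_invariant Y"
  shows "(\<lambda>n. ln (real (card (lang Y (box_d 1 (int n) :: (int^'d) set)))) / (real n) ^ CARD('d)) \<longlonglongrightarrow> htop Y"
    and "0 \<le> htop Y"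
proof -
  let ?d = "CARD('d)"
  define b where "b n = card (lang Y (box_d 1 (int n) :: (int^'d) set))" for n
  define u where "u n = ln (real (b n)) / (real n) ^ ?d" for n
  have u0: "0 \<le> u n" for n
  proof -
    \<comment> \<open>\<open>Y\<close> may be empty; then all counts are 0, and
      \<open>ln 0 = 0\<close>.\<close>
    have "0 \<le> ln (real (b n))" by (cases "b n = 0") (auto intro!: ln_ge_zero)
    then show ?thesis by (simp add: u_def)
  qed
  have lnle: "ln (real (b n)) \<le> real ((n div p + 1) ^ ?d) * ln (real (b p))" if p: "0 < p" for n p
  proof (cases "b n = 0")
    case True
    have "0 \<le> ln (real (b p))" by (cases "b p = 0") (auto intro!: ln_ge_zero)
    then show ?thesis using True by simp
  next
    case False
    have "real (b n) \<le> real (b p ^ ((n div p + 1) ^ ?d))"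
      using card_lang_cover[OF inv p, of n] unfolding b_def by (rule of_nat_mono)
    moreover have "b p \<noteq> 0"
    proof
      assume "b p = 0"
      then have "b n \<le> 0 ^ ((n div p + 1) ^ ?d)" using card_lang_cover[OF inv p, of n] by (simp add: b_def)
      then show False using False by (simp add: zero_power)
    qed
    ultimately have "ln (real (b n)) \<le> ln (real (b p) ^ ((n div p + 1) ^ ?d))"
      using False by (intro ln_mono) simp_all
    then show ?thesis using \<open>b p \<noteq> 0\<close> by (simp add: ln_realpow)
  qed
  have ule: "u n \<le> (1 + real p / real n) ^ ?d * u p" if n: "0 < n" and p: "0 < p" for n p
  proof -
    have "real (n div p * p) \<le> real n" by (rule of_nat_mono) (rule div_times_less_eq_dividend)
    then have "real (n div p) + 1 \<le> real n / real p + 1" using p by (simp add: field_simps)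
    then have "(real (n div p) + 1) ^ ?d \<le> (real n / real p + 1) ^ ?d" by (intro power_mono) auto
    moreover have l0: "0 \<le> ln (real (b p))" by (cases "b p = 0") (auto intro!: ln_ge_zero)
    ultimately have "ln (real (b n)) \<le> (real n / real p + 1) ^ ?d * ln (real (b p))"
      using lnle[OF p, of n] mult_right_mono[of "(real (n div p) + 1) ^ ?d" "(real n / real p + 1) ^ ?d" "ln (real (b p))"]
      by (simp add: add.commute)
    then have "u n \<le> (real n / real p + 1) ^ ?d * ln (real (b p)) / real n ^ ?d"
      unfolding u_def by (intro divide_right_mono) auto
    also have "\<dots> = (real p / real n * (real n / real p + 1)) ^ ?d * u p"
      using n p by (simp add: u_def power_mult_distrib power_divide)
    also have "real p / real n * (real n / real p + 1) = 1 + real p / real n"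
      using n p by (simp add: field_simps)
    finally show ?thesis .
  qed
  define I where "I = Inf (u ` {0<..})"
  have bdd: "bdd_below (u ` {0<..})" by (rule bdd_belowI[of _ 0]) (use u0 in auto)
  have "u \<longlonglongrightarrow> I"
  proof (rule LIMSEQ_I)
    fix \<epsilon> :: real assume e: "0 < \<epsilon>"
    have "\<exists>x\<in>u ` {0<..}. x < I + \<epsilon> / 2"
      using e cInf_less_iff[of "u ` {0<..}" "I + \<epsilon> / 2"] bdd by (auto simp: I_def)
    then obtain p where p: "0 < p" "u p < I + \<epsilon> / 2" by auto
    have "(\<lambda>n. (1 + real p / real n) ^ ?d * u p) \<longlonglongrightarrow> (1 + 0) ^ ?d * u p"
      by (intro tendsto_intros lim_const_over_n)
    then have "\<forall>\<^sub>F n in sequentially. (1 + real p / real n) ^ ?d * u p < I + \<epsilon>"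
      using p(2) e by (intro order_tendstoD(2)) auto
    then obtain n0 where n0: "\<And>n. n \<ge> n0 \<Longrightarrow> (1 + real p / real n) ^ ?d * u p < I + \<epsilon>"
      by (auto simp: eventually_sequentially)
    have "\<bar>u n - I\<bar> < \<epsilon>" if "n \<ge> Suc n0" for n
    proof -
      have "u n < I + \<epsilon>" using ule[of n p] n0[of n] that p by fastforce
      moreover have "I \<le> u n" unfolding I_def by (rule cInf_lower[OF _ bdd]) (use that in auto)
      ultimately show ?thesis using e by linarith
    qed
    then show "\<exists>n0. \<forall>n\<ge>n0. norm (u n - I) < \<epsilon>" by auto
  qed
  moreover have ueq: "(\<lambda>n. ln (real (card (lang Y (box_d 1 (int n) :: (int^'d) set)))) / (real n) ^ ?d) = u"
    by (simp add: u_def b_def fun_eq_iff)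
  ultimately have "htop Y = I" unfolding htop_def ueq by (intro limI)
  then show "(\<lambda>n. ln (real (card (lang Y (box_d 1 (int n) :: (int^'d) set)))) / (real n) ^ ?d) \<longlonglongrightarrow> htop Y"
    using \<open>u \<longlonglongrightarrow> I\<close> ueq by simp
  then show "0 \<le> htop Y" unfolding ueq by (rule LIMSEQ_le_const) (use u0 in auto)
qed

lemma power_diff_le:
  assumes "(a::nat) \<le> s" shows "s ^ n - a ^ n \<le> n * (s - a) * s ^ (n - 1)"
proof -
  have "int (s ^ n - a ^ n) = int s ^ n - int a ^ n"
    using power_mono[OF assms, of n] by (simp add: of_nat_diff)
  also have "\<dots> = (int s - int a) * (\<Sum>i<n. int a ^ (n - Suc i) * int s ^ i)" by (rule power_diff_sumr2)
  also have "\<dots> \<le> (int s - int a) * (\<Sum>i<n. int s ^ (n - 1))"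
  proof (intro mult_left_mono sum_mono)
    fix i assume "i \<in> {..<n}"
    then have "n - 1 = (n - Suc i) + i" by auto
    then have "int s ^ (n - 1) = int s ^ (n - Suc i) * int s ^ i" by (simp add: power_add)
    moreover have "int a ^ (n - Suc i) \<le> int s ^ (n - Suc i)" using assms by (intro power_mono) auto
    ultimately show "int a ^ (n - Suc i) * int s ^ i \<le> int s ^ (n - 1)" by (simp add: mult_right_mono)
  qed (use assms in auto)
  also have "\<dots> = int (n * (s - a) * s ^ (n - 1))" using assms by (simp add: of_nat_diff)
  finally show ?thesis by (simp only: of_nat_le_iff)
qed

text \<open>On the box of side \<open>a\<close> there are more than \<open>exp (h1 * a ^ d)\<close>
  patterns, on the box of side \<open>s\<close> at most \<open>exp (h2 * s ^ d)\<close> words of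
  \<open>Y\<close>, where \<open>h2 < h1\<close> and \<open>d\<close> is the dimension. The
  difference \<open>s - a\<close> stays bounded as \<open>s\<close> grows, so all losses but one are
  of order \<open>s ^ (d - 1)\<close>; the exception is the slab in \<open>card_self_compat\<close>,
  which is made small by choosing \<open>s\<close> without small divisors. The side \<open>a\<close>
  is a multiple of \<open>k\<close>, as the entropy of the family refers to such boxes only.\<close>

lemma codebook_exists:
  fixes X :: "(int^'d \<Rightarrow> 'a::finite) set" and Y :: "(int^'d \<Rightarrow> 'b::finite) set"
    and P :: "(int^'d) set \<Rightarrow> (int^'d \<Rightarrow> 'a) set"
  assumes dim: "CARD('d) \<ge> 2" and fam: "family_of_patterns X k P" and inv: "shift_invariant Y"
    and ent: "ereal (htop Y) < family_entropy k P"
  obtains s a b w Q where "k dvd a" "0 < a" "a + 2 * m + 1 \<le> s" "1 \<le> b"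
    "card (lang Y (box_d 1 (int s))) \<le> b" "w \<in> P (box_d 1 (int a))" "Q \<subseteq> P (box_d 1 (int a))" "w \<notin> Q"
    "finite Q" "2 * b \<le> card Q"
    "\<And>q t. q \<in> insert w Q \<Longrightarrow> \<exists>l. \<not> int s dvd t$l \<Longrightarrow> \<not> compat a s w q t"
proof -
  let ?d = "CARD('d)" and ?\<alpha> = "ln (real CARD('a))"
  have k: "0 < k" using fam by (simp add: family_of_patterns_def)
  obtain h1 where h1: "htop Y < h1" "ereal h1 < family_entropy k P" using ereal_dense2[OF ent] by auto
  define pc where "pc n = card (P (box_d 1 (int (n * k)) :: (int^'d) set))" for n
  have "\<forall>\<^sub>F n in sequentially. ereal h1 < ereal (ln (real (pc n)) / (real (n * k)) ^ ?d)"
    using less_LiminfD[OF h1(2)[unfolded family_entropy_def]] by (simp add: pc_def)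
  then obtain N0 where N0: "\<And>n. n \<ge> N0 \<Longrightarrow> h1 < ln (real (pc n)) / (real (n * k)) ^ ?d"
    by (auto simp: eventually_sequentially)
  define h2 where "h2 = (htop Y + h1) / 2"
  have h2: "htop Y < h2" "h2 < h1" using h1(1) by (auto simp: h2_def)
  have h0: "0 \<le> htop Y" by (rule htop_limit(2)[OF inv])
  have h12: "0 < h2" "0 < h1" using h0 h2 by auto
  define bb where "bb n = card (lang Y (box_d 1 (int n) :: (int^'d) set))" for n
  have "\<forall>\<^sub>F n in sequentially. ln (real (bb n)) / (real n) ^ ?d < h2"
    using order_tendstoD(2)[OF htop_limit(1)[OF inv] h2(1)] by (simp add: bb_def)
  then obtain N1 where N1: "\<And>n. n \<ge> N1 \<Longrightarrow> ln (real (bb n)) / (real n) ^ ?d < h2"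
    by (auto simp: eventually_sequentially)
  have \<alpha>: "0 \<le> ?\<alpha>" by (rule ln_ge_zero) (simp add: Suc_leI)
  \<comment> \<open>The slab has at most \<open>s ^ d / L\<close> symbols; with this
    \<open>L\<close> it adds at most \<open>h1 / 4 * s ^ d\<close> to the exponent.\<close>
  define L where "L = Suc (nat \<lceil>4 * ?\<alpha> / h1\<rceil>)"
  have L: "0 < L" by (simp add: L_def)
  have "4 * ?\<alpha> / h1 \<le> real L" unfolding L_def by linarith
  then have \<alpha>L: "?\<alpha> \<le> h1 / 4 * real L" using h12 by (simp add: field_simps)
  define g0 where "g0 = 2 * m + 1 + k"
  \<comment> \<open>\<open>C\<close> collects the coefficients of \<open>s ^ (d - 1)\<close>: 2 for
    the reserve in \<open>D - 2\<close>, \<open>d\<close> for the factor \<open>s ^ d\<close>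
    through \<open>ln s \<le> s ^ (d - 1)\<close>, and the two products for the volume of the gap,
    once as free symbols and once as a loss in \<open>a ^ d\<close>. The margin that has to absorb
    them is \<open>e * s ^ d\<close>.\<close>
  define C where "C = 2 + real ?d + ?\<alpha> * (real ?d * real g0) + h1 * (real ?d * real g0)"
  define e where "e = min (h1 / 2) (h1 - h2)"
  have e: "0 < e" "e \<le> h1 / 2" "e \<le> h1 - h2" using h12 h2 unfolding e_def by (simp, intro min.cobounded1, intro min.cobounded2)
  define j where "j = N1 + g0 + k * (N0 + 2) + nat \<lceil>C / e\<rceil>"
  \<comment> \<open>\<open>s\<close> is congruent to 1 modulo every positive number up to
    \<open>L\<close>, so it has no divisor other than 1 below \<open>L\<close>.\<close>
  define s where "s = fact L * j + 1"
  have "1 * j \<le> fact L * j" by (rule mult_right_mono) (simp_all add: Suc_leI)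
  then have sj: "j + 1 \<le> s" by (simp add: s_def)
  have sdiv: "L \<le> f" if f: "f dvd s" "f \<noteq> 1" for f
  proof (rule ccontr)
    assume "\<not> L \<le> f"
    moreover have "0 < f" using f by (cases f) (auto simp: s_def)
    ultimately have "f dvd fact L" by (intro dvd_fact) auto
    then have "f dvd fact L * j" by (rule dvd_mult2)
    then have "f dvd 1" using f(1) unfolding s_def by (metis dvd_add_right_iff)
    then show False using f(2) by simp
  qed
  define N where "N = (s - (2 * m + 1)) div k"
  define a where "a = N * k"
  have s_ge: "g0 + k * (N0 + 2) \<le> s" using sj by (simp add: j_def)
  have a_le: "a \<le> s - (2 * m + 1)" unfolding a_def N_def by (rule div_times_less_eq_dividend)
  have a_s: "a + 2 * m + 1 \<le> s" using a_le s_ge by (simp add: g0_def)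
  have "s - (2 * m + 1) < a + k"
    unfolding a_def N_def using dividend_less_div_times[OF k, of "s - (2 * m + 1)"] by simp
  then have gap0: "s - a \<le> g0" by (simp add: g0_def)
  have "k * (N0 + 2) \<le> s - (2 * m + 1)" using s_ge by (simp add: g0_def)
  then have "N0 + 2 \<le> N" unfolding N_def using k by (simp add: less_eq_div_iff_mult_less_eq mult.commute)
  then have NN: "N0 \<le> N" "0 < N" by auto
  have a0: "0 < a" using NN k by (simp add: a_def)
  have as: "a \<le> s" "0 < s" using a_s by auto
  let ?W = "P (box_d 1 (int a))"
  have W: "?W \<subseteq> words a"
  proof -
    have "grid_union k (box_d 1 (int a) :: (int^'d) set)"
      unfolding a_def by (rule grid_union_box[OF dim k])
    then have "?W \<subseteq> lang X (box_d 1 (int a))" using fam by (simp add: family_of_patterns_def)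
    then show ?thesis by (auto simp: lang_def)
  qed
  define gap where "gap = s ^ ?d - a ^ ?d"
  define x where "x = real s ^ (?d - 1)"
  define y where "y = real s ^ ?d"
  have s1: "1 \<le> real s" using as by simp
  have yx: "y = real s * x" using dim by (simp add: y_def x_def flip: power_Suc)
  have x1: "1 \<le> x" unfolding x_def using s1 by (rule one_le_power)
  have sx: "real s \<le> x" unfolding x_def using power_increasing[of 1 "?d - 1" "real s"] s1 dim by simp
  have "real gap \<le> real (?d * (s - a) * s ^ (?d - 1))"
    unfolding gap_def by (rule of_nat_mono) (rule power_diff_le[OF as(1)])
  also have "\<dots> \<le> real ?d * real g0 * x"
    unfolding x_def of_nat_mult of_nat_power using gap0 by (intro mult_right_mono mult_left_mono) auto
  finally have gapx: "real gap \<le> real ?d * real g0 * x" .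
  have ad: "real a ^ ?d = y - real gap"
    unfolding y_def gap_def using power_mono[OF as(1), of ?d] by (simp add: of_nat_diff)
  have "C / e \<le> real s" using sj unfolding j_def by linarith
  then have "C \<le> e * real s" using e by (simp add: field_simps)
  then have Cx: "C * x \<le> e * y" unfolding yx using x1 by (simp add: mult_right_mono flip: mult.assoc)
  have y0: "0 < y" using yx s1 x1 by simp
  define D where "D = h1 * real a ^ ?d"
  have hg: "h1 * real gap \<le> h1 * (real ?d * real g0) * x"
    using gapx h12 by (simp add: mult_left_mono mult.assoc)
  have ag: "?\<alpha> * real gap \<le> ?\<alpha> * (real ?d * real g0) * x"
    using gapx \<alpha> mult_left_mono[of "real gap" "real ?d * real g0 * x" ?\<alpha>] by (simp add: mult.assoc)
  have Dlow: "h1 * y - h1 * (real ?d * real g0) * x \<le> D" using hg unfolding D_def ad by (simp add: algebra_simps)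
  have Csplit: "C * x = 2 * x + real ?d * x + ?\<alpha> * (real ?d * real g0) * x + h1 * (real ?d * real g0) * x"
    unfolding C_def by (simp add: algebra_simps)
  have pos: "0 \<le> real ?d * x" "0 \<le> ?\<alpha> * (real ?d * real g0) * x" "0 \<le> h1 * (real ?d * real g0) * x"
    using x1 \<alpha> h12 by auto
  have ey: "e * y \<le> h1 / 2 * y" "e * y \<le> (h1 - h2) * y" using e y0 by (auto intro!: mult_right_mono)
  have lns: "ln (real s) \<le> x" using ln_le_minus_one[of "real s"] s1 sx by linarith
  have expln: "real (s ^ ?d * CARD('a) ^ i) = exp (real ?d * ln (real s) + ?\<alpha> * real i)" for i
  proof -
    have "exp (real ?d * ln (real s)) = real s ^ ?d" using s1 by (simp add: exp_of_nat_mult)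
    moreover have "exp (?\<alpha> * real i) = real CARD('a) ^ i"
      by (simp add: mult.commute[of _ "real i"] exp_of_nat_mult)
    ultimately show ?thesis by (simp add: exp_add)
  qed
  have dl: "real ?d * ln (real s) \<le> real ?d * x" using lns by (intro mult_left_mono) auto
  have cW: "exp D < real (card ?W)"
  proof -
    have "h1 < ln (real (pc N)) / (real (N * k)) ^ ?d" by (rule N0[OF NN(1)])
    then have "h1 < ln (real (card ?W)) / real a ^ ?d" by (simp add: pc_def a_def)
    then have ln: "D < ln (real (card ?W))" using a0 by (simp add: D_def pos_less_divide_eq)
    have "0 < D" using h12 a0 by (simp add: D_def)
    then have "card ?W \<noteq> 0" using ln by (cases "card ?W = 0") auto
    then show ?thesis using ln by (metis exp_less_mono exp_ln of_nat_0_less_iff neq0_conv)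
  qed
  have c1: "s ^ ?d * CARD('a) ^ (s ^ ?d div L + (s ^ ?d - a ^ ?d)) < card ?W"
  proof -
    have "?\<alpha> * real (s ^ ?d div L) \<le> h1 / 4 * y"
    proof -
      have "real (s ^ ?d div L) * real L \<le> y"
        unfolding y_def by (metis div_times_less_eq_dividend of_nat_le_iff of_nat_mult of_nat_power)
      have "?\<alpha> * real (s ^ ?d div L) \<le> h1 / 4 * real L * real (s ^ ?d div L)"
        using \<alpha>L by (rule mult_right_mono) simp
      also have "\<dots> = h1 / 4 * (real (s ^ ?d div L) * real L)" by simp
      also have "\<dots> \<le> h1 / 4 * y" using \<open>real (s ^ ?d div L) * real L \<le> y\<close> h12 by (intro mult_left_mono) auto
      finally show ?thesis .
    qed
    then have "real ?d * ln (real s) + ?\<alpha> * real (s ^ ?d div L + gap) \<le>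
        real ?d * x + h1 / 4 * y + ?\<alpha> * (real ?d * real g0) * x"
      unfolding of_nat_add distrib_left using dl ag by linarith
    also have "\<dots> \<le> D"
    proof -
      have "0 < h1 * y" using h12 y0 by simp
      then show ?thesis using Dlow Csplit Cx ey(1) pos x1 by linarith
    qed
    finally have "real (s ^ ?d * CARD('a) ^ (s ^ ?d div L + gap)) \<le> exp D" unfolding expln by simp
    then have "real (s ^ ?d * CARD('a) ^ (s ^ ?d div L + gap)) < real (card ?W)" using cW by linarith
    then show ?thesis unfolding gap_def of_nat_less_iff .
  qed
  define b where "b = max 1 (bb s)"
  have c2: "2 * b + 1 + s ^ ?d * CARD('a) ^ (s ^ ?d - a ^ ?d) \<le> card ?W"
  proof -
    have b: "real b \<le> exp (h2 * y)"
    proof (cases "bb s = 0")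
      case True
      then show ?thesis using h12 y0 by (simp add: b_def)
    next
      case False
      have "N1 \<le> s" using sj by (simp add: j_def)
      then have "ln (real (bb s)) \<le> h2 * y" using N1[of s] y0 by (simp add: y_def[symmetric] pos_divide_less_eq)
      then have "real (bb s) \<le> exp (h2 * y)" using False by (metis exp_le_cancel_iff exp_ln of_nat_0_less_iff neq0_conv)
      moreover have "1 \<le> exp (h2 * y)" using h12 y0 by simp
      ultimately show ?thesis by (simp add: b_def max_def)
    qed
    \<comment> \<open>Each of \<open>b\<close>, 1 and the third summand is to be at most
      \<open>exp (D - 2)\<close>. The total is then at most \<open>4 * exp (D - 2)\<close>, and
      \<open>4 \<le> exp 2\<close>.\<close>
    have "h2 * y \<le> D - 2"
    proof -
      have "(h1 - h2) * y = h1 * y - h2 * y" by (simp add: algebra_simps)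
      then show ?thesis using Dlow Csplit Cx ey(2) pos x1 by linarith
    qed
    then have t1: "real b \<le> exp (D - 2)" using b by (meson exp_le_cancel_iff order_trans)
    have "real ?d * ln (real s) + ?\<alpha> * real gap \<le> D - 2"
    proof -
      have "0 < h1 * y" using h12 y0 by simp
      then show ?thesis using Dlow Csplit Cx ey(1) pos x1 dl ag by linarith
    qed
    then have t3: "real (s ^ ?d * CARD('a) ^ gap) \<le> exp (D - 2)" unfolding expln by simp
    have "0 \<le> h2 * y" using h12 y0 by simp
    then have "0 \<le> D - 2" using \<open>h2 * y \<le> D - 2\<close> by linarith
    then have t2: "1 \<le> exp (D - 2)" by simp
    have "4 \<le> exp (2::real)"
    proof -
      have "2 \<le> exp (1::real)" using exp_ge_add_one_self[of 1] by simp
      then have "2 * 2 \<le> exp (1::real) * exp 1" by (intro mult_mono) auto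
      then show ?thesis by (simp flip: exp_add)
    qed
    then have "4 * exp (D - 2) \<le> exp 2 * exp (D - 2)" by (rule mult_right_mono) simp
    also have "\<dots> = exp D" by (simp flip: exp_add)
    finally have "2 * real b + 1 + real (s ^ ?d * CARD('a) ^ gap) \<le> real (card ?W)"
      using t1 t2 t3 cW by linarith
    then have "real (2 * b + 1 + s ^ ?d * CARD('a) ^ gap) \<le> real (card ?W)" by simp
    then show ?thesis unfolding gap_def of_nat_le_iff .
  qed
  obtain w Q where wQ: "w \<in> ?W" "Q \<subseteq> ?W" "w \<notin> Q" "finite Q" "2 * b \<le> card Q"
    "\<And>q t. q \<in> insert w Q \<Longrightarrow> \<exists>l. \<not> int s dvd t$l \<Longrightarrow> \<not> compat a s w q t"
    by (rule codebook_count[OF as sdiv L W c1 c2]) (assumption+, rule that)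
  show ?thesis
    by (rule that[of a s b w Q]) (use wQ a0 a_s in \<open>auto simp: a_def b_def bb_def\<close>)
qed

subsection \<open>Scales\<close>

text \<open>Let \<open>r = 40 * p * R\<close> with \<open>p\<close> and \<open>s\<close> fixed. The
  two sides whose powers are subtracted differ by a constant and are at most \<open>B * R\<close>,
  so the left-hand side grows like \<open>R ^ (d - 1)\<close> against \<open>R ^ d\<close> on the
  right.\<close>

lemma scale_step:
  assumes "0 < (p::int)" "0 \<le> s" "0 < d"
  shows "\<exists>r\<ge>64 * p. l * (nat (2 * (2 * r + 8 * p + 3 * s) + 1) ^ d - nat (2 * (2 * r - s) + 1) ^ d + e)
     \<le> nat (r div (40 * p)) ^ d \<and> s \<le> r"
proof -
  define p' s' where "p' = nat p" and "s' = nat s"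
  have ps: "p = int p'" "s = int s'" "0 < p'" using assms by (auto simp: p'_def s'_def)
  define B where "B = 176 * p' + 6 * s' + 1"
  define R where "R = l * (d * (16 * p' + 8 * s') * B ^ (d - 1) + e) + 2 + s'"
  define r where "r = 40 * p * int R"
  have R: "2 \<le> R" "s' \<le> R" "l * (d * (16 * p' + 8 * s') * B ^ (d - 1) + e) \<le> R" by (auto simp: R_def)
  have "40 * p * 2 \<le> r" unfolding r_def using R(1) assms by (intro mult_left_mono) auto
  then have r64: "64 * p \<le> r" using assms by linarith
  have "1 * int R \<le> (40 * p) * int R" by (rule mult_right_mono) (use assms in auto)
  then have sr: "s \<le> r" unfolding r_def ps using R(2) by linarith
  have rd: "nat (r div (40 * p)) = R" unfolding r_def using assms by simp
  define A1 A2 where "A1 = nat (2 * (2 * r + 8 * p + 3 * s) + 1)" and "A2 = nat (2 * (2 * r - s) + 1)"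
  have A1: "A1 = 160 * p' * R + 16 * p' + 6 * s' + 1"
    unfolding A1_def r_def ps by (simp add: nat_eq_iff algebra_simps)
  have A12: "A2 \<le> A1" "A1 - A2 = 16 * p' + 8 * s'"
  proof -
    have "int A1 = 2 * (2 * r + 8 * p + 3 * s) + 1" "int A2 = 2 * (2 * r - s) + 1"
      using sr assms(1,2) r64 by (auto simp: A1_def A2_def)
    then have "int A1 = int A2 + int (16 * p' + 8 * s')" using ps by simp
    then have "A1 = A2 + (16 * p' + 8 * s')" by linarith
    then show "A2 \<le> A1" "A1 - A2 = 16 * p' + 8 * s'" by auto
  qed
  have A1B: "A1 \<le> B * R"
  proof -
    have "p' \<le> p' * R" "s' \<le> s' * R" using R(1) by auto
    moreover have "B * R = 160 * (p' * R) + 16 * (p' * R) + 6 * (s' * R) + R"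
      by (simp add: B_def algebra_simps)
    moreover have "160 * p' * R = 160 * (p' * R)" by simp
    ultimately show ?thesis unfolding A1 using R(1) by linarith
  qed
  have "A1 ^ d - A2 ^ d \<le> d * (A1 - A2) * A1 ^ (d - 1)" by (rule power_diff_le[OF A12(1)])
  also have "\<dots> \<le> d * (16 * p' + 8 * s') * (B * R) ^ (d - 1)"
    unfolding A12(2) using A1B by (intro mult_left_mono power_mono) auto
  also have "\<dots> = d * (16 * p' + 8 * s') * B ^ (d - 1) * R ^ (d - 1)" by (simp add: power_mult_distrib)
  finally have 1: "A1 ^ d - A2 ^ d \<le> d * (16 * p' + 8 * s') * B ^ (d - 1) * R ^ (d - 1)" .
  have "e * 1 \<le> e * R ^ (d - 1)" using R(1) by (intro mult_left_mono) auto
  then have "A1 ^ d - A2 ^ d + e \<le> (d * (16 * p' + 8 * s') * B ^ (d - 1) + e) * R ^ (d - 1)"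
    using 1 unfolding distrib_right mult_1_right by (rule add_mono[rotated])
  then have "l * (A1 ^ d - A2 ^ d + e) \<le> l * ((d * (16 * p' + 8 * s') * B ^ (d - 1) + e) * R ^ (d - 1))"
    by (rule mult_left_mono) simp
  also have "\<dots> \<le> R * R ^ (d - 1)" unfolding mult.assoc[symmetric] using R(3) by (rule mult_right_mono) simp
  also have "\<dots> = R ^ d" using assms(3) by (simp flip: power_Suc)
  finally show ?thesis using r64 sr rd unfolding A1_def A2_def by (intro exI[of _ r]) simp
qed

lemma scales_exist:
  assumes "0 \<le> s" "0 < d" "0 < base"
  obtains \<rho> :: "nat \<Rightarrow> int" where "\<rho> 0 = base" "\<And>n. 64 * \<rho> n \<le> \<rho> (Suc n)"
    "\<And>n. l * (nat (2 * (2 * \<rho> (Suc n) + 8 * \<rho> n + 3 * s) + 1) ^ d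
        - nat (2 * (2 * \<rho> (Suc n) - s) + 1) ^ d + (e + n))
     \<le> nat (\<rho> (Suc n) div (40 * \<rho> n)) ^ d"
proof -
  define Q where "Q n p r \<longleftrightarrow> 64 * p \<le> r \<and> l * (nat (2 * (2 * r + 8 * p + 3 * s) + 1) ^ d
        - nat (2 * (2 * r - s) + 1) ^ d + (e + n)) \<le> nat (r div (40 * p)) ^ d" for n and p r :: int
  have "\<exists>f. \<forall>n. (0 < f n \<and> (n = 0 \<longrightarrow> f n = base)) \<and> Q n (f n) (f (Suc n))"
  proof (rule dependent_nat_choice)
    show "\<exists>x. 0 < x \<and> (0 = (0::nat) \<longrightarrow> x = base)" using assms(3) by auto
    fix p :: int and n :: nat assume "0 < p \<and> (n = 0 \<longrightarrow> p = base)"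
    then have p: "0 < p" by simp
    obtain r where "64 * p \<le> r" "Q n p r" using scale_step[OF p assms(1,2), of l "e + n"] unfolding Q_def by blast
    then show "\<exists>r. (0 < r \<and> (Suc n = 0 \<longrightarrow> r = base)) \<and> Q n p r" using p by (intro exI[of _ r]) auto
  qed
  then obtain f where f: "\<And>n. (0 < f n \<and> (n = 0 \<longrightarrow> f n = base)) \<and> Q n (f n) (f (Suc n))" by blast
  show ?thesis by (rule that[of f]) (use f in \<open>auto simp: Q_def\<close>)
qed

subsection \<open>Coding\<close>

lemma property_F_extend:
  assumes F: "property_F X k P m" and C: "grid_union k C" and fin: "finite A"
    and Cs: "\<And>x. x \<in> A \<Longrightarrow> grid_union k (Cs x)" "\<And>x. x \<in> A \<Longrightarrow> cs x \<in> P (Cs x)"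
    "\<And>x. x \<in> A \<Longrightarrow> thick (int m) (Cs x) \<subseteq> C"
    "\<And>x x'. x \<in> A \<Longrightarrow> x' \<in> A \<Longrightarrow> x \<noteq> x' \<Longrightarrow> thick (int m) (Cs x) \<inter> thick (int m) (Cs x') = {}"
  shows "\<exists>c\<in>P C. \<forall>x\<in>A. restrict c (Cs x) = cs x"
proof -
  obtain h where h: "bij_betw h {0..<card A} A" using ex_bij_betw_nat_finite[OF fin] by blast
  have hA: "h j \<in> A" if "j < card A" for j using h that by (auto simp: bij_betw_def)
  have inj: "h i \<noteq> h j" if "i < card A" "j < card A" "i \<noteq> j" for i j
    using h that by (auto simp: bij_betw_def inj_on_def)
  have "grid_union k C \<and> (\<forall>j<card A. grid_union k (Cs (h j)) \<and> cs (h j) \<in> P (Cs (h j))) \<and>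
      (\<forall>i<card A. \<forall>j<card A. i \<noteq> j \<longrightarrow>
        (Cs (h i) + box_d (- int m) (int m)) \<inter> (Cs (h j) + box_d (- int m) (int m)) = {}) \<and>
      (\<forall>j<card A. Cs (h j) + box_d (- int m) (int m) \<subseteq> C)"
    unfolding set_plus_box using C Cs hA inj by simp
  moreover have "\<forall>C (r::nat) Cs cs.
        grid_union k C \<and> (\<forall>j<r. grid_union k (Cs j) \<and> cs j \<in> P (Cs j)) \<and>
        (\<forall>i<r. \<forall>j<r. i \<noteq> j \<longrightarrow>
            (Cs i + box_d (- int m) (int m)) \<inter> (Cs j + box_d (- int m) (int m)) = {}) \<and>
        (\<forall>j<r. Cs j + box_d (- int m) (int m) \<subseteq> C)
        \<longrightarrow> (\<exists>c\<in>P C. \<forall>j<r. restrict c (Cs j) = cs j)"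
    using F unfolding property_F_def by (rule conjunct1)
  ultimately obtain c where c: "c \<in> P C" "\<And>j. j < card A \<Longrightarrow> restrict c (Cs (h j)) = cs (h j)"
    by (elim allE[of _ C] allE[of _ "card A"] allE[of _ "\<lambda>j. Cs (h j)"] allE[of _ "\<lambda>j. cs (h j)"]) blast
  have "restrict c (Cs x) = cs x" if "x \<in> A" for x
  proof -
    have "x \<in> h ` {0..<card A}" using h that by (simp add: bij_betw_def)
    then show ?thesis using c(2) by auto
  qed
  then show ?thesis using c(1) by blast
qed

text \<open>Course-of-values recursion. Patterns are specified by a choice that refers to the
  patterns of all lower levels, so these are passed to it as one function, cut off at
  \<open>n\<close>.\<close>

fun level_rec :: "(nat \<Rightarrow> (nat \<Rightarrow> 'c) \<Rightarrow> 'c) \<Rightarrow> nat \<Rightarrow> 'c" where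
  "level_rec F n = F n (\<lambda>j. if j < n then level_rec F j else undefined)"

declare level_rec.simps [simp del]

definition scaled :: "nat \<Rightarrow> int^'d \<Rightarrow> int^'d" where
  "scaled s i = (\<chi> l. int s * i$l)"

lemma scaled_nth [simp]: "scaled s i $ l = int s * i$l" by (simp add: scaled_def)

lemma scaled_inj: "0 < s \<Longrightarrow> scaled s i = scaled s i' \<Longrightarrow> i = i'"
  by (simp add: vec_eq_iff)

lemma scaled_approx:
  assumes "0 < s"
  shows "v - scaled s (\<chi> l. (v$l - 1) div int s) \<in> box_d 1 (int s)"
proof -
  have "1 \<le> v$l - int s * ((v$l - 1) div int s) \<and> v$l - int s * ((v$l - 1) div int s) \<le> int s" for l
    using div_eq_iff_bounds[of "int s" "v$l - 1" "(v$l - 1) div int s"] assms by simp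
  then show ?thesis by (simp add: box_d_def)
qed

lemma box_d_mono: "x' \<le> x \<Longrightarrow> y \<le> y' \<Longrightarrow> box_d x y \<subseteq> box_d x' y'"
  unfolding box_d_def by (intro Collect_mono) (auto intro: order_trans)

lemma box_d_nrm:
  assumes "e \<in> box_d x y" "- h \<le> x" "y \<le> h" shows "nrm e \<le> h"
proof -
  have "\<bar>e$l\<bar> \<le> h" for l
  proof -
    have "x \<le> e$l" "e$l \<le> y" using assms(1) by (auto simp: box_d_def)
    then show ?thesis using assms by simp
  qed
  then show ?thesis by (simp add: nrm_le_iff)
qed

lemma box_d_plus:
  assumes "e \<in> box_d x y" "nrm f \<le> h" shows "e + f \<in> box_d (x - h) (y + h)"
proof -
  have "x - h \<le> (e + f)$l \<and> (e + f)$l \<le> y + h" for l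
  proof -
    have "x \<le> e$l" "e$l \<le> y" using assms(1) by (auto simp: box_d_def)
    moreover have "\<bar>f$l\<bar> \<le> h" using comp_le_nrm[of f l] assms(2) by simp
    ultimately have "x - h \<le> e$l + f$l \<and> e$l + f$l \<le> y + h" by linarith
    then show ?thesis by simp
  qed
  then show ?thesis by (simp add: box_d_def)
qed

text \<open>In \<open>capacity\<close>, the difference of powers bounds the number of lattice points in the shell containing the
  boundary of a piece of level \<open>n\<close>, the next term counts the boxes that carry no data, and the right-hand side
  is the number of disjoint cubes of side \<open>40 * \<rho> n\<close> in the piece, each of which contains a code box.\<close>

locale coding = toast Z \<rho> K M
  for Z :: "(int^'d \<Rightarrow> 'b::finite) set" and \<rho> K M +
  fixes X :: "(int^'d \<Rightarrow> 'a::finite) set" and P :: "(int^'d) set \<Rightarrow> (int^'d \<Rightarrow> 'a) set"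
    and k m s a b :: nat and w q0 q1 :: "int^'d \<Rightarrow> 'a" and Q :: "(int^'d \<Rightarrow> 'a) set"
  assumes fam: "family_of_patterns X k P" and propF: "property_F X k P m"
    and K_def: "K = 3 * int s * int k"
    and k_a: "k dvd a" and a_pos: "0 < a" and a_s: "a + 2 * m + 1 \<le> s" and b_pos: "1 \<le> b"
    and card_lang: "card (lang Z (box_d 1 (int s))) \<le> b"
    and w_P: "w \<in> P (box_d 1 (int a))" and Q_P: "Q \<subseteq> P (box_d 1 (int a))" and w_Q: "w \<notin> Q"
    and fin_Q: "finite Q" and card_Q: "2 * b \<le> card Q"
    and no_compat: "q \<in> insert w Q \<Longrightarrow> \<exists>l. \<not> int s dvd t$l \<Longrightarrow> \<not> compat a s w q t"
    and q01: "q0 \<in> Q" "q1 \<in> Q" "q0 \<noteq> q1"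
    and capacity: "(b + 1) * (nat (2 * (2 * \<rho> (Suc n) + 8 * \<rho> n + 3 * int s) + 1) ^ CARD('d)
        - nat (2 * (2 * \<rho> (Suc n) - int s) + 1) ^ CARD('d) + ((6 * k + 1) ^ CARD('d) + 1 + n))
     \<le> nat (\<rho> (Suc n) div (40 * \<rho> n)) ^ CARD('d)"
begin

text \<open>For a piece anchored at the origin: \<open>slots\<close> indexes the code boxes, \<open>cells\<close> the cells of \<open>y\<close> recorded
  in them. The cells leave out a neighbourhood of the smaller pieces, which record it themselves, and in turn
  exceed the piece itself. The box \<open>level_slot j y\<close> depends only on the pieces of level less than \<open>j\<close>; it
  holds \<open>q1\<close> if \<open>j\<close> is the level of the piece and \<open>q0\<close> if it is smaller.\<close>

definition slots :: "nat \<Rightarrow> (int^'d \<Rightarrow> 'b) \<Rightarrow> (int^'d) set" where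
  "slots n y = {i. (\<forall>e\<in>box_d (1 - int m) (int a + int m). scaled s i + e \<in> piece n y) \<and>
     (\<forall>j u. \<forall>e\<in>box_d (1 - 2 * int m) (int a + 2 * int m). scaled s i + e \<notin> near n y j u)}"

definition cells :: "nat \<Rightarrow> (int^'d \<Rightarrow> 'b) \<Rightarrow> (int^'d) set" where
  "cells n y = {i. scaled s i \<in> thick (3 * int s) (piece n y) \<and> (\<forall>j u. scaled s i \<notin> thick (int s) (near n y j u))}"

definition marker_array :: "(int^'d) set" where "marker_array = box_d 0 (6 * int k)"

definition level_slot :: "nat \<Rightarrow> (int^'d \<Rightarrow> 'b) \<Rightarrow> int^'d" where
  "level_slot j y = (SOME i. r j \<le> 8 * nrm (scaled s i) \<and> nrm (scaled s i) \<le> r j \<and>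
     (\<forall>l<j. \<forall>u. near j y l u \<inter> cb (scaled s i) (3 * r l) = {}))"

definition data :: "nat \<Rightarrow> (int^'d \<Rightarrow> 'b) \<Rightarrow> (int^'d) set" where
  "data n y = slots n y - marker_array - (\<lambda>j. level_slot j y) ` {..n}"

definition info :: "nat \<Rightarrow> (int^'d \<Rightarrow> 'b) \<Rightarrow> int^'d \<Rightarrow> int^'d \<Rightarrow> 'b" where
  "info n y = restrict (\<lambda>i. restrict (shift (scaled s i) y) (box_d 1 (int s))) (cells n y)"

text \<open>The injection is chosen from the two index sets alone. Points with equal cells and equal
  data boxes are therefore coded by the same injection, and the decoder knows which one.\<close>

definition coder :: "(int^'d) set \<Rightarrow> (int^'d) set \<Rightarrow> (int^'d \<Rightarrow> int^'d \<Rightarrow> 'b) \<Rightarrow> int^'d \<Rightarrow> int^'d \<Rightarrow> 'a" where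
  "coder J D = (SOME f. f ` PiE J (\<lambda>_. lang Z (box_d 1 (int s))) \<subseteq> PiE D (\<lambda>_. Q) \<and>
     inj_on f (PiE J (\<lambda>_. lang Z (box_d 1 (int s)))))"

definition assign :: "nat \<Rightarrow> (int^'d \<Rightarrow> 'b) \<Rightarrow> int^'d \<Rightarrow> int^'d \<Rightarrow> 'a" where
  "assign n y i = (if i \<in> marker_array then w else if \<exists>j\<le>n. i = level_slot j y then (if i = level_slot n y then q1 else q0)
     else coder (cells n y) (data n y) (info n y) i)"

definition pat_step :: "nat \<Rightarrow> (nat \<Rightarrow> (int^'d \<Rightarrow> 'b) \<Rightarrow> int^'d \<Rightarrow> 'a) \<Rightarrow> (int^'d \<Rightarrow> 'b) \<Rightarrow> int^'d \<Rightarrow> 'a" where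
  "pat_step n f y = (SOME c. c \<in> P (piece n y) \<and>
     (\<forall>j u. near n y j u \<noteq> {} \<longrightarrow> near n y j u \<subseteq> piece n y \<longrightarrow>
       (\<forall>p\<in>near n y j u. c p = f j (shift u y) (p - u))) \<and>
     (\<forall>i\<in>slots n y. \<forall>e\<in>box_d 1 (int a). c (scaled s i + e) = assign n y i e))"

definition pat :: "nat \<Rightarrow> (int^'d \<Rightarrow> 'b) \<Rightarrow> int^'d \<Rightarrow> 'a" where
  "pat = level_rec pat_step"

lemma k_pos: "0 < k" using fam by (simp add: family_of_patterns_def)

lemma s_pos: "0 < s" using a_s by simp

lemma s_le_K: "3 * int s \<le> K" unfolding K_def using mult_left_mono[of 1 "int k" "3 * int s"] k_pos by simp

lemma k_dvd_K: "int k dvd K" by (simp add: K_def)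

lemma marker_array_bound: "6 * int k * int s + 2 * int s \<le> \<rho> 0"
proof -
  have "1 * int s \<le> int k * int s" by (rule mult_right_mono) (use k_pos in auto)
  moreover have "K = 3 * (int k * int s)" by (simp add: K_def)
  moreover have "6 * int k * int s = 6 * (int k * int s)" by simp
  ultimately show ?thesis using rho_0 by linarith
qed

lemma s_rho: "24 * int s \<le> \<rho> n" using rho_ge[of n] s_le_K by linarith

lemma s_r: "24 * int s \<le> r n" using s_rho[of "Suc n"] by (simp add: r_def)

lemma box_m_nrm: "e \<in> box_d (1 - 2 * int m) (int a + 2 * int m) \<Longrightarrow> nrm e \<le> int s"
  by (erule box_d_nrm) (use a_s in auto)

lemma box_m_nrm': "e \<in> box_d (1 - int m) (int a + int m) \<Longrightarrow> nrm e \<le> int s"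
  by (erule box_d_nrm) (use a_s in auto)

lemma r_mono: "j \<le> n \<Longrightarrow> r j \<le> r n"
  unfolding r_def by (rule rho_mono) simp

lemma r_64: "j < n \<Longrightarrow> 64 * r j \<le> r n"
  using r_rho[of j n] rho_r64[of n] r_pos[of j] by linarith

lemma spread_near': "y \<in> Z \<Longrightarrow> spread r n (near n y)"
  by (rule spread_near[OF spread_all])

lemma near_empty_ge: "n \<le> j \<Longrightarrow> near n y j u = {}" by (simp add: near_eq)

lemma slotI:
  assumes C: "cb 0 (2 * r n) \<subseteq> piece n y" and i: "nrm (scaled s i) \<le> 2 * r n - int s"
    and cl: "\<And>j u. j < n \<Longrightarrow> near n y j u \<inter> cb (scaled s i) (int s) = {}"
  shows "i \<in> slots n y"
  unfolding slots_def
proof (intro CollectI conjI ballI allI)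
  fix e :: "int^'d" assume "e \<in> box_d (1 - int m) (int a + int m)"
  then have "nrm (scaled s i + e) \<le> 2 * r n" using box_m_nrm'[of e] nrm_triangle[of "scaled s i" e] i by linarith
  then show "scaled s i + e \<in> piece n y" using C by auto
next
  fix j u and e :: "int^'d" assume "e \<in> box_d (1 - 2 * int m) (int a + 2 * int m)"
  then have "scaled s i + e \<in> cb (scaled s i) (int s)" using box_m_nrm[of e] by simp
  then show "scaled s i + e \<notin> near n y j u" using cl[of j u] near_empty_ge[of n j y u] by (cases "j < n") auto
qed

text \<open>Rounding a clear point to the lattice moves it by at most \<open>s \<le> r j\<close>,
  which reduces the clearance from \<open>4 * r j\<close> to \<open>3 * r j\<close>.\<close>

lemma grid_clear_exists:
  assumes y: "y \<in> Z"
  obtains i where "nrm (scaled s i - z) \<le> 16 * \<rho> n + int s" "\<And>j u. j < n \<Longrightarrow> near n y j u \<inter> cb (scaled s i) (3 * r j) = {}"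
proof -
  obtain v where v: "nrm (v - z) \<le> 16 * \<rho> n" "clear_at r n (near n y) v"
    using clear_exists[OF spread_near'[OF y], of z n] by auto
  define i where "i = (\<chi> l. (v$l - 1) div int s)"
  have vi: "nrm (v - scaled s i) \<le> int s"
    using box_d_nrm[OF scaled_approx[OF s_pos, of v], of "int s"] unfolding i_def by simp
  have 1: "nrm (scaled s i - z) \<le> 16 * \<rho> n + int s"
    using nrm_triangle_diff[of "scaled s i" z v] nrm_commute[of "scaled s i" v] vi v(1) by linarith
  have 2: "near n y j u \<inter> cb (scaled s i) (3 * r j) = {}" if "j < n" for j u
  proof -
    have "cb (scaled s i) (3 * r j) \<subseteq> cb v (4 * r j)"
    proof
      fix p assume "p \<in> cb (scaled s i) (3 * r j)"
      then show "p \<in> cb v (4 * r j)"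
        using nrm_triangle_diff[of p v "scaled s i"] nrm_commute[of "scaled s i" v] vi s_r[of j] by simp
    qed
    then show ?thesis using v(2) that unfolding clear_at_def by blast
  qed
  show ?thesis by (rule that[OF 1 2])
qed

text \<open>Aim at a point at distance about \<open>r j / 2\<close> from the centre. A clear lattice
  point is found within \<open>16 * \<rho> j + s\<close>, little more than \<open>r j / 4\<close>,
  so its norm lies between \<open>r j / 8\<close> and \<open>r j\<close>. Since \<open>r\<close>
  grows at least by the factor 64, these ranges are disjoint for different levels, and they lie
  beyond the marker array.\<close>

lemma level_slot:
  assumes y: "y \<in> Z"
  shows "r j \<le> 8 * nrm (scaled s (level_slot j y)) \<and> nrm (scaled s (level_slot j y)) \<le> r j \<and>
     (\<forall>l<j. \<forall>u. near j y l u \<inter> cb (scaled s (level_slot j y)) (3 * r l) = {})"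
  unfolding level_slot_def
proof (rule someI_ex)
  obtain l0 :: 'd where True by auto
  define z where "z = (axis l0 (r j div 2) :: int^'d)"
  have z: "nrm z = r j div 2" using r_pos[of j] by (simp add: z_def nrm_axis)
  obtain i where i: "nrm (scaled s i - z) \<le> 16 * \<rho> j + int s" "\<And>l u. l < j \<Longrightarrow> near j y l u \<inter> cb (scaled s i) (3 * r l) = {}"
    using grid_clear_exists[OF y, of z j] by blast
  have "nrm (scaled s i) \<le> nrm (scaled s i - z) + nrm z" using nrm_triangle[of "scaled s i - z" z] by simp
  moreover have "nrm z \<le> nrm (scaled s i - z) + nrm (scaled s i)"
    using nrm_triangle[of "z - scaled s i" "scaled s i"] nrm_commute[of z "scaled s i"] by simp
  moreover have "2 * (r j div 2) \<le> r j" "r j \<le> 2 * (r j div 2) + 1" by linarith+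
  ultimately have "r j \<le> 8 * nrm (scaled s i)" "nrm (scaled s i) \<le> r j"
    using z i(1) rho_r64[of j] s_rho[of j] s_pos rho_ge[of j] K_pos by linarith+
  then show "\<exists>i. r j \<le> 8 * nrm (scaled s i) \<and> nrm (scaled s i) \<le> r j \<and> (\<forall>l<j. \<forall>u. near j y l u \<inter> cb (scaled s i) (3 * r l) = {})"
    using i(2) by blast
qed

lemma level_slot_inj:
  assumes y: "y \<in> Z" and jl: "j \<noteq> l" shows "level_slot j y \<noteq> level_slot l y"
proof -
  have *: "level_slot j y \<noteq> level_slot l y" if "j < l" for j l
  proof
    assume "level_slot j y = level_slot l y"
    then have "r l \<le> 8 * r j" using level_slot[OF y, of j] level_slot[OF y, of l] by simp
    then show False using r_64[OF that] r_pos[of j] by linarith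
  qed
  show ?thesis using jl *[of j l] *[of l j] by (cases "j < l") auto
qed

lemma marker_array_nrm:
  assumes "i \<in> box_d (-1) (6 * int k + 1)" shows "nrm (scaled s i) \<le> 6 * int k * int s + int s"
proof -
  have "\<bar>scaled s i $ l\<bar> \<le> 6 * int k * int s + int s" for l
  proof -
    have "- 1 \<le> i$l" "i$l \<le> 6 * int k + 1" using assms by (auto simp: box_d_def)
    then have "\<bar>i$l\<bar> \<le> 6 * int k + 1" by linarith
    then have "int s * \<bar>i$l\<bar> \<le> int s * (6 * int k + 1)" by (rule mult_left_mono) simp
    then show ?thesis by (simp add: abs_mult algebra_simps)
  qed
  then show ?thesis by (simp add: nrm_le_iff)
qed

lemma level_slot_notin_arr: assumes y: "y \<in> Z" shows "level_slot j y \<notin> marker_array"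
proof
  assume "level_slot j y \<in> marker_array"
  then have "level_slot j y \<in> box_d (-1) (6 * int k + 1)"
    unfolding marker_array_def box_d_def by (auto simp: order_trans[of "-1" 0])  (smt (verit))
  then have "nrm (scaled s (level_slot j y)) \<le> 6 * int k * int s + int s" by (rule marker_array_nrm)
  then have "nrm (scaled s (level_slot j y)) \<le> \<rho> 0" using marker_array_bound by simp
  then show False using level_slot[OF y, of j] rho_mono[OF le0, of j] rho_r64[of j] rho_pos[of 0] by linarith
qed

section \<open>The code boxes of a single piece and their capacity\<close>

context
  fixes n y assumes y: "y \<in> Z" and anc: "anchor n y"
begin

lemma abs_0: "abs_piece y n 0 = piece n y" by (simp add: abs_piece_def)

lemma piece_ne: "piece n y \<noteq> {}"
  using abs_piece_ne_anchor[OF y, of n 0] anc by (simp add: abs_0)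

lemma piece_bounds: "cb 0 (2 * r n) \<subseteq> piece n y" "piece n y \<subseteq> cb 0 (2 * r n + 8 * \<rho> n)" "piece n y \<subseteq> cb 0 (3 * r n)"
  using abs_piece_bounds[OF y, of n 0] piece_ne by (simp_all add: abs_0)

lemma clear_0: "near n y j u \<inter> cb 0 (4 * r j) = {}"
proof (cases "j < n")
  case True
  then show ?thesis using abs_piece_clear[OF y, of n 0 j u] piece_ne near_subset[of n y j u] by (simp add: abs_0) blast
qed (simp add: near_empty_ge)

lemma finite_piece: "finite (piece n y)" using piece_bounds(3) by (rule finite_subset) simp

lemma grid_union_piece: "grid_union k (piece n y)"
proof (rule grid_union_saturated[OF finite_piece _ k_pos])
  have g: "good_piece n (near n y) (piece n y)"
    using abs_piece_good[OF y, of n 0] piece_ne by (simp add: abs_0)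
  then show "lattice_connected (piece n y)" "lattice_connected (UNIV - piece n y)"
    by (simp_all add: good_piece_def)
  show "saturated (int k) (piece n y)"
    by (rule saturated_dvd[of K]) (use g k_pos K_pos k_dvd_K in \<open>auto simp: good_piece_def\<close>)
qed

text \<open>The range exceeds the marker array by one layer on each side. The boxes of this layer do
  not carry the marker word, which later betrays an array that is shifted against the true
  one.\<close>

lemma marker_array_slots: "box_d (-1) (6 * int k + 1) \<subseteq> slots n y"
proof
  fix i :: "int^'d" assume "i \<in> box_d (-1) (6 * int k + 1)"
  then have i: "nrm (scaled s i) \<le> 6 * int k * int s + int s" by (rule marker_array_nrm)
  have i0: "nrm (scaled s i) + int s \<le> r j" for j
    using i marker_array_bound rho_mono[of 0 "Suc j"] by (simp add: r_def)
  show "i \<in> slots n y"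
  proof (rule slotI[OF piece_bounds(1)])
    show "nrm (scaled s i) \<le> 2 * r n - int s" using i0[of n] r_pos[of n] by linarith
    fix j u
    have "cb (scaled s i) (int s) \<subseteq> cb 0 (4 * r j)"
    proof
      fix p assume "p \<in> cb (scaled s i) (int s)"
      then show "p \<in> cb 0 (4 * r j)" using nrm_triangle_diff[of p 0 "scaled s i"] i0[of j] r_pos[of j] by simp
    qed
    then show "near n y j u \<inter> cb (scaled s i) (int s) = {}" using clear_0[of j u] by blast
  qed
qed

text \<open>\<open>level_slot j\<close> is chosen from the pieces visible at level \<open>j\<close>;
  this transfers its clearance to the wider view at level \<open>n\<close>.\<close>

lemma near_restrict:
  assumes "l < j" "j \<le> n" "near n y l u \<inter> cb v (3 * r l) \<noteq> {}" "nrm v \<le> r j"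
  shows "near j y l u \<inter> cb v (3 * r l) \<noteq> {}"
proof -
  obtain p where p: "p \<in> near n y l u" "nrm (p - v) \<le> 3 * r l" using assms(3) by auto
  have pa: "p \<in> abs_piece y l u" using p(1) near_subset by blast
  have "nrm p \<le> 7 * r j" using nrm_triangle_diff[of p 0 v] p(2) assms(4) r_mono[of l j] assms(1) r_pos[of j] by simp
  then have "near j y l u = abs_piece y l u" by (rule abs_piece_near[OF spread_all[OF y] assms(1) pa])
  then show ?thesis using pa p(2) by fastforce
qed

text \<open>Pieces of level below \<open>j\<close> are avoided by the choice of the box. For a level
  \<open>l \<ge> j\<close> the box lies within \<open>r l + s\<close> of the anchor, which is clear
  of such pieces up to \<open>4 * r l\<close>.\<close>

lemma level_slot_slots: assumes j: "j \<le> n" shows "level_slot j y \<in> slots n y"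
proof (rule slotI[OF piece_bounds(1)])
  let ?v = "scaled s (level_slot j y)"
  have b1: "nrm ?v \<le> r j" using level_slot[OF y, of j] by simp
  show "nrm ?v \<le> 2 * r n - int s" using b1 r_mono[OF j] s_r[of n] by linarith
  fix l u assume "l < n"
  show "near n y l u \<inter> cb ?v (int s) = {}"
  proof (cases "l < j")
    case True
    have "near n y l u \<inter> cb ?v (3 * r l) = {}"
      using near_restrict[OF True j _ b1, of u] level_slot[OF y, of j] True by blast
    moreover have "cb ?v (int s) \<subseteq> cb ?v (3 * r l)" using s_r[of l] by auto
    ultimately show ?thesis by blast
  next
    case False
    have "cb ?v (int s) \<subseteq> cb 0 (4 * r l)"
    proof
      fix p assume "p \<in> cb ?v (int s)"
      then show "p \<in> cb 0 (4 * r l)"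
        using nrm_triangle_diff[of p 0 ?v] b1 r_mono[of j l] False s_r[of l] by simp
    qed
    then show ?thesis using clear_0[of l u] by blast
  qed
qed

lemma finite_slots: "finite (slots n y)"
proof -
  have "(\<lambda>i. scaled s i + 1) ` slots n y \<subseteq> piece n y"
  proof
    fix p assume "p \<in> (\<lambda>i. scaled s i + 1) ` slots n y"
    moreover have "(1 :: int^'d) \<in> box_d (1 - int m) (int a + int m)" using a_pos by (simp add: box_d_def)
    ultimately show "p \<in> piece n y" by (auto simp: slots_def)
  qed
  moreover have "inj_on (\<lambda>i. scaled s i + 1) (slots n y)" using scaled_inj[OF s_pos] by (auto simp: inj_on_def)
  ultimately show ?thesis using finite_subset[OF _ finite_piece] finite_imageD by blast
qed

lemma cells_bound: "i \<in> cells n y \<Longrightarrow> nrm (scaled s i) \<le> 2 * r n + 8 * \<rho> n + 3 * int s"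
proof -
  assume "i \<in> cells n y"
  then have "scaled s i \<in> thick (3 * int s) (cb 0 (2 * r n + 8 * \<rho> n))"
    using thick_mono[OF piece_bounds(2) order_refl, of "3 * int s"] by (auto simp: cells_def)
  then show ?thesis using thick_cb_subset[of "3 * int s" "0::int^'d" "2 * r n + 8 * \<rho> n"] by auto
qed

lemma finite_cells: "finite (cells n y)"
proof -
  have "scaled s ` cells n y \<subseteq> cb 0 (2 * r n + 8 * \<rho> n + 3 * int s)" using cells_bound by auto
  then have "finite (scaled s ` cells n y)" by (rule finite_subset) simp
  moreover have "inj_on (scaled s) (cells n y)" using scaled_inj[OF s_pos] by (auto simp: inj_on_def)
  ultimately show ?thesis by (rule finite_imageD)
qed

text \<open>A cell keeps distance more than \<open>s\<close> from the smaller pieces, so inside the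
  cube of radius \<open>2 * r n - s\<close> it is a slot. The remaining cells lie in the shell
  around that cube.\<close>

lemma cells_not_slots:
  "card (cells n y - slots n y) \<le> nat (2 * (2 * \<rho> (Suc n) + 8 * \<rho> n + 3 * int s) + 1) ^ CARD('d)
        - nat (2 * (2 * \<rho> (Suc n) - int s) + 1) ^ CARD('d)"
proof -
  let ?A = "cb 0 (2 * r n + 8 * \<rho> n + 3 * int s) :: (int^'d) set" and ?B = "cb 0 (2 * r n - int s) :: (int^'d) set"
  have "scaled s ` (cells n y - slots n y) \<subseteq> ?A - ?B"
  proof
    fix p assume "p \<in> scaled s ` (cells n y - slots n y)"
    then obtain i where i: "p = scaled s i" "i \<in> cells n y" "i \<notin> slots n y" by auto
    have "\<not> nrm (scaled s i) \<le> 2 * r n - int s"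
    proof
      assume "nrm (scaled s i) \<le> 2 * r n - int s"
      moreover have "near n y j u \<inter> cb (scaled s i) (int s) = {}" for j u
      proof (rule ccontr)
        assume "near n y j u \<inter> cb (scaled s i) (int s) \<noteq> {}"
        then obtain p where "p \<in> near n y j u" "nrm (p - scaled s i) \<le> int s" by auto
        then have "scaled s i \<in> thick (int s) (near n y j u)" using nrm_commute[of p "scaled s i"] by (auto simp: mem_thick)
        then show False using i(2) by (simp add: cells_def)
      qed
      ultimately have "i \<in> slots n y" by (rule slotI[OF piece_bounds(1)])
      then show False using i(3) by simp
    qed
    then show "p \<in> ?A - ?B" using cells_bound[OF i(2)] i(1) by simp
  qed
  moreover have "inj_on (scaled s) (cells n y - slots n y)" using scaled_inj[OF s_pos] by (auto simp: inj_on_def)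
  ultimately have "card (cells n y - slots n y) \<le> card (?A - ?B)" by (intro card_inj_on_le[of "scaled s"]) auto
  also have "\<dots> = card ?A - card ?B"
  proof (rule card_Diff_subset)
    show "?B \<subseteq> ?A" using rho_pos[of n] s_pos by auto
  qed simp
  finally show ?thesis by (simp add: card_cb r_def)
qed

text \<open>Each point of the lattice of mesh \<open>40 * \<rho> n\<close> in the piece has a slot
  within \<open>16 * \<rho> n + s\<close>. This is less than half the mesh, so different lattice
  points get different slots.\<close>

lemma many_slots: "nat (\<rho> (Suc n) div (40 * \<rho> n)) ^ CARD('d) \<le> card (slots n y)"
proof -
  define R where "R = r n div (40 * \<rho> n)"
  let ?B = "box_d 1 R :: (int^'d) set"
  have R: "40 * \<rho> n * R \<le> r n" unfolding R_def using rho_pos[of n] mult_div_mod_eq[of "40 * \<rho> n" "r n"]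
      pos_mod_sign[of "40 * \<rho> n" "r n"] by linarith
  have "\<exists>i. i \<in> slots n y \<and> nrm (scaled s i - (\<chi> l. 40 * \<rho> n * \<kappa>$l)) \<le> 16 * \<rho> n + int s" if \<kappa>: "\<kappa> \<in> ?B" for \<kappa>
  proof -
    let ?z = "(\<chi> l. 40 * \<rho> n * \<kappa>$l) :: int^'d"
    have "\<bar>?z$l\<bar> \<le> r n" for l
    proof -
      have k: "1 \<le> \<kappa>$l" "\<kappa>$l \<le> R" using \<kappa> by (auto simp: box_d_def)
      have "40 * \<rho> n * \<kappa>$l \<le> 40 * \<rho> n * R" "0 \<le> 40 * \<rho> n * \<kappa>$l"
        using k rho_pos[of n] by (auto intro: mult_left_mono)
      then show ?thesis using R by simp
    qed
    then have z: "nrm ?z \<le> r n" by (simp add: nrm_le_iff)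
    obtain i where i: "nrm (scaled s i - ?z) \<le> 16 * \<rho> n + int s" "\<And>j u. j < n \<Longrightarrow> near n y j u \<inter> cb (scaled s i) (3 * r j) = {}"
      using grid_clear_exists[OF y, of ?z n] by blast
    have "i \<in> slots n y"
    proof (rule slotI[OF piece_bounds(1)])
      show "nrm (scaled s i) \<le> 2 * r n - int s"
        using nrm_triangle_diff[of "scaled s i" 0 ?z] z i(1) rho_r64[of n] s_rho[of n] rho_pos[of n] by simp
      fix j u assume j: "j < n"
      have "cb (scaled s i) (int s) \<subseteq> cb (scaled s i) (3 * r j)" using s_r[of j] by auto
      then show "near n y j u \<inter> cb (scaled s i) (int s) = {}" using i(2)[OF j, of u] by blast
    qed
    then show ?thesis using i(1) by blast
  qed
  then obtain h where h: "\<And>\<kappa>. \<kappa> \<in> ?B \<Longrightarrow> h \<kappa> \<in> slots n y"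
    "\<And>\<kappa>. \<kappa> \<in> ?B \<Longrightarrow> nrm (scaled s (h \<kappa>) - (\<chi> l. 40 * \<rho> n * \<kappa>$l)) \<le> 16 * \<rho> n + int s" by metis
  have "inj_on h ?B"
  proof (rule inj_onI, rule ccontr)
    fix \<kappa> \<kappa>' :: "int^'d" assume k: "\<kappa> \<in> ?B" "\<kappa>' \<in> ?B" and eq: "h \<kappa> = h \<kappa>'" and ne: "\<kappa> \<noteq> \<kappa>'"
    obtain l where l: "\<kappa>$l \<noteq> \<kappa>'$l" using ne by (auto simp: vec_eq_iff)
    let ?z = "(\<chi> l. 40 * \<rho> n * \<kappa>$l) :: int^'d" and ?z' = "(\<chi> l. 40 * \<rho> n * \<kappa>'$l) :: int^'d"
    have "40 * \<rho> n * 1 \<le> 40 * \<rho> n * \<bar>\<kappa>$l - \<kappa>'$l\<bar>" using l rho_pos[of n] by (intro mult_left_mono) auto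
    also have "\<dots> = \<bar>(?z - ?z')$l\<bar>" using rho_pos[of n] by (simp add: abs_mult flip: right_diff_distrib)
    also have "\<dots> \<le> nrm (?z - ?z')" by (rule comp_le_nrm)
    also have "\<dots> \<le> 2 * (16 * \<rho> n + int s)"
      using nrm_triangle_diff[of ?z ?z' "scaled s (h \<kappa>)"] h(2)[OF k(1)] h(2)[OF k(2)] nrm_commute[of ?z "scaled s (h \<kappa>)"] eq by simp
    finally show False using s_rho[of n] rho_pos[of n] by simp
  qed
  then have "card ?B \<le> card (slots n y)" using h(1) finite_slots by (intro card_inj_on_le) auto
  moreover have "card ?B = nat R ^ CARD('d)" by (simp add: card_box_d)
  ultimately show ?thesis by (simp add: R_def r_def)
qed

text \<open>The cells exceed the data boxes in number by at most \<open>bd + ex\<close>. The excess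
  costs a factor \<open>b ^ (bd + ex)\<close>, at most \<open>2 ^ (b * (bd + ex))\<close> because
  \<open>b \<le> 2 ^ b\<close>. It is covered by the factor 2 that \<open>2 * b \<le> card Q\<close>
  grants for each data box, as there are at least \<open>b * (bd + ex)\<close> of these.\<close>

lemma capacity_ok:
  "card (PiE (cells n y) (\<lambda>_. lang Z (box_d 1 (int s)))) \<le> card (PiE (data n y) (\<lambda>_. Q))"
proof -
  let ?L = "lang Z (box_d 1 (int s))"
  define bd where "bd = nat (2 * (2 * \<rho> (Suc n) + 8 * \<rho> n + 3 * int s) + 1) ^ CARD('d)
        - nat (2 * (2 * \<rho> (Suc n) - int s) + 1) ^ CARD('d)"
  define ex where "ex = (6 * k + 1) ^ CARD('d) + 1 + n"
  have sl: "(b + 1) * (bd + ex) \<le> card (slots n y)"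
    using capacity[of n] many_slots by (simp add: bd_def ex_def)
  have carr: "card marker_array = (6 * k + 1) ^ CARD('d)"
  proof -
    have "nat (6 * int k - 0 + 1) = 6 * k + 1" by linarith
    then show ?thesis unfolding marker_array_def card_box_d by simp
  qed
  have fa: "finite marker_array" by (simp add: marker_array_def)
  have "card (slots n y) \<le> card (data n y \<union> (marker_array \<union> (\<lambda>j. level_slot j y) ` {..n}))"
    by (rule card_mono) (use finite_slots fa in \<open>auto simp: data_def\<close>)
  also have "\<dots> \<le> card (data n y) + (card marker_array + card ((\<lambda>j. level_slot j y) ` {..n}))"
    by (meson add_left_mono card_Un_le order_trans)
  also have "\<dots> \<le> card (data n y) + ex"
    using card_image_le[of "{..n}" "\<lambda>j. level_slot j y"] by (simp add: carr ex_def)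
  finally have dn: "card (slots n y) \<le> card (data n y) + ex" .
  have "card (cells n y) \<le> card (slots n y \<union> (cells n y - slots n y))"
    by (rule card_mono) (use finite_slots finite_cells in auto)
  also have "\<dots> \<le> card (slots n y) + bd"
    using card_Un_le[of "slots n y" "cells n y - slots n y"] cells_not_slots unfolding bd_def by linarith
  finally have cj: "card (cells n y) \<le> card (data n y) + (bd + ex)" using dn by simp
  have db: "b * (bd + ex) \<le> card (data n y)" using sl dn by (simp add: algebra_simps)
  have "card (PiE (cells n y) (\<lambda>_. ?L)) = card ?L ^ card (cells n y)" by (simp add: card_PiE finite_cells)
  also have "\<dots> \<le> b ^ card (cells n y)" using card_lang by (rule power_mono) simp
  also have "\<dots> \<le> b ^ (card (data n y) + (bd + ex))" using cj b_pos by (rule power_increasing)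
  also have "\<dots> = b ^ card (data n y) * b ^ (bd + ex)" by (simp add: power_add)
  also have "\<dots> \<le> b ^ card (data n y) * (2 ^ b) ^ (bd + ex)"
    by (intro mult_left_mono power_mono) (auto intro: less_imp_le)
  also have "\<dots> = b ^ card (data n y) * 2 ^ (b * (bd + ex))" by (simp add: power_mult)
  also have "\<dots> \<le> b ^ card (data n y) * 2 ^ card (data n y)"
    using db by (intro mult_left_mono power_increasing) auto
  also have "\<dots> = (2 * b) ^ card (data n y)" by (simp add: power_mult_distrib)
  also have "\<dots> \<le> card Q ^ card (data n y)" using card_Q by (rule power_mono) simp
  also have "\<dots> = card (PiE (data n y) (\<lambda>_. Q))"
    using finite_slots by (simp add: card_PiE data_def)
  finally show ?thesis .
qed

lemma coder:
  "coder (cells n y) (data n y) ` PiE (cells n y) (\<lambda>_. lang Z (box_d 1 (int s))) \<subseteq> PiE (data n y) (\<lambda>_. Q)"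
  "inj_on (coder (cells n y) (data n y)) (PiE (cells n y) (\<lambda>_. lang Z (box_d 1 (int s))))"
proof -
  let ?A = "PiE (cells n y) (\<lambda>_. lang Z (box_d 1 (int s)))" and ?B = "PiE (data n y) (\<lambda>_. Q)"
  have "finite ?A" by (intro finite_PiE finite_cells finite_lang) simp
  moreover have "finite ?B" by (intro finite_PiE fin_Q) (use finite_slots in \<open>simp add: data_def\<close>)
  ultimately have "\<exists>f. f ` ?A \<subseteq> ?B \<and> inj_on f ?A" using capacity_ok by (rule card_le_inj)
  then have "coder (cells n y) (data n y) ` ?A \<subseteq> ?B \<and> inj_on (coder (cells n y) (data n y)) ?A"
    unfolding coder_def by (rule someI_ex)
  then show "coder (cells n y) (data n y) ` ?A \<subseteq> ?B" "inj_on (coder (cells n y) (data n y)) ?A" by auto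
qed

lemma info_PiE: "info n y \<in> PiE (cells n y) (\<lambda>_. lang Z (box_d 1 (int s)))"
  using shift_Z[OF y] by (auto simp: info_def lang_def)

lemma assign_mem:
  assumes "i \<in> slots n y" shows "assign n y i \<in> insert w Q" "i \<notin> marker_array \<Longrightarrow> assign n y i \<in> Q"
proof -
  have "coder (cells n y) (data n y) (info n y) \<in> PiE (data n y) (\<lambda>_. Q)" using coder(1) info_PiE by blast
  then have "i \<in> data n y \<Longrightarrow> coder (cells n y) (data n y) (info n y) i \<in> Q" by auto
  moreover have "i \<notin> marker_array \<Longrightarrow> \<not> (\<exists>j\<le>n. i = level_slot j y) \<Longrightarrow> i \<in> data n y" using assms by (auto simp: data_def)
  ultimately show "i \<notin> marker_array \<Longrightarrow> assign n y i \<in> Q" using q01 by (auto simp: assign_def)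
  then show "assign n y i \<in> insert w Q" by (cases "i \<in> marker_array") (auto simp: assign_def)
qed

lemma near_if_sub_piece:
  assumes "j < n" "abs_piece y j u \<subseteq> piece n y"
  shows "near n y j u = abs_piece y j u"
proof (cases "abs_piece y j u = {}")
  case True then show ?thesis using near_subset[of n y j u] by auto
next
  case False
  then obtain p where p: "p \<in> abs_piece y j u" by auto
  then have "nrm (p - 0) \<le> 3 * r n" using assms(2) piece_bounds(3) by fastforce
  then show ?thesis using abs_piece_near[OF spread_all[OF y] assms(1) p] r_pos[of n] by simp
qed

end


section \<open>Choice of the patterns on the pieces\<close>

lemma pat_eq:
  "pat n y = (SOME c. c \<in> P (piece n y) \<and>
     (\<forall>j u. near n y j u \<noteq> {} \<longrightarrow> near n y j u \<subseteq> piece n y \<longrightarrow>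
       (\<forall>p\<in>near n y j u. c p = pat j (shift u y) (p - u))) \<and>
     (\<forall>i\<in>slots n y. \<forall>e\<in>box_d 1 (int a). c (scaled s i + e) = assign n y i e))"
proof -
  have "pat n y = pat_step n (\<lambda>j. if j < n then pat j else undefined) y"
    unfolding pat_def by (subst level_rec.simps) (rule refl)
  also have "\<dots> = pat_step n pat y"
    unfolding pat_step_def by (rule arg_cong[of _ _ Eps]) (auto simp: fun_eq_iff near_eq)
  finally show ?thesis unfolding pat_step_def .
qed

definition pat_ok :: "nat \<Rightarrow> (int^'d \<Rightarrow> 'b) \<Rightarrow> bool" where
  "pat_ok n y \<longleftrightarrow> pat n y \<in> P (piece n y) \<and>
     (\<forall>j<n. \<forall>u. abs_piece y j u \<subseteq> piece n y \<longrightarrow> (\<forall>p\<in>abs_piece y j u. pat n y p = pat j (shift u y) (p - u))) \<and>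
     (\<forall>i\<in>slots n y. \<forall>e\<in>box_d 1 (int a). pat n y (scaled s i + e) = assign n y i e)"

lemma P_ext:
  assumes "grid_union k C" "c \<in> P C" "p \<notin> C" shows "c p = undefined"
proof -
  have "c \<in> lang X C" using fam assms by (auto simp: family_of_patterns_def)
  then show ?thesis using assms(3) by (auto simp: lang_def)
qed

lemma P_translate: "grid_union k C \<Longrightarrow> c \<in> P C \<Longrightarrow> translate_pat \<alpha> c \<in> P (translate_set \<alpha> C)"
  using fam by (auto simp: family_of_patterns_def)

lemma grid_union_code_box: "grid_union k (box_d 1 (int a) :: (int^'d) set)"
proof -
  obtain h where "a = h * k" using k_a by (metis dvd_def mult.commute)
  then show ?thesis using grid_union_box[OF dim k_pos, of h] by simp
qed

lemma abs_piece_translate: "abs_piece y n v = translate_set v (piece n (shift v y))"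
  by (simp add: abs_piece_def translate_set_def add.commute)

lemma pat_sub:
  assumes ok: "pat_ok n (shift v y)" and j: "j < n" and sub: "abs_piece y j u \<subseteq> abs_piece y n v"
    and p: "p \<in> abs_piece y j u"
  shows "pat n (shift v y) (p - v) = pat j (shift u y) (p - u)"
proof -
  have s1: "abs_piece (shift v y) j (u - v) \<subseteq> piece n (shift v y)"
  proof
    fix x assume "x \<in> abs_piece (shift v y) j (u - v)"
    then have "v + x \<in> abs_piece y j u" by (simp add: mem_abs_piece_shift)
    then have "v + x \<in> abs_piece y n v" using sub by blast
    then show "x \<in> piece n (shift v y)" by (simp add: mem_abs_piece)
  qed
  have "p - v \<in> abs_piece (shift v y) j (u - v)" using p by (simp add: mem_abs_piece_shift)
  then have "pat n (shift v y) (p - v) = pat j (shift (u - v) (shift v y)) (p - v - (u - v))"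
    using ok j s1 unfolding pat_ok_def by blast
  then show ?thesis by (simp add: shift_shift)
qed

lemma slot_box_sub:
  assumes i: "i \<in> slots n y" and x: "x \<in> thick (int m) (translate_set (scaled s i) (box_d 1 (int a)))"
  shows "x \<in> piece n y"
proof -
  obtain z where z: "z \<in> translate_set (scaled s i) (box_d 1 (int a))" "nrm (x - z) \<le> int m"
    using x by (auto simp: mem_thick)
  then have "(z - scaled s i) + (x - z) \<in> box_d (1 - int m) (int a + int m)"
    by (intro box_d_plus) (simp_all add: translate_set_mem)
  then have "x - scaled s i \<in> box_d (1 - int m) (int a + int m)" by simp
  then have "scaled s i + (x - scaled s i) \<in> piece n y" using i unfolding slots_def by blast
  then show ?thesis by simp
qed

lemma slot_box_clear:
  assumes i: "i \<in> slots n y"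
  shows "thick (int m) (translate_set (scaled s i) (box_d 1 (int a))) \<inter> thick (int m) (near n y j u) = {}"
proof (rule ccontr)
  assume "\<not> ?thesis"
  then obtain x where "x \<in> thick (int m) (translate_set (scaled s i) (box_d 1 (int a)))" "x \<in> thick (int m) (near n y j u)"
    by blast
  then obtain z z' where z: "z - scaled s i \<in> box_d 1 (int a)" "nrm (x - z) \<le> int m"
      "z' \<in> near n y j u" "nrm (x - z') \<le> int m" by (auto simp: mem_thick translate_set_mem)
  have "nrm (z' - z) \<le> 2 * int m" using nrm_triangle_diff[of z' z x] z nrm_commute[of x z'] by simp
  then have "(z - scaled s i) + (z' - z) \<in> box_d (1 - 2 * int m) (int a + 2 * int m)" using z(1) by (intro box_d_plus)
  then have "z' - scaled s i \<in> box_d (1 - 2 * int m) (int a + 2 * int m)" by simp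
  then have "scaled s i + (z' - scaled s i) \<notin> near n y j u" using i unfolding slots_def by blast
  then show False using z(3) by simp
qed

lemma slot_box_disjoint:
  assumes "i \<noteq> i'"
  shows "thick (int m) (translate_set (scaled s i) (box_d 1 (int a))) \<inter>
    thick (int m) (translate_set (scaled s i') (box_d 1 (int a)) :: (int^'d) set) = {}"
proof (rule ccontr)
  assume "\<not> ?thesis"
  then obtain x where "x \<in> thick (int m) (translate_set (scaled s i) (box_d 1 (int a)))"
    "x \<in> thick (int m) (translate_set (scaled s i') (box_d 1 (int a)))" by blast
  then obtain z z' :: "int^'d" where z: "z - scaled s i \<in> box_d 1 (int a)" "nrm (x - z) \<le> int m"
      "z' - scaled s i' \<in> box_d 1 (int a)" "nrm (x - z') \<le> int m" by (auto simp: mem_thick translate_set_mem)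
  obtain l where l: "i$l \<noteq> i'$l" using assms by (auto simp: vec_eq_iff)
  have "\<bar>(x - z)$l\<bar> \<le> int m" "\<bar>(x - z')$l\<bar> \<le> int m" using z comp_le_nrm order_trans by blast+
  moreover have "1 \<le> (z - scaled s i)$l" "(z - scaled s i)$l \<le> int a" "1 \<le> (z' - scaled s i')$l" "(z' - scaled s i')$l \<le> int a"
    using z by (auto simp: box_d_def)
  ultimately have "\<bar>int s * i$l - int s * i'$l\<bar> < int s" using a_s by simp
  then have "int s * \<bar>i$l - i'$l\<bar> < int s * 1" by (simp add: abs_mult flip: right_diff_distrib)
  moreover have "int s * 1 \<le> int s * \<bar>i$l - i'$l\<bar>" by (rule mult_left_mono) (use l in auto)
  ultimately show False by linarith
qed

text \<open>Property F wants the prescribed sets to be far apart, but smaller pieces are nested.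
  Hence only the maximal ones, collected in \<open>Sub\<close>, and the code boxes are prescribed;
  the pattern on any other smaller piece is inherited from a maximal one containing it, by the
  induction hypothesis.\<close>

lemma pat_ok: "y \<in> Z \<Longrightarrow> anchor n y \<Longrightarrow> pat_ok n y"
proof (induction n arbitrary: y rule: less_induct)
  case (less n)
  note y = less.prems(1) and anc = less.prems(2)
  let ?C = "piece n y" and ?E = "near n y" and ?box = "box_d 1 (int a) :: (int^'d) set"
  define Sub where "Sub = {ju. ?E (fst ju) (snd ju) \<noteq> {} \<and> ?E (fst ju) (snd ju) \<subseteq> ?C \<and>
    \<not> (\<exists>j' u'. fst ju < j' \<and> ?E j' u' \<noteq> {} \<and> ?E j' u' \<subseteq> ?C \<and> ?E (fst ju) (snd ju) \<subseteq> ?E j' u')}"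
  have E: "j < n" "nrm u \<le> 10 * r n" "?E j u = abs_piece y j u" if "?E j u \<noteq> {}" for j u
    using that by (auto simp: near_eq split: if_splits)
  have finSub: "finite Sub"
  proof (rule finite_subset)
    show "Sub \<subseteq> {..<n} \<times> cb 0 (10 * r n)"
    proof
      fix ju assume "ju \<in> Sub"
      then have "?E (fst ju) (snd ju) \<noteq> {}" unfolding Sub_def by blast
      from E(1,2)[OF this] show "ju \<in> {..<n} \<times> cb 0 (10 * r n)" by (simp add: mem_Times_iff)
    qed
  qed simp
  define Cs where "Cs x = (case x of Inl ju \<Rightarrow> ?E (fst ju) (snd ju) | Inr i \<Rightarrow> translate_set (scaled s i) ?box)" for x
  define cs where "cs x = (case x of Inl ju \<Rightarrow> translate_pat (snd ju) (pat (fst ju) (shift (snd ju) y))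
     | Inr i \<Rightarrow> translate_pat (scaled s i) (assign n y i))" for x
  have anch: "anchor j (shift u y)" if "?E j u \<noteq> {}" for j u
    using E(3)[OF that] that abs_piece_ne_anchor[OF y, of j u] by simp
  have thE: "thick h (?E j u) \<subseteq> abs_piece y j' u'"
    if "?E j u \<noteq> {}" "j < j'" "abs_piece y j' u' \<noteq> {}" "thick (8 * K) (?E j u) \<inter> abs_piece y j' u' \<noteq> {}" "h \<le> 8 * K" for j u j' u' h
    using abs_piece_closed[OF y that(3,2), of u] that thick_mono[OF order_refl that(5), of "abs_piece y j u"] E(3)[OF that(1)] by auto
  have mK: "2 * int m \<le> 8 * K" "int m \<le> 8 * K" using a_s s_le_K by linarith+
  \<comment> \<open>Pieces of different levels whose margins meet are within
    \<open>2 * m \<le> 8 * K\<close> of each other and hence nested by closedness. Pieces of the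
    same level would be too close unless they coincide.\<close>
  have meetE: "j = j' \<and> u = u' \<or> j < j' \<and> ?E j u \<subseteq> ?E j' u' \<or> j' < j \<and> ?E j' u' \<subseteq> ?E j u"
    if ne: "?E j u \<noteq> {}" "?E j' u' \<noteq> {}" and meet: "thick (int m) (?E j u) \<inter> thick (int m) (?E j' u') \<noteq> {}" for j u j' u'
  proof -
    obtain x z z' where z: "z \<in> ?E j u" "nrm (x - z) \<le> int m" "z' \<in> ?E j' u'" "nrm (x - z') \<le> int m"
      using meet by (auto simp: mem_thick)
    have zz: "nrm (z - z') \<le> 2 * int m" using nrm_triangle_diff[of z z' x] z nrm_commute[of x z] by simp
    have lt: "?E j u \<subseteq> ?E j' u'" if "j < j'" "?E j u \<noteq> {}" "?E j' u' \<noteq> {}" "z \<in> ?E j u" "z' \<in> ?E j' u'" "nrm (z - z') \<le> 2 * int m"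
      for j u j' u' z z'
    proof -
      have "z' \<in> thick (8 * K) (?E j u)" unfolding mem_thick using that mK nrm_commute[of z' z] by (intro bexI[of _ z]) auto
      then have "thick 0 (?E j u) \<subseteq> abs_piece y j' u'"
        using that E(3)[OF that(3)] K_pos by (intro thE) auto
      then show ?thesis using subset_thick[of 0 "?E j u"] E(3)[OF that(3)] by auto
    qed
    consider "j < j'" | "j' < j" | "j = j'" by linarith
    then show ?thesis
    proof cases
      case 1 then show ?thesis using lt[OF 1 ne z(1,3) zz] by simp
    next
      case 2
      have "nrm (z' - z) \<le> 2 * int m" using zz by (simp add: nrm_commute)
      then show ?thesis using lt[OF 2 ne(2,1) z(3,1)] 2 by simp
    next
      case 3
      have "nrm (z - u) \<le> 3 * r j" "nrm (z' - u') \<le> 3 * r j"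
        using abs_piece_bounds(3)[OF y, of j u] abs_piece_bounds(3)[OF y, of j u'] E(3)[OF ne(1)] E(3)[OF ne(2)] ne z 3
        by (metis mem_cb subsetD)+
      then have "nrm (u - u') \<le> 6 * r j + 2 * int m"
        using nrm_triangle_diff[of u u' z] nrm_triangle_diff[of z u' z'] zz nrm_commute[of u z] by linarith
      moreover have "2 * int m \<le> r j" using a_s s_r[of j] by linarith
      ultimately have "nrm (u - u') < 98 * r j" using r_pos[of j] by linarith
      then show ?thesis using abs_piece_sep[OF y, of j u u'] E(3)[OF ne(1)] E(3)[OF ne(2)] ne 3 by force
    qed
  qed
  have "\<exists>c\<in>P ?C. \<forall>x\<in>Inl ` Sub \<union> Inr ` slots n y. restrict c (Cs x) = cs x"
  proof (rule property_F_extend[OF propF grid_union_piece[OF y anc]])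
    show "finite (Inl ` Sub \<union> Inr ` slots n y)" using finSub finite_slots[OF y anc] by simp
    fix x :: "(nat \<times> (int^'d)) + (int^'d)" assume x: "x \<in> Inl ` Sub \<union> Inr ` slots n y"
    show "grid_union k (Cs x)" and "cs x \<in> P (Cs x)" and "thick (int m) (Cs x) \<subseteq> ?C"
    proof -
      have "grid_union k (Cs x) \<and> cs x \<in> P (Cs x) \<and> thick (int m) (Cs x) \<subseteq> ?C"
      proof (cases x)
        case (Inl ju)
        obtain j u where ju: "ju = (j, u)" by fastforce
        have ne: "?E j u \<noteq> {}" "?E j u \<subseteq> ?C" using x Inl ju by (auto simp: Sub_def)
        have e: "Cs x = translate_set u (piece j (shift u y))"
          using E(3)[OF ne(1)] by (simp add: Cs_def Inl ju abs_piece_translate)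
        have g: "grid_union k (piece j (shift u y))" by (rule grid_union_piece[OF shift_Z[OF y] anch[OF ne(1)]])
        have "pat_ok j (shift u y)" by (rule less.IH[OF E(1)[OF ne(1)] shift_Z[OF y] anch[OF ne(1)]])
        then have "translate_pat u (pat j (shift u y)) \<in> P (translate_set u (piece j (shift u y)))"
          using P_translate[OF g] by (simp add: pat_ok_def)
        moreover have "cs x = translate_pat u (pat j (shift u y))" by (simp add: cs_def Inl ju)
        ultimately have csP: "cs x \<in> P (Cs x)" by (simp add: e)
        have "thick (int m) (?E j u) \<subseteq> abs_piece y n 0"
        proof (rule thE[OF ne(1) E(1)[OF ne(1)] _ _ mK(2)])
          show "abs_piece y n 0 \<noteq> {}" using ne by (simp add: abs_0[OF y anc]) blast
          have "?E j u \<subseteq> thick (8 * K) (?E j u)" by (rule subset_thick) (use K_pos in simp)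
          then show "thick (8 * K) (?E j u) \<inter> abs_piece y n 0 \<noteq> {}" using ne by (simp add: abs_0[OF y anc]) blast
        qed
        then have "thick (int m) (Cs x) \<subseteq> ?C" by (simp add: Cs_def Inl ju abs_0[OF y anc])
        moreover have "grid_union k (Cs x)" unfolding e by (rule grid_union_translate[OF g])
        ultimately show ?thesis using csP by simp
      next
        case (Inr i)
        have i: "i \<in> slots n y" using x Inr by auto
        have "assign n y i \<in> P ?box" using assign_mem(1)[OF y anc i] w_P Q_P by (auto elim: insertE)
        then have "cs x \<in> P (Cs x)" using P_translate[OF grid_union_code_box] by (simp add: Cs_def cs_def Inr)
        moreover have "thick (int m) (Cs x) \<subseteq> ?C" using slot_box_sub[OF i] by (auto simp: Cs_def Inr)
        moreover have "grid_union k (Cs x)" using grid_union_translate[OF grid_union_code_box] by (simp add: Cs_def Inr)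
        ultimately show ?thesis by simp
      qed
      then show "grid_union k (Cs x)" "cs x \<in> P (Cs x)" "thick (int m) (Cs x) \<subseteq> ?C" by auto
    qed
    fix x' assume x': "x' \<in> Inl ` Sub \<union> Inr ` slots n y" and xx: "x \<noteq> x'"
    show "thick (int m) (Cs x) \<inter> thick (int m) (Cs x') = {}"
    proof (cases x)
      case (Inl ju)
      show ?thesis
      proof (cases x')
        case (Inl ju')
        show ?thesis
        proof (rule ccontr)
          assume ne: "thick (int m) (Cs x) \<inter> thick (int m) (Cs x') \<noteq> {}"
          have s: "ju \<in> Sub" "ju' \<in> Sub" using x x' \<open>x = Inl ju\<close> Inl by auto
          have "fst ju = fst ju' \<and> snd ju = snd ju' \<or> fst ju < fst ju' \<and> ?E (fst ju) (snd ju) \<subseteq> ?E (fst ju') (snd ju') \<or>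
             fst ju' < fst ju \<and> ?E (fst ju') (snd ju') \<subseteq> ?E (fst ju) (snd ju)"
            by (rule meetE) (use s ne \<open>x = Inl ju\<close> Inl in \<open>auto simp: Sub_def Cs_def\<close>)
          moreover have False if "ju \<in> Sub" "ju' \<in> Sub" "fst ju < fst ju'" "?E (fst ju) (snd ju) \<subseteq> ?E (fst ju') (snd ju')" for ju ju'
            using that unfolding Sub_def mem_Collect_eq by blast
          ultimately show False using s xx \<open>x = Inl ju\<close> Inl prod_eqI by metis
        qed
      next
        case (Inr i)
        then have "i \<in> slots n y" using x' by auto
        then show ?thesis using slot_box_clear[of i n y] \<open>x = Inl ju\<close> Inr by (simp add: Cs_def Int_commute)
      qed
    next
      case (Inr i)
      then have i: "i \<in> slots n y" using x by auto
      show ?thesis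
      proof (cases x')
        case (Inl ju) then show ?thesis using slot_box_clear[OF i] \<open>x = Inr i\<close> by (simp add: Cs_def)
      next
        case (Inr i') then show ?thesis using slot_box_disjoint[of i i'] xx \<open>x = Inr i\<close> by (simp add: Cs_def)
      qed
    qed
  qed
  then obtain c where c: "c \<in> P ?C" "\<And>x. x \<in> Inl ` Sub \<union> Inr ` slots n y \<Longrightarrow> restrict c (Cs x) = cs x" by blast
  have cval: "c p = cs x p" if "x \<in> Inl ` Sub \<union> Inr ` slots n y" "p \<in> Cs x" for x p
    using fun_cong[OF c(2)[OF that(1)], of p] that(2) by simp
  have c1: "c p = pat j (shift u y) (p - u)" if ne: "?E j u \<noteq> {}" and sub: "?E j u \<subseteq> ?C" and p: "p \<in> ?E j u" for j u p
  proof -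
    \<comment> \<open>Among the visible pieces between \<open>?E j u\<close> and \<open>?C\<close>,
      one of the highest level belongs to \<open>Sub\<close>.\<close>
    define Js where "Js = {j'. \<exists>u'. ?E j' u' \<noteq> {} \<and> ?E j' u' \<subseteq> ?C \<and> ?E j u \<subseteq> ?E j' u'}"
    have finJ: "finite Js" by (rule finite_subset[of _ "{..<n}"]) (use E(1) in \<open>auto simp: Js_def\<close>)
    have "j \<in> Js" using ne sub by (auto simp: Js_def)
    then have "Max Js \<in> Js" using finJ by (intro Max_in) auto
    then obtain u' where u': "?E (Max Js) u' \<noteq> {}" "?E (Max Js) u' \<subseteq> ?C" "?E j u \<subseteq> ?E (Max Js) u'"
      unfolding Js_def by blast
    have jM: "j \<le> Max Js" using \<open>j \<in> Js\<close> finJ by simp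
    have "(Max Js, u') \<in> Sub"
    proof -
      have "\<not> (\<exists>j'' u''. Max Js < j'' \<and> ?E j'' u'' \<noteq> {} \<and> ?E j'' u'' \<subseteq> ?C \<and> ?E (Max Js) u' \<subseteq> ?E j'' u'')"
      proof
        assume "\<exists>j'' u''. Max Js < j'' \<and> ?E j'' u'' \<noteq> {} \<and> ?E j'' u'' \<subseteq> ?C \<and> ?E (Max Js) u' \<subseteq> ?E j'' u''"
        then obtain j'' u'' where j'': "Max Js < j''" "?E j'' u'' \<noteq> {}" "?E j'' u'' \<subseteq> ?C" "?E (Max Js) u' \<subseteq> ?E j'' u''" by blast
        then have "j'' \<in> Js" using u'(3) unfolding Js_def by blast
        then show False using j''(1) finJ by (simp add: leD)
      qed
      then show ?thesis using u' by (simp add: Sub_def)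
    qed
    then have "c p = cs (Inl (Max Js, u')) p" using p u'(3) by (intro cval) (auto simp: Cs_def)
    then have cp: "c p = pat (Max Js) (shift u' y) (p - u')" by (simp add: cs_def translate_pat_def)
    show ?thesis
    proof (cases "j = Max Js")
      case True
      have "p \<in> abs_piece y j u" "p \<in> abs_piece y j u'" using p u' E(3)[OF ne] E(3)[OF u'(1)] True by auto
      then have "u = u'" by (rule abs_piece_unique[OF y])
      then show ?thesis using cp True by simp
    next
      case False
      then have lt: "j < Max Js" using jM by simp
      have ok: "pat_ok (Max Js) (shift u' y)" by (rule less.IH[OF E(1)[OF u'(1)] shift_Z[OF y] anch[OF u'(1)]])
      show ?thesis
        unfolding cp by (rule pat_sub[OF ok lt]) (use p u' E(3)[OF ne] E(3)[OF u'(1)] in auto)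
    qed
  qed
  have c2: "c (scaled s i + e) = assign n y i e" if "i \<in> slots n y" "e \<in> ?box" for i e
  proof -
    have "c (scaled s i + e) = cs (Inr i) (scaled s i + e)" using that by (intro cval) (auto simp: Cs_def translate_set_mem)
    then show ?thesis by (simp add: cs_def translate_pat_def)
  qed
  have "pat n y \<in> P ?C \<and>
     (\<forall>j u. ?E j u \<noteq> {} \<longrightarrow> ?E j u \<subseteq> ?C \<longrightarrow> (\<forall>p\<in>?E j u. pat n y p = pat j (shift u y) (p - u))) \<and>
     (\<forall>i\<in>slots n y. \<forall>e\<in>?box. pat n y (scaled s i + e) = assign n y i e)"
    unfolding pat_eq[of n y] by (rule someI[of _ c]) (use c(1) c1 c2 in blast)
  moreover have "?E j u = abs_piece y j u" if "j < n" "abs_piece y j u \<subseteq> ?C" for j u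
    by (rule near_if_sub_piece[OF y anc that])
  ultimately show ?case unfolding pat_ok_def by (metis empty_iff)
qed

text \<open>Pieces with a common point are equal or nested, and the pattern of the larger one
  extends that of the smaller.\<close>

lemma pat_consistent:
  assumes y: "y \<in> Z" and p: "p \<in> abs_piece y n v" "p \<in> abs_piece y n' v'"
  shows "pat n (shift v y) (p - v) = pat n' (shift v' y) (p - v')"
proof -
  have *: "pat n (shift v y) (p - v) = pat n' (shift v' y) (p - v')"
    if lt: "n < n'" and p: "p \<in> abs_piece y n v" "p \<in> abs_piece y n' v'" for n v n' v'
  proof -
    have ne: "abs_piece y n' v' \<noteq> {}" using p by auto
    have sub: "abs_piece y n v \<subseteq> thick (8 * K) (abs_piece y n v)" by (rule subset_thick) (use K_pos in simp)
    then have "thick (8 * K) (abs_piece y n v) \<subseteq> abs_piece y n' v'"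
      using p by (intro abs_piece_closed[OF y ne lt]) blast
    then have "abs_piece y n v \<subseteq> abs_piece y n' v'" using sub by blast
    moreover have "pat_ok n' (shift v' y)"
      by (rule pat_ok[OF shift_Z[OF y]]) (use ne abs_piece_ne_anchor[OF y] in blast)
    ultimately show ?thesis using pat_sub[OF _ lt _ p(1)] by simp
  qed
  consider "n < n'" | "n' < n" | "n = n'" by linarith
  then show ?thesis
  proof cases
    case 1 then show ?thesis using * p by blast
  next
    case 2 then show ?thesis using *[OF 2 p(2,1)] by simp
  next
    case 3 then show ?thesis using abs_piece_unique[OF y] p by blast
  qed
qed

section \<open>The map into \<open>X\<close>\<close>

definition origin_symbol :: "(int^'d \<Rightarrow> 'b) \<Rightarrow> 'a" where
  "origin_symbol y = (let nv = SOME nv. 0 \<in> abs_piece y (fst nv) (snd nv)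
     in pat (fst nv) (shift (snd nv) y) (- snd nv))"

text \<open>Reading every symbol as the origin symbol of a shifted point makes equivariance
  immediate. That one piece may serve for many positions is then a matter of
  \<open>pat_consistent\<close>.\<close>

definition phi :: "(int^'d \<Rightarrow> 'b) \<Rightarrow> int^'d \<Rightarrow> 'a" where
  "phi y p = origin_symbol (shift p y)"

lemma phi_shift: "phi (shift \<gamma> y) = shift \<gamma> (phi y)"
  by (simp add: phi_def fun_eq_iff shift_shift shift_apply)

lemma origin_symbol_eq:
  assumes y: "y \<in> Z" and 0: "0 \<in> abs_piece y n v"
  shows "origin_symbol y = pat n (shift v y) (- v)"
proof -
  define nv where "nv = (SOME nv. 0 \<in> abs_piece y (fst nv) (snd nv))"
  have "0 \<in> abs_piece y (fst nv) (snd nv)" unfolding nv_def by (rule someI[of _ "(n, v)"]) (simp add: 0)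
  from pat_consistent[OF y this 0] show ?thesis by (simp add: origin_symbol_def nv_def[symmetric])
qed

lemma phi_eq:
  assumes y: "y \<in> Z" and p: "p \<in> abs_piece y n v"
  shows "phi y p = pat n (shift v y) (p - v)"
  using origin_symbol_eq[OF shift_Z[OF y, of p], of n "v - p"] p
  by (simp add: phi_def mem_abs_piece_shift shift_shift)

lemma piece_cover: "y \<in> Z \<Longrightarrow> \<exists>n v. p \<in> abs_piece y n v"
  using abs_piece_cover[of y 0 p 0] by force

text \<open>Choose pieces of strictly increasing level that contain larger and larger cubes around
  the origin. Sharing the origin, they are nested, and the second clause of property F applies to
  them.\<close>

lemma phi_in_X:
  assumes y: "y \<in> Z" shows "phi y \<in> X"
proof -
  have "\<exists>f. \<forall>t. cb 0 (int t) \<subseteq> abs_piece y (fst (f t)) (snd (f t)) \<and> fst (f t) < fst (f (Suc t))"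
  proof (rule dependent_nat_choice)
    obtain n v where "cb 0 (int 0) \<subseteq> abs_piece y n v" using abs_piece_cover[OF y, of 0 0 "int 0"] by blast
    then show "\<exists>x. cb 0 (int 0) \<subseteq> abs_piece y (fst x) (snd x)" by (intro exI[of _ "(n, v)"]) simp
    fix x and t :: nat
    obtain n v where "n \<ge> Suc (fst x)" "cb 0 (int (Suc t)) \<subseteq> abs_piece y n v"
      using abs_piece_cover[OF y, of "Suc (fst x)" 0 "int (Suc t)"] by blast
    then show "\<exists>x'. cb 0 (int (Suc t)) \<subseteq> abs_piece y (fst x') (snd x') \<and> fst x < fst x'"
      by (intro exI[of _ "(n, v)"]) simp
  qed
  then obtain f where f: "\<And>t. cb 0 (int t) \<subseteq> abs_piece y (fst (f t)) (snd (f t))" "\<And>t. fst (f t) < fst (f (Suc t))" by blast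
  define Bs where "Bs t = abs_piece y (fst (f t)) (snd (f t))" for t :: nat
  have 0: "0 \<in> Bs t" for t using f(1)[of t] by (auto simp: Bs_def)
  have "grid_union k (Bs t)" for t
  proof -
    have "anchor (fst (f t)) (shift (snd (f t)) y)" using 0[of t] abs_piece_ne_anchor[OF y] by (auto simp: Bs_def)
    then show ?thesis unfolding Bs_def abs_piece_translate
      by (intro grid_union_translate grid_union_piece shift_Z[OF y])
  qed
  moreover have "incseq Bs"
  proof (rule incseq_SucI)
    fix t
    have sub: "Bs t \<subseteq> thick (8 * K) (Bs t)" by (rule subset_thick) (use K_pos in simp)
    have "thick (8 * K) (Bs t) \<subseteq> Bs (Suc t)" unfolding Bs_def
      by (rule abs_piece_closed[OF y _ f(2)]) (use 0[of t] 0[of "Suc t"] sub in \<open>auto simp: Bs_def\<close>)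
    then show "Bs t \<subseteq> Bs (Suc t)" using sub by blast
  qed
  moreover have "(\<Union>t. Bs t) = UNIV"
  proof -
    have "p \<in> Bs (nat (nrm p))" for p using f(1)[of "nat (nrm p)"] by (auto simp: Bs_def)
    then show ?thesis by blast
  qed
  moreover have "restrict (phi y) (Bs t) \<in> P (Bs t)" for t
  proof -
    let ?n = "fst (f t)" and ?v = "snd (f t)"
    have anc: "anchor ?n (shift ?v y)" using 0[of t] abs_piece_ne_anchor[OF y] by (auto simp: Bs_def)
    note ok = pat_ok[OF shift_Z[OF y] anc]
    have g: "grid_union k (piece ?n (shift ?v y))" by (rule grid_union_piece[OF shift_Z[OF y] anc])
    have pp: "pat ?n (shift ?v y) \<in> P (piece ?n (shift ?v y))" using ok by (simp add: pat_ok_def)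
    have "restrict (phi y) (Bs t) = translate_pat ?v (pat ?n (shift ?v y))"
    proof
      fix p
      show "restrict (phi y) (Bs t) p = translate_pat ?v (pat ?n (shift ?v y)) p"
      proof (cases "p \<in> Bs t")
        case True then show ?thesis using phi_eq[OF y, of p ?n ?v] by (simp add: Bs_def translate_pat_def)
      next
        case False
        then have "p - ?v \<notin> piece ?n (shift ?v y)" by (simp add: Bs_def mem_abs_piece)
        then show ?thesis using P_ext[OF g pp] False by (simp add: translate_pat_def)
      qed
    qed
    then show ?thesis using P_translate[OF g pp, of ?v] by (simp add: Bs_def abs_piece_translate)
  qed
  ultimately show ?thesis using propF unfolding property_F_def by blast
qed

section \<open>Borel measurability of the map\<close>

lemma borel_countable_piece_near: "borel_countable (\<lambda>y. (piece n y, near n y))" by (rule borel_countable_pair[OF borel_countable_piece borel_countable_near'])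

lemma borel_countable_slots: "borel_countable (slots n)" by (rule borel_countable_det[OF borel_countable_piece_near[of n]]) (simp add: slots_def)

lemma borel_countable_cells: "borel_countable (cells n)" by (rule borel_countable_det[OF borel_countable_piece_near[of n]]) (simp add: cells_def)

lemma borel_countable_beta: "borel_countable (level_slot j)" by (rule borel_countable_det[OF borel_countable_near'[of j]]) (simp add: level_slot_def)

lemma borel_countable_betas: "borel_countable (\<lambda>y. restrict (\<lambda>j. level_slot j y) {..n})" by (rule borel_countable_window[OF _ borel_countable_beta]) simp

lemma betas_eq: "restrict (\<lambda>j. level_slot j y) {..n} = restrict (\<lambda>j. level_slot j y') {..n} \<Longrightarrow> j \<le> n \<Longrightarrow> level_slot j y = level_slot j y'"
  by (drule fun_cong[of _ _ j]) simp

lemma borel_countable_data: "borel_countable (data n)"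
proof (rule borel_countable_det[OF borel_countable_pair[OF borel_countable_slots[of n] borel_countable_betas[of n]]])
  fix y y' assume eq: "(slots n y, restrict (\<lambda>j. level_slot j y) {..n}) = (slots n y', restrict (\<lambda>j. level_slot j y') {..n})"
  then have "level_slot j y = level_slot j y'" if "j \<le> n" for j using betas_eq that by blast
  then have "(\<lambda>j. level_slot j y) ` {..n} = (\<lambda>j. level_slot j y') ` {..n}" by (intro image_cong) auto
  then show "data n y = data n y'" using eq by (simp add: data_def)
qed

text \<open>The cells lie in a cube whose radius depends only on \<open>n\<close>, so the recorded
  windows are read off from finitely many coordinates.\<close>

lemma borel_countable_info: "borel_countable (info n)"
proof (rule borel_countable_det[OF borel_countable_pair[OF borel_countable_cells[of n] borel_countable_local[of "2 * r n + 8 * \<rho> n + 4 * int s"]]])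
  let ?R = "2 * r n + 8 * \<rho> n + 4 * int s"
  fix y y' assume y: "y \<in> Z" and eq: "(cells n y, restrict y (cb 0 ?R)) = (cells n y', restrict y' (cb 0 ?R))"
  have "restrict (shift (scaled s i) y) (box_d 1 (int s)) = restrict (shift (scaled s i) y') (box_d 1 (int s))" if i: "i \<in> cells n y" for i
  proof (rule restrict_ext)
    fix e :: "int^'d" assume e: "e \<in> box_d 1 (int s)"
    have "anchor n y"
    proof (rule piece_nonempty_anchor, rule notI)
      assume "piece n y = {}"
      then show False using i by (simp add: cells_def)
    qed
    then have "nrm (scaled s i) \<le> 2 * r n + 8 * \<rho> n + 3 * int s" using cells_bound[OF y] i by blast
    moreover have "nrm e \<le> int s" by (rule box_d_nrm[OF e]) auto
    ultimately have "scaled s i + e \<in> cb 0 ?R" using nrm_triangle[of "scaled s i" e] by simp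
    then have "y (scaled s i + e) = y' (scaled s i + e)" using eq by (metis prod.inject restrict_apply')
    then show "shift (scaled s i) y e = shift (scaled s i) y' e" by (simp add: shift_apply)
  qed
  then have "restrict (\<lambda>i. restrict (shift (scaled s i) y) (box_d 1 (int s))) (cells n y) =
      restrict (\<lambda>i. restrict (shift (scaled s i) y') (box_d 1 (int s))) (cells n y)" by (rule restrict_ext)
  then show "info n y = info n y'" using eq by (simp add: info_def)
qed

lemma borel_countable_assign: "borel_countable (assign n)"
proof (rule borel_countable_det[OF borel_countable_pair[OF borel_countable_betas[of n] borel_countable_pair[OF borel_countable_cells[of n] borel_countable_pair[OF borel_countable_data[of n] borel_countable_info[of n]]]]])
  fix y y' assume eq: "(restrict (\<lambda>j. level_slot j y) {..n}, cells n y, data n y, info n y) =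
    (restrict (\<lambda>j. level_slot j y') {..n}, cells n y', data n y', info n y')"
  then have b: "level_slot j y = level_slot j y'" if "j \<le> n" for j using betas_eq that by blast
  then have ex: "(\<exists>j\<le>n. i = level_slot j y) = (\<exists>j\<le>n. i = level_slot j y')" for i by metis
  have "info n y = info n y'" "cells n y = cells n y'" "data n y = data n y'" using eq by simp_all
  then show "assign n y = assign n y'" unfolding assign_def[abs_def] ex b[OF order_refl] by (simp only:)
qed

lemma borel_countable_pat: "borel_countable (pat n)"
proof (induction n rule: less_induct)
  case (less n)
  let ?I = "{..<n} \<times> cb 0 (10 * r n)"
  have w: "borel_countable (\<lambda>y. restrict (\<lambda>i. pat (fst i) (shift (snd i) y)) ?I)"
    by (rule borel_countable_window) (use less in \<open>auto intro: borel_countable_shift\<close>)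
  show ?case
  proof (rule borel_countable_det[OF borel_countable_pair[OF borel_countable_piece_near[of n] borel_countable_pair[OF borel_countable_slots[of n] borel_countable_pair[OF borel_countable_assign[of n] w]]]])
    fix y y' assume eq: "((piece n y, near n y), slots n y, assign n y, restrict (\<lambda>i. pat (fst i) (shift (snd i) y)) ?I) =
      ((piece n y', near n y'), slots n y', assign n y', restrict (\<lambda>i. pat (fst i) (shift (snd i) y')) ?I)"
    have "pat j (shift u y) = pat j (shift u y')" if "near n y' j u \<noteq> {}" for j u
    proof -
      have "restrict (\<lambda>i. pat (fst i) (shift (snd i) y)) ?I = restrict (\<lambda>i. pat (fst i) (shift (snd i) y')) ?I"
        using eq by simp
      from fun_cong[OF this, of "(j, u)"] show ?thesis using that by (simp add: near_eq split: if_splits)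
    qed
    then show "pat n y = pat n y'"
      unfolding pat_eq[of n] using eq by (intro arg_cong[of _ _ Eps]) (auto simp: fun_eq_iff)
  qed
qed

lemma phi_measurable: "phi \<in> measurable N (borel_of config_topology)"
proof (rule measurable_config)
  fix p and \<alpha> :: 'a
  have "borel_pred (\<lambda>y. origin_symbol y = \<alpha>)"
  proof -
    have "borel_pred (\<lambda>y. - v \<in> piece n (shift v y) \<and> pat n (shift v y) (- v) = \<alpha>)" for n v
      using borel_pred_cm[OF borel_countable_shift[OF borel_countable_pair[OF borel_countable_piece[of n] borel_countable_pat[of n]], of v], of "\<lambda>z. - v \<in> fst z \<and> snd z (- v) = \<alpha>"]
      by simp
    then have "borel_pred (\<lambda>y. \<exists>n v. - v \<in> piece n (shift v y) \<and> pat n (shift v y) (- v) = \<alpha>)" by (intro borel_pred_ex)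
    moreover have "(\<exists>n v. - v \<in> piece n (shift v y) \<and> pat n (shift v y) (- v) = \<alpha>) \<longleftrightarrow> origin_symbol y = \<alpha>"
      if y: "y \<in> Z" for y
    proof
      assume "\<exists>n v. - v \<in> piece n (shift v y) \<and> pat n (shift v y) (- v) = \<alpha>"
      then obtain n v where "- v \<in> piece n (shift v y)" "pat n (shift v y) (- v) = \<alpha>" by blast
      then show "origin_symbol y = \<alpha>" using origin_symbol_eq[OF y, of n v] by (simp add: mem_abs_piece)
    next
      assume o: "origin_symbol y = \<alpha>"
      obtain n v where "0 \<in> abs_piece y n v" using piece_cover[OF y] by blast
      then show "\<exists>n v. - v \<in> piece n (shift v y) \<and> pat n (shift v y) (- v) = \<alpha>"
        using origin_symbol_eq[OF y, of n v] o by (intro exI[of _ n] exI[of _ v]) (simp add: mem_abs_piece)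
    qed
    ultimately show ?thesis by (subst borel_pred_cong[where Q = "\<lambda>y. \<exists>n v. - v \<in> piece n (shift v y) \<and> pat n (shift v y) (- v) = \<alpha>"]) simp_all
  qed
  from borel_pred_shift[OF this, of p] show "{y \<in> space N. phi y p = \<alpha>} \<in> sets N"
    by (simp add: borel_pred_def phi_def)
qed


section \<open>Recognising the anchors in the image\<close>

lemma phi_slot:
  assumes y: "y \<in> Z" and ne: "abs_piece y n v \<noteq> {}" and i: "i \<in> slots n (shift v y)" and e: "e \<in> box_d 1 (int a)"
  shows "phi y (v + scaled s i + e) = assign n (shift v y) i e"
proof -
  have anc: "anchor n (shift v y)" using ne abs_piece_ne_anchor[OF y] by simp
  note ok = pat_ok[OF shift_Z[OF y] anc]
  have "e \<in> box_d (1 - int m) (int a + int m)" using e box_d_mono[of "1 - int m" 1 "int a" "int a + int m"] by auto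
  then have "scaled s i + e \<in> piece n (shift v y)" using i unfolding slots_def by blast
  then have "v + scaled s i + e \<in> abs_piece y n v" by (simp add: mem_abs_piece add.assoc)
  then have "phi y (v + scaled s i + e) = pat n (shift v y) (scaled s i + e)" using phi_eq[OF y, of _ n v] by (simp add: add.assoc)
  then show ?thesis using ok i e by (simp add: pat_ok_def)
qed

lemma assign_ext: "c \<in> insert w Q \<Longrightarrow> p \<notin> box_d 1 (int a) \<Longrightarrow> c p = undefined"
  using P_ext[OF grid_union_code_box, of c p] w_P Q_P by auto

lemma word_eqI:
  assumes "c \<in> insert w Q" "c' \<in> insert w Q" "\<And>e. e \<in> box_d 1 (int a) \<Longrightarrow> c e = c' e"
  shows "c = c'"
proof
  fix e show "c e = c' e"
    using assms(3)[of e] assign_ext[OF assms(1), of e] assign_ext[OF assms(2), of e] by (cases "e \<in> box_d 1 (int a)") auto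
qed

text \<open>A box with margins has extent \<open>a + 4 * m < 2 * s\<close>, and rounding to the
  lattice based at \<open>v\<close> costs less than \<open>s\<close>, so it fits into a cell of side
  \<open>K \<ge> 3 * s\<close>. The grid of cells has its own base \<open>v0\<close>, since it may
  be the grid of a smaller piece.\<close>

lemma slot_in_cell:
  assumes cell: "\<And>x. same_cell K (p - v0) (x - v0) \<Longrightarrow> x \<in> abs_piece y n v"
    and cl: "\<And>j u x. j < n \<Longrightarrow> same_cell K (p - v0) (x - v0) \<Longrightarrow> x \<notin> abs_piece y j u"
  shows "\<exists>i. i \<in> slots n (shift v y) \<and> nrm (v + scaled s i - p) \<le> K"
proof -
  define lo where "lo = ((\<chi> l. v0$l + K * ((p$l - v0$l - 1) div K)) :: int^'d)"
  have K0: "0 < K" using K_pos by simp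
  have inB: "same_cell K (p - v0) (x - v0)" if "\<And>l. lo$l + 1 \<le> x$l \<and> x$l \<le> lo$l + K" for x
  proof -
    have "(x$l - v0$l - 1) div K = (p$l - v0$l - 1) div K" for l
      unfolding div_eq_iff_bounds[OF K0] using that[of l] by (simp add: lo_def)
    then show ?thesis by (simp add: same_cell_def)
  qed
  define i where "i = ((\<chi> l. (lo$l + 2 * int m - v$l + int s - 1) div int s) :: int^'d)"
  have i1: "lo$l + 2 * int m - v$l \<le> int s * i$l" "int s * i$l \<le> lo$l + 2 * int m - v$l + int s - 1" for l
  proof -
    have "0 < int s" using s_pos by simp
    from div_eq_iff_bounds[OF this, of "lo$l + 2 * int m - v$l + int s - 1" "i$l"]
    show "lo$l + 2 * int m - v$l \<le> int s * i$l" "int s * i$l \<le> lo$l + 2 * int m - v$l + int s - 1"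
      by (auto simp: i_def)
  qed
  have big: "same_cell K (p - v0) (v + scaled s i + e - v0)" if e: "e \<in> box_d (1 - 2 * int m) (int a + 2 * int m)" for e
  proof (rule inB)
    fix l
    have "1 - 2 * int m \<le> e$l" "e$l \<le> int a + 2 * int m" using e by (auto simp: box_d_def)
    then show "lo$l + 1 \<le> (v + scaled s i + e)$l \<and> (v + scaled s i + e)$l \<le> lo$l + K"
      using i1[of l] s_le_K a_s by simp
  qed
  have "i \<in> slots n (shift v y)" unfolding slots_def
  proof (intro CollectI conjI ballI allI)
    fix e :: "int^'d" assume "e \<in> box_d (1 - int m) (int a + int m)"
    then have "e \<in> box_d (1 - 2 * int m) (int a + 2 * int m)"
      using box_d_mono[of "1 - 2 * int m" "1 - int m" "int a + int m" "int a + 2 * int m"] by auto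
    then have "v + scaled s i + e \<in> abs_piece y n v" using cell big by blast
    then show "scaled s i + e \<in> piece n (shift v y)" by (simp add: mem_abs_piece add.assoc)
  next
    fix j u and e :: "int^'d" assume e: "e \<in> box_d (1 - 2 * int m) (int a + 2 * int m)"
    show "scaled s i + e \<notin> near n (shift v y) j u"
    proof
      assume ne: "scaled s i + e \<in> near n (shift v y) j u"
      then have "j < n" using near_empty_ge[of n j "shift v y" u] by (cases "j < n") auto
      moreover have "v + (scaled s i + e) \<in> abs_piece y j (v + u)"
        using ne near_subset[of n "shift v y" j u] by (auto simp: mem_abs_piece_shift)
      ultimately show False using cl[OF _ big[OF e], of j "v + u"] by (simp add: add.assoc)
    qed
  qed
  moreover have "nrm (v + scaled s i - p) \<le> K"
  proof -
    have "\<bar>(v + scaled s i - p)$l\<bar> \<le> K" for l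
    proof -
      have "K * ((p$l - v0$l - 1) div K) \<le> p$l - v0$l - 1 \<and> p$l - v0$l - 1 < K * ((p$l - v0$l - 1) div K) + K"
        using div_eq_iff_bounds[OF K0, of "p$l - v0$l - 1" "(p$l - v0$l - 1) div K"] by simp
      then have "lo$l + 1 \<le> p$l" "p$l \<le> lo$l + K" by (auto simp: lo_def)
      then show ?thesis using i1[of l] s_le_K a_s by simp
    qed
    then show ?thesis by (simp add: nrm_le_iff)
  qed
  ultimately show ?thesis by blast
qed

text \<open>Take the piece of least level containing \<open>p\<close>. If its cell at
  \<open>p\<close> meets no smaller piece, that cell holds a slot. Otherwise it meets some smaller
  piece \<open>?D\<close>, and the cell at \<open>p\<close> in the grid of \<open>?D\<close> is
  used: by saturation it misses \<open>?D\<close>, it lies in the margin of \<open>?D\<close>, and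
  closedness, separation and the choice of the level keep every other smaller piece away from
  it.\<close>

lemma slot_near:
  assumes y: "y \<in> Z"
  shows "\<exists>n v i. abs_piece y n v \<noteq> {} \<and> i \<in> slots n (shift v y) \<and> nrm (v + scaled s i - p) \<le> K"
proof -
  have K0: "0 < K" using K_pos by simp
  define n where "n = (LEAST n. \<exists>v. p \<in> abs_piece y n v)"
  have "\<exists>v. p \<in> abs_piece y n v" unfolding n_def using piece_cover[OF y, of p] by (rule LeastI_ex)
  then obtain v where v: "p \<in> abs_piece y n v" by blast
  have min: "p \<notin> abs_piece y j u" if "j < n" for j u
    using not_less_Least[of j "\<lambda>n. \<exists>v. p \<in> abs_piece y n v"] that unfolding n_def by blast
  have ne: "abs_piece y n v \<noteq> {}" using v by auto
  have cell: "x \<in> abs_piece y n v" if "same_cell K (p - v) (x - v)" for x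
    using abs_piece_saturated[OF y v that] .
  show ?thesis
  proof (cases "\<forall>j u x. j < n \<longrightarrow> same_cell K (p - v) (x - v) \<longrightarrow> x \<notin> abs_piece y j u")
    case True
    then show ?thesis using slot_in_cell[of p v y n v] cell ne by blast
  next
    case False
    then obtain j u x where j: "j < n" and x: "same_cell K (p - v) (x - v)" "x \<in> abs_piece y j u" by blast
    let ?D = "abs_piece y j u"
    have neD: "?D \<noteq> {}" using x by auto
    have px: "nrm (p - x) < K" using same_cell_nrm[OF K0 x(1)] by simp
    have Dsub: "?D \<subseteq> thick (8 * K) ?D" by (rule subset_thick) (use K0 in simp)
    have "thick (8 * K) ?D \<inter> abs_piece y n v \<noteq> {}" using Dsub x(2) cell[OF x(1)] by blast
    then have DC: "thick (8 * K) ?D \<subseteq> abs_piece y n v" by (rule abs_piece_closed[OF y ne j])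
    have cellD: "z \<in> thick (8 * K) ?D" "z \<notin> ?D" "nrm (z - x) < 2 * K" if z: "same_cell K (p - u) (z - u)" for z
    proof -
      have "nrm (p - z) < K" using same_cell_nrm[OF K0 z] by simp
      then show zx: "nrm (z - x) < 2 * K" using nrm_triangle_diff[of z x p] nrm_commute[of z p] px by linarith
      then show "z \<in> thick (8 * K) ?D" unfolding mem_thick using x(2) K0 by (intro bexI[of _ x]) auto
      show "z \<notin> ?D"
      proof
        assume "z \<in> ?D"
        then have "p \<in> ?D" using abs_piece_saturated[OF y, of z j u p] z same_cell_sym by blast
        then show False using min[OF j] by blast
      qed
    qed
    have clear: "z \<notin> abs_piece y j' u'" if j': "j' < n" and z: "same_cell K (p - u) (z - u)" for j' u' z
    proof
      let ?D' = "abs_piece y j' u'"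
      assume zD: "z \<in> ?D'"
      then have neD': "?D' \<noteq> {}" by auto
      consider "j' < j" | "j' = j" | "j < j'" by linarith
      then show False
      proof cases
        case 1
        have "x \<in> thick (8 * K) ?D'" unfolding mem_thick
          using zD cellD(3)[OF z] K0 nrm_commute[of x z] by (intro bexI[of _ z]) auto
        then have "thick (8 * K) ?D' \<subseteq> ?D" using x(2) by (intro abs_piece_closed[OF y neD 1]) blast
        moreover have "?D' \<subseteq> thick (8 * K) ?D'" by (rule subset_thick) (use K0 in simp)
        ultimately show False using zD cellD(2)[OF z] by blast
      next
        case 2
        have "nrm (x - u) \<le> 3 * r j" "nrm (z - u') \<le> 3 * r j"
          using abs_piece_bounds(3)[OF y neD] abs_piece_bounds(3)[OF y neD'] x(2) zD 2 by auto
        then have "nrm (u - u') < 6 * r j + 2 * K"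
          using nrm_triangle_diff[of u u' x] nrm_triangle_diff[of x u' z] nrm_commute[of u x] nrm_commute[of x z] cellD(3)[OF z]
          by linarith
        moreover have "8 * K \<le> r j" using rho_ge[of "Suc j"] by (simp add: r_def)
        ultimately have "nrm (u - u') < 98 * r j" using r_pos[of j] by linarith
        then have "u = u'" using abs_piece_sep[OF y, of j u u'] neD neD' 2 by force
        then show False using zD 2 cellD(2)[OF z] by simp
      next
        case 3
        have "thick (8 * K) ?D \<subseteq> ?D'" using zD cellD(1)[OF z] by (intro abs_piece_closed[OF y neD' 3]) blast
        moreover have "p \<in> thick (8 * K) ?D" unfolding mem_thick using x(2) px K0 by (intro bexI[of _ x]) auto
        ultimately show False using min[OF j'] by blast
      qed
    qed
    have "\<exists>i. i \<in> slots n (shift v y) \<and> nrm (v + scaled s i - p) \<le> K"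
      by (rule slot_in_cell[of p u]) (use cellD(1) DC clear in blast)+
    then show ?thesis using ne by blast
  qed
qed

definition marked :: "(int^'d \<Rightarrow> 'a) \<Rightarrow> int^'d \<Rightarrow> bool" where
  "marked x v \<longleftrightarrow> (\<forall>i\<in>marker_array. \<forall>e\<in>box_d 1 (int a). x (v + scaled s i + e) = w e)"

lemma anchor_marked:
  assumes y: "y \<in> Z" and ne: "abs_piece y n v \<noteq> {}" shows "marked (phi y) v"
  unfolding marked_def
proof (intro ballI)
  fix i e :: "int^'d" assume i: "i \<in> marker_array" and e: "e \<in> box_d 1 (int a)"
  have anc: "anchor n (shift v y)" using ne abs_piece_ne_anchor[OF y] by simp
  have "marker_array \<subseteq> box_d (-1) (6 * int k + 1)" unfolding marker_array_def by (rule box_d_mono) auto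
  then have "i \<in> slots n (shift v y)" using marker_array_slots[OF shift_Z[OF y] anc] i by blast
  from phi_slot[OF y ne this e] show "phi y (v + scaled s i + e) = w e" using i by (simp add: assign_def)
qed

text \<open>An array of markers contains a code box; by the choice of the code that box is a marker box of
  some piece and the two arrays are aligned; if they were distinct, the array would also contain a box
  just outside the marker array of the piece, which does not carry the marker word.\<close>

lemma marked_anchor:
  assumes y: "y \<in> Z" and mk: "marked (phi y) v'"
  shows "\<exists>n. abs_piece y n v' \<noteq> {}"
proof -
  have mkD: "phi y (v' + scaled s c + e) = w e" if "c \<in> marker_array" "e \<in> box_d 1 (int a)" for c e
    using mk that by (simp add: marked_def)
  \<comment> \<open>The target is the middle of the array at \<open>v'\<close>, which has extent
    \<open>6 * k * s = 2 * K\<close>. A slot within \<open>K\<close> of it is based inside the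
    array.\<close>
  obtain n v i where ne: "abs_piece y n v \<noteq> {}" and i: "i \<in> slots n (shift v y)"
    and near: "nrm (v + scaled s i - (v' + (\<chi> l. K))) \<le> K" using slot_near[OF y] by blast
  have anc: "anchor n (shift v y)" using ne abs_piece_ne_anchor[OF y] by simp
  define u where "u = v + scaled s i"
  define q where "q = assign n (shift v y) i"
  have q: "q \<in> insert w Q" unfolding q_def by (rule assign_mem(1)[OF shift_Z[OF y] anc i])
  have phiu: "phi y (u + e) = q e" if "e \<in> box_d 1 (int a)" for e
    unfolding u_def q_def by (rule phi_slot[OF y ne i that])
  have ub: "0 \<le> u$l - v'$l" "u$l - v'$l \<le> int s * (6 * int k)" for l
  proof -
    have "\<bar>(u - (v' + (\<chi> l. K)))$l\<bar> \<le> K" using comp_le_nrm near order_trans unfolding u_def by blast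
    then have "0 \<le> u$l - v'$l" "u$l - v'$l \<le> 2 * K" by auto
    moreover have "2 * K = int s * (6 * int k)" by (simp add: K_def)
    ultimately show "0 \<le> u$l - v'$l" "u$l - v'$l \<le> int s * (6 * int k)" by auto
  qed
  have arrI: "c \<in> marker_array" if "\<And>l. - int s < int s * c$l" "\<And>l. int s * c$l < int s * (6 * int k) + int s" for c :: "int^'d"
  proof -
    have "0 \<le> c$l \<and> c$l \<le> 6 * int k" for l
    proof -
      have "int s * (-1) < int s * c$l" using that(1)[of l] by simp
      moreover have "int s * c$l < int s * (6 * int k + 1)" using that(2)[of l] by (simp add: distrib_left)
      ultimately have "- 1 < c$l" "c$l < 6 * int k + 1" using s_pos by (simp_all only: mult_less_cancel_left_pos of_nat_0_less_iff)
      then show ?thesis by linarith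
    qed
    then show ?thesis by (simp add: marker_array_def box_d_def)
  qed
  have "compat a s w q (v' - u)" unfolding compat_def
  proof (intro ballI impI)
    fix p assume p: "p \<in> box_d 1 (int a)" and p': "rep s (p - (v' - u)) \<in> box_d 1 (int a)"
    let ?p = "rep s (p - (v' - u))"
    obtain c where c: "p - (v' - u) - ?p = (\<chi> l. int s * c$l)" by (rule rep_diff_eq)
    then have up: "u + p = v' + scaled s c + ?p" by (simp add: scaled_def algebra_simps)
    have "c \<in> marker_array"
    proof (rule arrI)
      fix l
      have "int s * c$l = (p - (v' - u) - ?p)$l" using c by simp
      then have e: "int s * c$l = (u$l - v'$l) + p$l - ?p$l" by simp
      have "1 \<le> p$l" "p$l \<le> int a" "1 \<le> ?p$l" "?p$l \<le> int a" using p p' by (auto simp: box_d_def)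
      then show "- int s < int s * c$l" "int s * c$l < int s * (6 * int k) + int s"
        using e ub[of l] a_s by linarith+
    qed
    then show "q p = w ?p" using mkD[OF _ p', of c] phiu[OF p] up by simp
  qed
  then have dv: "int s dvd (v' - u)$l" for l using no_compat[OF q] by blast
  define c0 where "c0 = ((\<chi> l. (v' - u)$l div int s) :: int^'d)"
  have v'u: "v' = u + scaled s c0" using dv by (simp add: c0_def vec_eq_iff)
  have mc0: "- c0 \<in> marker_array"
  proof (rule arrI)
    fix l
    have "int s * (- c0)$l = u$l - v'$l" using v'u by simp
    then show "- int s < int s * (- c0)$l" "int s * (- c0)$l < int s * (6 * int k) + int s" using ub[of l] s_pos by linarith+
  qed
  have "q = w"
  proof (rule word_eqI[OF q])
    fix e :: "int^'d" assume e: "e \<in> box_d 1 (int a)"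
    have "v' + scaled s (- c0) = u" by (simp add: v'u vec_eq_iff)
    then show "q e = w e" using mkD[OF mc0 e] phiu[OF e] by simp
  qed simp
  then have i_arr: "i \<in> marker_array" using assign_mem(2)[OF shift_Z[OF y] anc i] w_Q unfolding q_def by metis
  define i1 where "i1 = i + c0"
  have v'v: "v' = v + scaled s i1" by (simp add: v'u u_def i1_def vec_eq_iff distrib_left)
  have ii: "0 \<le> i$l" "i$l \<le> 6 * int k" "0 \<le> i$l - i1$l" "i$l - i1$l \<le> 6 * int k" for l
    using i_arr mc0 unfolding marker_array_def box_d_def i1_def by (auto dest!: spec[of _ l])
  have "i1 = 0"
  proof (rule ccontr)
    assume "i1 \<noteq> 0"
    then obtain l where l: "i1$l \<noteq> 0" by (auto simp: vec_eq_iff)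
    \<comment> \<open>Move the aligned box along coordinate \<open>l\<close> into the layer just
      outside the array of the piece, on the side towards which the array at \<open>v'\<close> is
      displaced. It then still belongs to the array at \<open>v'\<close>.\<close>
    define h where "h = (if 0 < i1$l then 6 * int k + 1 else -1)"
    define i2 where "i2 = ((\<chi> l'. if l' = l then h else i$l') :: int^'d)"
    have hb: "-1 \<le> h" "h \<le> 6 * int k + 1" "\<not> (0 \<le> h \<and> h \<le> 6 * int k)" "0 \<le> h - i1$l" "h - i1$l \<le> 6 * int k"
      using l ii[of l] by (auto simp: h_def)
    have "-1 \<le> i2$l' \<and> i2$l' \<le> 6 * int k + 1" for l' using hb ii[of l'] by (auto simp: i2_def)
    then have i2s: "i2 \<in> slots n (shift v y)"
      using marker_array_slots[OF shift_Z[OF y] anc] by (auto simp: box_d_def)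
    have "i2 \<notin> marker_array"
    proof
      assume "i2 \<in> marker_array"
      then have "0 \<le> i2$l \<and> i2$l \<le> 6 * int k" unfolding marker_array_def box_d_def by blast
      then show False using hb by (simp add: i2_def)
    qed
    then have aQ: "assign n (shift v y) i2 \<in> Q" by (rule assign_mem(2)[OF shift_Z[OF y] anc i2s])
    have "0 \<le> (i2 - i1)$l' \<and> (i2 - i1)$l' \<le> 6 * int k" for l' using hb ii[of l'] by (auto simp: i2_def)
    then have i21: "i2 - i1 \<in> marker_array" by (simp add: marker_array_def box_d_def)
    have e: "v + scaled s i2 = v' + scaled s (i2 - i1)" by (simp add: v'v vec_eq_iff right_diff_distrib)
    have "assign n (shift v y) i2 = w"
    proof (rule word_eqI)
      fix x :: "int^'d" assume x: "x \<in> box_d 1 (int a)"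
      show "assign n (shift v y) i2 x = w x" using phi_slot[OF y ne i2s x] mkD[OF i21 x] e by simp
    qed (use aQ in auto)
    then show False using aQ w_Q by simp
  qed
  then have "v' = v" using v'v by (simp add: vec_eq_iff)
  then show ?thesis using ne by blast
qed

section \<open>Recovering the pieces and the point\<close>

lemma near_cong:
  assumes "\<And>j u. j < n \<Longrightarrow> abs_piece y j u = abs_piece y' j u"
  shows "near n (shift v y) = near n (shift v y')"
proof (intro ext)
  fix j u show "near n (shift v y) j u = near n (shift v y') j u"
    by (simp add: near_eq abs_piece_shift assms)
qed

text \<open>A piece contains a cube around its anchor, whereas an anchor of higher level is clear of
  all smaller pieces.\<close>

lemma anchor_level_unique:
  assumes y: "y \<in> Z" and "abs_piece y n v \<noteq> {}" "abs_piece y n' v \<noteq> {}" shows "n = n'"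
proof -
  have *: "\<not> n' < n" if "abs_piece y n v \<noteq> {}" "abs_piece y n' v \<noteq> {}" for n n'
  proof
    assume lt: "n' < n"
    have "cb v (2 * r n') \<subseteq> abs_piece y n' v" by (rule abs_piece_bounds(1)[OF y that(2)])
    moreover have "v \<in> cb v (2 * r n')" "v \<in> cb v (4 * r n')" using r_pos[of n'] by simp_all
    ultimately show False using abs_piece_clear[OF y that(1) lt, of v] by blast
  qed
  show ?thesis using *[OF assms(2,3)] *[OF assms(3,2)] by simp
qed

text \<open>The marker array shows that \<open>v\<close> is an anchor for \<open>y'\<close> as well,
  at some level \<open>n'\<close>. Lower levels are excluded by the induction hypothesis. If
  \<open>n'\<close> were larger, then \<open>level_slot n\<close>, which depends only on pieces
  below level \<open>n\<close>, would be the same box for both points, but it would hold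
  \<open>q1\<close> for one and \<open>q0\<close> for the other.\<close>

lemma level_transfer:
  assumes y: "y \<in> Z" and y': "y' \<in> Z" and eq: "phi y = phi y'"
    and IH: "\<And>j u. j < n \<Longrightarrow> abs_piece y j u = abs_piece y' j u" and ne: "abs_piece y n v \<noteq> {}"
  shows "abs_piece y' n v = abs_piece y n v"
proof -
  have "marked (phi y') v" using anchor_marked[OF y ne] eq by simp
  then obtain n' where n': "abs_piece y' n' v \<noteq> {}" using marked_anchor[OF y'] by blast
  have anc: "anchor n (shift v y)" "anchor n' (shift v y')"
    using ne n' abs_piece_ne_anchor[OF y] abs_piece_ne_anchor[OF y'] by auto
  have nr: "near n (shift v y) = near n (shift v y')" by (rule near_cong[OF IH])
  have "n' = n"
  proof (rule linorder_cases[of n' n])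
    assume "n' < n"
    then have "abs_piece y n' v \<noteq> {}" using IH n' by simp
    then show ?thesis using anchor_level_unique[OF y ne] by simp
  next
    assume lt: "n < n'"
    define i where "i = level_slot n (shift v y)"
    have i': "i = level_slot n (shift v y')" unfolding i_def level_slot_def nr ..
    have i1: "i \<in> slots n (shift v y)" unfolding i_def by (rule level_slot_slots[OF shift_Z[OF y] anc(1) order_refl])
    have i2: "i \<in> slots n' (shift v y')" unfolding i' by (rule level_slot_slots[OF shift_Z[OF y'] anc(2)]) (use lt in simp)
    have na: "i \<notin> marker_array" unfolding i_def by (rule level_slot_notin_arr[OF shift_Z[OF y]])
    have "i \<noteq> level_slot n' (shift v y')" unfolding i' by (rule level_slot_inj[OF shift_Z[OF y']]) (use lt in simp)
    moreover have "\<exists>j\<le>n'. i = level_slot j (shift v y')" using i' lt by (intro exI[of _ n]) simp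
    ultimately have a2: "assign n' (shift v y') i = q0" using na unfolding assign_def by simp
    have a1: "assign n (shift v y) i = q1" using na i_def unfolding assign_def by auto
    have "q1 = q0"
    proof (rule word_eqI)
      fix e :: "int^'d" assume e: "e \<in> box_d 1 (int a)"
      show "q1 e = q0 e" using phi_slot[OF y ne i1 e] phi_slot[OF y' n' i2 e] a1 a2 eq by simp
    qed (use q01 in auto)
    then show ?thesis using q01 by simp
  qed simp
  then have "piece n (shift v y') = piece n (shift v y)" using anc by (simp add: piece_eq nr)
  then show ?thesis by (simp add: abs_piece_def)
qed

lemma pieces_determined:
  assumes y: "y \<in> Z" and y': "y' \<in> Z" and eq: "phi y = phi y'"
  shows "abs_piece y n v = abs_piece y' n v"
proof (induction n arbitrary: v rule: less_induct)
  case (less n)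
  show ?case
  proof (cases "abs_piece y n v = {}")
    case False
    then show ?thesis using level_transfer[OF y y' eq less] by simp
  next
    case True
    show ?thesis
    proof (cases "abs_piece y' n v = {}")
      case False
      then show ?thesis using level_transfer[OF y' y eq[symmetric] less[symmetric]] by simp
    qed (use True in simp)
  qed
qed

text \<open>Take the least level with a piece within \<open>2 * s\<close> of \<open>p\<close>. The
  cell at \<open>p\<close> is then within \<open>3 * s\<close> of that piece, and a smaller piece
  within \<open>s\<close> of the cell's base point would itself be within \<open>2 * s\<close> of
  \<open>p\<close>.\<close>

lemma cells_cover:
  assumes y: "y \<in> Z"
  shows "\<exists>n v i. abs_piece y n v \<noteq> {} \<and> i \<in> cells n (shift v y) \<and> p - v - scaled s i \<in> box_d 1 (int s)"
proof -
  have sub: "abs_piece y n v \<subseteq> thick (2 * int s) (abs_piece y n v)" for n v by (rule subset_thick) simp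
  define n where "n = (LEAST n. \<exists>v. p \<in> thick (2 * int s) (abs_piece y n v))"
  have "\<exists>n v. p \<in> thick (2 * int s) (abs_piece y n v)" using piece_cover[OF y, of p] sub by blast
  then have "\<exists>v. p \<in> thick (2 * int s) (abs_piece y n v)" unfolding n_def by (rule LeastI_ex)
  then obtain v z where z: "z \<in> abs_piece y n v" "nrm (p - z) \<le> 2 * int s" by (auto simp: mem_thick)
  define i where "i = ((\<chi> l. ((p - v)$l - 1) div int s) :: int^'d)"
  have i: "p - v - scaled s i \<in> box_d 1 (int s)" unfolding i_def by (rule scaled_approx[OF s_pos])
  have ni: "nrm (p - v - scaled s i) \<le> int s" by (rule box_d_nrm[OF i]) auto
  have "i \<in> cells n (shift v y)" unfolding cells_def
  proof (intro CollectI conjI allI notI)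
    have "nrm (scaled s i - (z - v)) \<le> 3 * int s"
    proof -
      have "nrm (scaled s i - (z - v)) \<le> nrm (scaled s i - (p - v)) + nrm ((p - v) - (z - v))" by (rule nrm_triangle_diff)
      then show ?thesis using ni nrm_commute[of "scaled s i" "p - v"] z(2) by simp
    qed
    then show "scaled s i \<in> thick (3 * int s) (piece n (shift v y))"
      unfolding mem_thick using z(1) by (intro bexI[of _ "z - v"]) (simp_all add: mem_abs_piece)
    fix j u assume "scaled s i \<in> thick (int s) (near n (shift v y) j u)"
    then obtain x where x: "x \<in> near n (shift v y) j u" "nrm (scaled s i - x) \<le> int s" by (auto simp: mem_thick)
    have j: "j < n" using x(1) near_empty_ge[of n j "shift v y" u] by (cases "j < n") auto
    have "v + x \<in> abs_piece y j (v + u)" using x(1) near_subset[of n "shift v y" j u] by (auto simp: mem_abs_piece_shift)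
    moreover have "nrm (p - (v + x)) \<le> 2 * int s"
    proof -
      have "p - v - scaled s i + (scaled s i - x) = p - (v + x)" by (simp add: algebra_simps)
      then have "nrm (p - (v + x)) \<le> nrm (p - v - scaled s i) + nrm (scaled s i - x)"
        using nrm_triangle[of "p - v - scaled s i" "scaled s i - x"] by (simp only:)
      then show ?thesis using ni x(2) by linarith
    qed
    ultimately have "\<exists>u. p \<in> thick (2 * int s) (abs_piece y j u)" unfolding mem_thick by blast
    then show False using j not_less_Least[of j "\<lambda>n. \<exists>v. p \<in> thick (2 * int s) (abs_piece y n v)"] unfolding n_def by blast
  qed
  then show ?thesis using z(1) i by blast
qed

text \<open>Equal pieces give equal cells and data boxes, hence the same coder. Its injectivity
  returns the windows of the point at all cells of all pieces.\<close>

lemma phi_inj: "inj_on phi Z"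
proof (rule inj_onI)
  fix y y' assume y: "y \<in> Z" and y': "y' \<in> Z" and eq: "phi y = phi y'"
  note pe = pieces_determined[OF y y' eq]
  show "y = y'"
  proof
    fix p
    obtain n v i where ne: "abs_piece y n v \<noteq> {}" and i: "i \<in> cells n (shift v y)"
      and e: "p - v - scaled s i \<in> box_d 1 (int s)" using cells_cover[OF y] by blast
    let ?y = "shift v y" and ?y' = "shift v y'"
    have ne': "abs_piece y' n v \<noteq> {}" using ne pe by simp
    have anc: "anchor n ?y" "anchor n ?y'" using ne ne' abs_piece_ne_anchor[OF y] abs_piece_ne_anchor[OF y'] by auto
    have nr: "near j ?y = near j ?y'" for j by (rule near_cong[OF pe])
    have pc: "piece n ?y = piece n ?y'" using anc by (simp add: piece_eq nr)
    have be: "level_slot j ?y = level_slot j ?y'" for j by (simp add: level_slot_def nr)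
    have sl: "slots n ?y = slots n ?y'" by (simp add: slots_def nr pc)
    have ce: "cells n ?y = cells n ?y'" by (simp add: cells_def nr pc)
    have da: "data n ?y = data n ?y'" by (simp add: data_def sl be)
    let ?f = "coder (cells n ?y) (data n ?y)"
    have mem: "?f (info n ?y) \<in> PiE (data n ?y) (\<lambda>_. Q)" "?f (info n ?y') \<in> PiE (data n ?y) (\<lambda>_. Q)"
      using coder(1)[OF shift_Z[OF y] anc(1)] info_PiE[OF shift_Z[OF y] anc(1)] info_PiE[OF shift_Z[OF y'] anc(2)]
      unfolding ce[symmetric] by blast+
    have "?f (info n ?y) = ?f (info n ?y')"
    proof (rule PiE_ext[OF mem])
      fix d assume d: "d \<in> data n ?y"
      then have ds: "d \<in> slots n ?y" and dn: "d \<notin> marker_array" "\<not> (\<exists>j\<le>n. d = level_slot j ?y)" by (auto simp: data_def)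
      show "?f (info n ?y) d = ?f (info n ?y') d"
      proof (rule word_eqI)
        show "?f (info n ?y) d \<in> insert w Q" "?f (info n ?y') d \<in> insert w Q" using mem d by auto
        fix x :: "int^'d" assume x: "x \<in> box_d 1 (int a)"
        have "assign n ?y d = ?f (info n ?y) d" unfolding assign_def using dn by (simp only: if_False)
        moreover have "assign n ?y' d = ?f (info n ?y') d"
          unfolding assign_def be[symmetric] ce[symmetric] da[symmetric] using dn by (simp only: if_False)
        moreover have "assign n ?y d x = assign n ?y' d x"
          using phi_slot[OF y ne ds x] phi_slot[OF y' ne' _ x, of d] ds eq sl by simp
        ultimately show "?f (info n ?y) d x = ?f (info n ?y') d x" by simp
      qed
    qed
    then have "info n ?y = info n ?y'"
      using coder(2)[OF shift_Z[OF y] anc(1)] info_PiE[OF shift_Z[OF y] anc(1)] info_PiE[OF shift_Z[OF y'] anc(2)]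
      unfolding ce[symmetric] by (simp add: inj_on_eq_iff)
    from fun_cong[OF fun_cong[OF this, of i], of "p - v - scaled s i"]
    show "y p = y' p" using i e ce by (simp add: info_def shift_apply)
  qed
qed

end

section \<open>Choice of the parameters and conclusion\<close>

theorem theorem9p1:
  fixes X :: "(int^'d \<Rightarrow> 'a::finite) set"
    and Y :: "(int^'d \<Rightarrow> 'b::finite) set"
    and P :: "(int^'d) set \<Rightarrow> (int^'d \<Rightarrow> 'a) set"
    and k m :: nat
  assumes "CARD('d) \<ge> 2"
    and "symbolic_system X"
    and "family_of_patterns X k P"
    and "property_F X k P m"
    and "shift_space Y"
    and "ereal (htop Y) < family_entropy k P"
  shows "\<exists>\<phi>. \<phi> \<in> measurable (restrict_space (borel_of config_topology) (Free Y))
                               (borel_of config_topology)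
            \<and> inj_on \<phi> (Free Y) \<and> \<phi> ` Free Y \<subseteq> X
            \<and> (\<forall>y\<in>Free Y. \<forall>\<gamma>. \<phi> (shift \<gamma> y) = shift \<gamma> (\<phi> y))"
proof -
  let ?Z = "Free Y"
  have inv: "shift_invariant Y" using assms(5) by (simp add: shift_space_def)
  interpret free_system ?Z
  proof
    fix y \<gamma> assume y: "y \<in> ?Z"
    have "shift \<delta> (shift \<gamma> y) \<noteq> shift \<gamma> y" if "\<delta> \<noteq> 0" for \<delta>
    proof
      assume "shift \<delta> (shift \<gamma> y) = shift \<gamma> y"
      then have "shift (- \<gamma>) (shift \<delta> (shift \<gamma> y)) = shift (- \<gamma>) (shift \<gamma> y)" by simp
      then have "shift \<delta> y = y" by (simp add: shift_shift)
      then show False using y that by (simp add: Free_def)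
    qed
    then show "shift \<gamma> y \<in> ?Z" using y inv by (auto simp: Free_def shift_invariant_def)
    show "\<gamma> \<noteq> 0 \<Longrightarrow> shift \<gamma> y \<noteq> y" using y by (simp add: Free_def)
  qed
  obtain s a b w Q where cb: "k dvd a" "0 < a" "a + 2 * m + 1 \<le> s" "1 \<le> b"
    "card (lang Y (box_d 1 (int s))) \<le> b" "w \<in> P (box_d 1 (int a))" "Q \<subseteq> P (box_d 1 (int a))" "w \<notin> Q"
    "finite Q" "2 * b \<le> card Q"
    "\<And>q t. q \<in> insert w Q \<Longrightarrow> \<exists>l. \<not> int s dvd t$l \<Longrightarrow> \<not> compat a s w q t"
    by (rule codebook_exists[OF assms(1,3) inv assms(6)]) (rule that)
  have k: "0 < k" using assms(3) by (simp add: family_of_patterns_def)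
  define K where "K = 3 * int s * int k"
  have "0 < int s * int k" using cb(3) k by simp
  then have K: "1 \<le> K" by (simp add: K_def)
  have "2 \<le> card Q" using cb(4,10) by linarith
  then have "\<not> (\<forall>q\<in>Q. \<forall>q'\<in>Q. q = q')" using card_le_Suc0_iff_eq[OF cb(9)] by linarith
  then obtain q0 q1 where q01: "q0 \<in> Q" "q1 \<in> Q" "q0 \<noteq> q1" by blast
  obtain \<rho> :: "nat \<Rightarrow> int" where \<rho>: "\<rho> 0 = 8 * K" "\<And>n. 64 * \<rho> n \<le> \<rho> (Suc n)"
    "\<And>n. (b + 1) * (nat (2 * (2 * \<rho> (Suc n) + 8 * \<rho> n + 3 * int s) + 1) ^ CARD('d)
        - nat (2 * (2 * \<rho> (Suc n) - int s) + 1) ^ CARD('d) + ((6 * k + 1) ^ CARD('d) + 1 + n))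
     \<le> nat (\<rho> (Suc n) div (40 * \<rho> n)) ^ CARD('d)"
    by (rule scales_exist[of "int s" "CARD('d)" "8 * K" "b + 1" "(6 * k + 1) ^ CARD('d) + 1"])
      (use K assms(1) that in simp_all)
  interpret scales \<rho> K
    by unfold_locales (use K \<rho> in auto)
  obtain M :: "nat \<Rightarrow> _" where M: "\<And>n. borel_pred (M n)"
    "\<And>n y \<gamma>. y \<in> ?Z \<Longrightarrow> M n y \<Longrightarrow> M n (shift \<gamma> y) \<Longrightarrow> \<gamma> \<noteq> 0 \<Longrightarrow> 100 * r n < nrm \<gamma>"
    "\<And>y. y \<in> ?Z \<Longrightarrow> \<exists>c::nat. \<forall>n0. \<exists>n\<ge>n0. \<exists>\<gamma>. nrm \<gamma> \<le> r n + int c \<and> M n (shift \<gamma> y)"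
    by (rule markers_exist[of r, OF r_pos]) (rule that)
  have lang: "card (lang ?Z (box_d 1 (int s))) \<le> b"
  proof -
    have "lang ?Z (box_d 1 (int s)) \<subseteq> lang Y (box_d 1 (int s))" by (auto simp: lang_def Free_def)
    then have "card (lang ?Z (box_d 1 (int s))) \<le> card (lang Y (box_d 1 (int s)))"
      by (intro card_mono finite_lang) simp
    then show ?thesis using cb(5) by simp
  qed
  interpret coding ?Z \<rho> K M X P k m s a b w q0 q1 Q
    by unfold_locales (fact assms M K_def cb lang q01 \<rho>)+
  show ?thesis
  proof (intro exI[of _ phi] conjI ballI allI)
    show "phi \<in> measurable N (borel_of config_topology)" by (rule phi_measurable)
    show "inj_on phi ?Z" by (rule phi_inj)
    show "phi ` ?Z \<subseteq> X" using phi_in_X by auto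
  qed (rule phi_shift)
qed

end
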